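(* Let $\mathcal{C}$ be the set of $f\in\mathrm{Diff}^2_+([0,1])$ such that for every integer $k\ge2$ there exists $h\in\mathrm{Diff}^2_+([0,1])$ with $hfh^{-1}=f^k$. Then $\mathcal{C}$ is a dense subset of $\mathrm{Diff}^2_V([0,1])$, i.e. $\mathcal{C}\subset\mathrm{Diff}^2_V([0,1])$ and $\mathcal{C}$ is dense in $\mathrm{Diff}^2_V([0,1])$ for the $C^2$ topology.
   Context: $\mathrm{Diff}^2_+([0,1])$ is the group of orientation-preserving $C^2$ diffeomorphisms of $[0,1]$, with the $C^2$ topology given by the distance $\|f-g\|_2=\max_{x\in[0,1]}|D^{2}f(x)-D^{2}g(x)|$. For such $f$, let $V(f)$ be the total variation of $\log Df$ on $[0,1]$. The asymptotic variation of $f$ is $V_\infty(f)=\lim_{n\to\infty}V(f^n)/n$ (the limit exists by subadditivity). $\mathrm{Diff}^2_V([0,1])=\{f\in\mathrm{Diff}^2_+([0,1]): V_\infty(f)=0\}$, with the induced topology. *)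

theory Defs
  imports "HOL-Analysis.Analysis" "HOL-Algebra.Bij"
begin

text \<open>Derivatives are taken relative to \<open>[0,1]\<close>, hence are one-sided at the endpoints.\<close>

definition D1 :: "(real \<Rightarrow> real) \<Rightarrow> real \<Rightarrow> real" where
  "D1 f x = vector_derivative f (at x within {0..1})"

definition D2 :: "(real \<Rightarrow> real) \<Rightarrow> real \<Rightarrow> real" where
  "D2 f = D1 (D1 f)"

definition C2_unit :: "(real \<Rightarrow> real) \<Rightarrow> bool" where
  "C2_unit f \<longleftrightarrow> f differentiable_on {0..1} \<and> D1 f differentiable_on {0..1}
     \<and> continuous_on {0..1} (D2 f)"

text \<open>Members of \<open>Bij {0..1}\<close> are extensional, i.e. \<open>undefined\<close> outside \<open>[0,1]\<close>, so that
  equality of diffeomorphisms is equality on \<open>[0,1]\<close>. The group operations are those of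
  \<open>BijGroup {0..1}\<close>: multiplication is composition \<open>g \<circ> f\<close> restricted to \<open>[0,1]\<close>.\<close>

definition Diff2 :: "(real \<Rightarrow> real) set" where
  "Diff2 = {f \<in> Bij {0..1}. strict_mono_on {0..1} f \<and> C2_unit f
              \<and> C2_unit (inv\<^bsub>BijGroup {0..1}\<^esub> f)}"

text \<open>The value outside \<open>Diff2\<close> is irrelevant; the locale \<open>Metric_space\<close>
  demands nonnegativity for all arguments.\<close>

definition C2_dist :: "(real \<Rightarrow> real) \<Rightarrow> (real \<Rightarrow> real) \<Rightarrow> real" where
  "C2_dist f g =
     (if f \<in> Diff2 \<and> g \<in> Diff2 then SUP x\<in>{0..1}. \<bar>D2 f x - D2 g x\<bar> else 0)"

definition Diff2_topology :: "(real \<Rightarrow> real) topology" where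
  "Diff2_topology = Metric_space.mtopology Diff2 C2_dist"

definition total_variation :: "(real \<Rightarrow> real) \<Rightarrow> real \<Rightarrow> real \<Rightarrow> real" where
  "total_variation g a b =
     (SUP (n, t) \<in> {(n::nat, t). t 0 = a \<and> t n = b \<and> mono_on {..n} t}.
        \<Sum>i<n. \<bar>g (t (Suc i)) - g (t i)\<bar>)"

definition log_variation :: "(real \<Rightarrow> real) \<Rightarrow> real" where
  "log_variation f = total_variation (\<lambda>x. ln (D1 f x)) 0 1"

definition asymptotic_variation :: "(real \<Rightarrow> real) \<Rightarrow> real" where
  "asymptotic_variation f =
     lim (\<lambda>n::nat. log_variation (f [^]\<^bsub>BijGroup {0..1}\<^esub> n) / real n)"

definition Diff2_V :: "(real \<Rightarrow> real) set" where
  "Diff2_V = {f \<in> Diff2. asymptotic_variation f = 0}"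

definition conj_to_powers :: "(real \<Rightarrow> real) set" where
  "conj_to_powers = {f \<in> Diff2. \<forall>k::nat. k \<ge> 2 \<longrightarrow>
     (\<exists>h\<in>Diff2. h \<otimes>\<^bsub>BijGroup {0..1}\<^esub> f \<otimes>\<^bsub>BijGroup {0..1}\<^esub> inv\<^bsub>BijGroup {0..1}\<^esub> h
        = f [^]\<^bsub>BijGroup {0..1}\<^esub> k)}"

lemma D1_eqI:
  assumes "(f has_real_derivative d) (at x within {0..1})" "x \<in> {0..1}"
  shows "D1 f x = d"
  using assms vector_derivative_within_cbox[where a="0::real" and b=1 and f=f and f'=d and x=x]
  by (simp add: D1_def has_real_derivative_iff_has_vector_derivative)

lemma has_D1:
  assumes "f differentiable_on {0..1}" "x \<in> {0..1}"
  shows "(f has_real_derivative D1 f x) (at x within {0..1})"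
proof -
  from assms obtain d where "(f has_real_derivative d) (at x within {0..1})"
    using differentiable_on_def real_differentiable_def by blast
  with D1_eqI[OF this assms(2)] show ?thesis by simp
qed

lemma D1_cong:
  assumes "\<And>x. x \<in> {0..1} \<Longrightarrow> f x = g x" "x \<in> {0..1}" "g differentiable_on {0..1}"
  shows "D1 f x = D1 g x"
  using assms(1,2) has_D1[OF assms(3,2)]
  by (intro D1_eqI) (auto intro: has_field_derivative_transform_within[where d=1])

lemma C2_unitI:
  assumes "\<And>x. x \<in> {0..1} \<Longrightarrow> (f has_real_derivative f' x) (at x within {0..1})"
    and "\<And>x. x \<in> {0..1} \<Longrightarrow> (f' has_real_derivative f'' x) (at x within {0..1})"
    and "continuous_on {0..1} f''"
  shows "C2_unit f"
proof -
  have e1: "D1 f x = f' x" if "x \<in> {0..1}" for x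
    using D1_eqI assms(1) that by blast
  have d: "(D1 f has_real_derivative f'' x) (at x within {0..1})" if x: "x \<in> {0..1}" for x
    using e1 assms(2)[OF x] x
    by (auto intro: has_field_derivative_transform_within[where d=1 and f=f'])
  have "D2 f x = f'' x" if "x \<in> {0..1}" for x
    unfolding D2_def using D1_eqI d that by blast
  then have "continuous_on {0..1} (D2 f)"
    using assms(3) continuous_on_cong[of "{0..1}" "{0..1}" "D2 f" f''] by blast
  then show ?thesis
    using assms(1) d unfolding C2_unit_def differentiable_on_def
    by (meson real_differentiable_def)
qed

lemma C2_dist_bdd:
  assumes "C2_unit f" "C2_unit g"
  shows "bdd_above ((\<lambda>x. \<bar>D2 f x - D2 g x\<bar>) ` {0..1})"
  using assms unfolding C2_unit_def
  by (intro bounded_imp_bdd_above compact_imp_bounded compact_continuous_image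
        continuous_intros) auto

lemma const_of_D1_eq:
  assumes "f differentiable_on {0..1}" "g differentiable_on {0..1}"
    and "\<And>x. x \<in> {0..1} \<Longrightarrow> D1 f x = D1 g x"
  obtains c where "\<And>x. x \<in> {0..1} \<Longrightarrow> f x = g x + c"
proof -
  have "((\<lambda>x. f x - g x) has_real_derivative 0) (at x within {0..1})" if "x \<in> {0..1}" for x
    using DERIV_diff[OF has_D1[OF assms(1) that] has_D1[OF assms(2) that]] assms(3)[OF that]
    by simp
  then obtain c where "\<And>x. x \<in> {0..1} \<Longrightarrow> f x - g x = c"
    using has_field_derivative_zero_constant[of "{0..1::real}" "\<lambda>x. f x - g x"] by auto
  then show ?thesis by (intro that[of c]) (auto simp: algebra_simps)
qed

lemma Diff2_endpoints:
  assumes "f \<in> Diff2"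
  shows "f 0 = 0" "f 1 = 1"
proof -
  have b: "bij_betw f {0..1} {0..1}" and m: "strict_mono_on {0..1} f"
    using assms by (auto simp: Diff2_def Bij_def)
  have im: "f ` {0..1} = {0..1}" using b by (simp add: bij_betw_def)
  from im obtain x where x: "x \<in> {0..1}" "f x = 0" by (metis atLeastAtMost_iff imageE order_refl zero_le_one)
  from im obtain y where y: "y \<in> {0..1}" "f y = 1" by (metis atLeastAtMost_iff imageE order_refl zero_le_one)
  have r: "f z \<in> {0..1}" if "z \<in> {0..1}" for z using im that by blast
  show "f 0 = 0"
    using strict_mono_onD[OF m, of 0 x] x r[of 0] by (cases "x = 0") auto
  show "f 1 = 1"
    using strict_mono_onD[OF m, of y 1] y r[of 1] by (cases "y = 1") auto
qed

lemma Diff2_C2: "f \<in> Diff2 \<Longrightarrow> C2_unit f"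
  by (simp add: Diff2_def)

lemma C2_dist_upper:
  assumes "f \<in> Diff2" "g \<in> Diff2" "x \<in> {0..1}"
  shows "\<bar>D2 f x - D2 g x\<bar> \<le> C2_dist f g"
  using cSUP_upper[OF assms(3) C2_dist_bdd[of f g]] assms
  by (simp add: C2_dist_def Diff2_C2)

lemma C2_dist_attained:
  assumes "f \<in> Diff2" "g \<in> Diff2"
  obtains x where "x \<in> {0..1}" "C2_dist f g = \<bar>D2 f x - D2 g x\<bar>"
proof -
  have "continuous_on {0..1} (\<lambda>x. \<bar>D2 f x - D2 g x\<bar>)"
    using Diff2_C2[OF assms(1)] Diff2_C2[OF assms(2)] unfolding C2_unit_def
    by (intro continuous_intros) auto
  then obtain x where x: "x \<in> {0..1}" "\<forall>y\<in>{0..1}. \<bar>D2 f y - D2 g y\<bar> \<le> \<bar>D2 f x - D2 g x\<bar>"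
    using continuous_attains_sup[of "{0..1::real}" "\<lambda>x. \<bar>D2 f x - D2 g x\<bar>"] by auto
  have "C2_dist f g \<le> \<bar>D2 f x - D2 g x\<bar>"
    using x assms by (auto simp: C2_dist_def intro!: cSUP_least)
  with C2_dist_upper[OF assms x(1)] x(1) that show ?thesis by force
qed

lemma C2_dist_zero_imp:
  assumes "f \<in> Diff2" "g \<in> Diff2" "C2_dist f g = 0"
  shows "f = g"
proof -
  have f: "f differentiable_on {0..1}" "D1 f differentiable_on {0..1}"
    and g: "g differentiable_on {0..1}" "D1 g differentiable_on {0..1}"
    using assms Diff2_C2 by (auto simp: C2_unit_def)
  have "D1 (D1 f) x = D1 (D1 g) x" if "x \<in> {0..1}" for x
    using C2_dist_upper[OF assms(1,2) that] assms(3) by (simp add: D2_def)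
  then obtain c where c: "\<And>x. x \<in> {0..1} \<Longrightarrow> D1 f x = D1 g x + c"
    using const_of_D1_eq[OF f(2) g(2)] by blast
  let ?k = "\<lambda>x. g x + c * x"
  have k: "(?k has_real_derivative D1 f x) (at x within {0..1})" if "x \<in> {0..1}" for x
    using c[OF that] by (auto intro!: derivative_eq_intros has_D1[OF g(1) that])
  have "?k differentiable_on {0..1}"
    using k unfolding differentiable_on_def by (meson real_differentiable_def)
  then obtain e where e: "\<And>x. x \<in> {0..1} \<Longrightarrow> f x = ?k x + e"
    using const_of_D1_eq[OF f(1), of ?k] D1_eqI[OF k] by metis
  have "e = 0" using e[of 0] Diff2_endpoints(1)[OF assms(1)] Diff2_endpoints(1)[OF assms(2)] by simp
  moreover have "c = 0" using e[of 1] Diff2_endpoints(2)[OF assms(1)] Diff2_endpoints(2)[OF assms(2)] calculation by simp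
  ultimately have "f x = g x" if "x \<in> {0..1}" for x using e[OF that] by simp
  then show ?thesis
    using assms(1,2) extensionalityI[of f "{0..1}" g] by (simp add: Diff2_def Bij_def)
qed

lemma Diff2_Metric_space: "Metric_space Diff2 C2_dist"
proof
  fix f g
  show "0 \<le> C2_dist f g"
  proof (cases "f \<in> Diff2 \<and> g \<in> Diff2")
    case True
    then show ?thesis using C2_dist_attained[of f g] by (metis abs_ge_zero)
  qed (auto simp: C2_dist_def)
  show "C2_dist f g = C2_dist g f"
    by (simp add: C2_dist_def abs_minus_commute)
  show "C2_dist f g = 0 \<longleftrightarrow> f = g" if "f \<in> Diff2" "g \<in> Diff2"
    using that C2_dist_zero_imp by (auto simp: C2_dist_def)
next
  fix f g h
  assume fgh: "f \<in> Diff2" "g \<in> Diff2" "h \<in> Diff2"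
  obtain x where x: "x \<in> {0..1}" "C2_dist f h = \<bar>D2 f x - D2 h x\<bar>"
    using C2_dist_attained[OF fgh(1,3)] by blast
  show "C2_dist f h \<le> C2_dist f g + C2_dist g h"
    using x C2_dist_upper[OF fgh(1,2) x(1)] C2_dist_upper[OF fgh(2,3) x(1)] by linarith
qed

lemma topspace_Diff2_topology [simp]: "topspace Diff2_topology = Diff2"
  by (simp add: Diff2_topology_def Metric_space.topspace_mtopology Diff2_Metric_space)

lemma C2_unit_compose:
  assumes f: "C2_unit f" and g: "C2_unit g" and into: "g ` {0..1} \<subseteq> {0..1}"
  shows "C2_unit (compose {0..1} f g)"
    and "\<And>x. x \<in> {0..1} \<Longrightarrow> D1 (compose {0..1} f g) x = D1 f (g x) * D1 g x"
proof -
  have chain: "((\<lambda>x. u (g x)) has_real_derivative D1 u (g x) * D1 g x) (at x within {0..1})"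
    if "u differentiable_on {0..1}" "x \<in> {0..1}" for u x
  proof -
    have gx: "g x \<in> {0..1}" using into that(2) by blast
    have "(u has_real_derivative D1 u (g x)) (at (g x) within g ` {0..1})"
      using has_D1[OF that(1) gx] into by (rule has_field_derivative_subset)
    moreover have "(g has_real_derivative D1 g x) (at x within {0..1})"
      using g that(2) by (intro has_D1) (auto simp: C2_unit_def)
    ultimately show ?thesis using DERIV_image_chain[of u _ g x "{0..1}"] by (simp add: o_def)
  qed
  have d: "(compose {0..1} f g has_real_derivative D1 f (g x) * D1 g x) (at x within {0..1})"
    if x: "x \<in> {0..1}" for x
    by (rule has_field_derivative_transform_within[OF chain[OF _ x], where d=1])
       (use f x in \<open>auto simp: C2_unit_def compose_def\<close>)
  show "D1 (compose {0..1} f g) x = D1 f (g x) * D1 g x" if "x \<in> {0..1}" for x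
    using D1_eqI d that by blast
  have d2: "((\<lambda>x. D1 f (g x) * D1 g x) has_real_derivative
        D2 f (g x) * D1 g x * D1 g x + D1 f (g x) * D2 g x) (at x within {0..1})"
    if x: "x \<in> {0..1}" for x
  proof -
    have a: "((\<lambda>x. D1 f (g x)) has_real_derivative D2 f (g x) * D1 g x) (at x within {0..1})"
      using chain[of "D1 f" x] f x by (simp add: C2_unit_def D2_def)
    have b: "(D1 g has_real_derivative D2 g x) (at x within {0..1})"
      using has_D1[of "D1 g" x] g x by (simp add: C2_unit_def D2_def)
    show ?thesis using DERIV_mult[OF a b] by (simp add: algebra_simps)
  qed
  have cg: "continuous_on {0..1} g" "continuous_on {0..1} (D1 g)" "continuous_on {0..1} (D1 f)"
    using f g differentiable_imp_continuous_on by (auto simp: C2_unit_def)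
  have "continuous_on {0..1} (\<lambda>x. D2 f (g x))"
    using continuous_on_compose2[of "{0..1}" "D2 f" "{0..1}" g] cg f into
    by (auto simp: C2_unit_def)
  moreover have "continuous_on {0..1} (\<lambda>x. D1 f (g x))"
    using continuous_on_compose2[OF cg(3) cg(1) into] .
  moreover have "continuous_on {0..1} (D2 g)" using g by (simp add: C2_unit_def)
  ultimately have "continuous_on {0..1} (\<lambda>x. D2 f (g x) * D1 g x * D1 g x + D1 f (g x) * D2 g x)"
    using cg by (intro continuous_intros)
  with d d2 show "C2_unit (compose {0..1} f g)" by (rule C2_unitI)
qed

lemma Diff2_subgroup: "subgroup Diff2 (BijGroup {0..1})"
proof -
  let ?I = "{0..1::real}"
  interpret B: group "BijGroup ?I" by (rule group_BijGroup)
  have carr: "carrier (BijGroup ?I) = Bij ?I" by (simp add: BijGroup_def)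
  have mult: "f \<otimes>\<^bsub>BijGroup ?I\<^esub> g = compose ?I f g" if "f \<in> Bij ?I" "g \<in> Bij ?I" for f g
    using that by (simp add: BijGroup_def)
  have Dcarr: "f \<in> Bij ?I" if "f \<in> Diff2" for f using that by (simp add: Diff2_def)
  have into: "f ` ?I = ?I" if "f \<in> Bij ?I" for f using that by (auto simp: Bij_def bij_betw_def)
  show ?thesis
  proof (rule B.subgroupI)
    show "Diff2 \<subseteq> carrier (BijGroup ?I)" by (auto simp: carr Diff2_def)
    have one: "\<one>\<^bsub>BijGroup ?I\<^esub> = (\<lambda>x\<in>?I. x)" by (simp add: BijGroup_def)
    have "C2_unit (\<lambda>x\<in>?I. x)"
    proof (rule C2_unitI[where f'="\<lambda>_. 1" and f''="\<lambda>_. 0"])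
      fix x :: real assume "x \<in> ?I"
      then show "((\<lambda>x\<in>?I. x) has_real_derivative 1) (at x within ?I)"
        by (intro has_field_derivative_transform_within[OF DERIV_ident, where d=1]) auto
    qed (auto intro!: derivative_eq_intros)
    then have "\<one>\<^bsub>BijGroup ?I\<^esub> \<in> Diff2"
      using B.one_closed B.inv_one by (simp add: Diff2_def carr one strict_mono_on_def)
    then show "Diff2 \<noteq> {}" by blast
  next
    fix f assume f: "f \<in> Diff2"
    have fB: "f \<in> Bij ?I" using f by (rule Dcarr)
    let ?g = "inv\<^bsub>BijGroup ?I\<^esub> f"
    have gB: "?g \<in> Bij ?I" using B.inv_closed fB by (simp add: carr)
    have fg: "f (?g x) = x" if "x \<in> ?I" for x
      using that into[OF fB] by (simp add: inv_BijGroup[OF fB] f_inv_into_f)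
    have "strict_mono_on ?I ?g"
    proof (rule strict_mono_onI)
      fix r s :: real assume rs: "r \<in> ?I" "s \<in> ?I" "r < s"
      have gr: "?g r \<in> ?I" "?g s \<in> ?I" using into[OF gB] rs by blast+
      have m: "strict_mono_on ?I f" using f by (simp add: Diff2_def)
      show "?g r < ?g s"
      proof (rule ccontr)
        assume "\<not> ?g r < ?g s"
        then have "f (?g s) \<le> f (?g r)"
          using strict_mono_onD[OF m gr(2,1)] by (cases "?g s = ?g r") auto
        with fg rs show False by simp
      qed
    qed
    moreover have "inv\<^bsub>BijGroup ?I\<^esub> ?g = f" using B.inv_inv fB by (simp add: carr)
    ultimately show "?g \<in> Diff2" using f gB by (simp add: Diff2_def)
  next
    fix f g assume f: "f \<in> Diff2" and g: "g \<in> Diff2"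
    note fB = Dcarr[OF f] and gB = Dcarr[OF g]
    have iB: "inv\<^bsub>BijGroup ?I\<^esub> f \<in> Bij ?I" "inv\<^bsub>BijGroup ?I\<^esub> g \<in> Bij ?I"
      using B.inv_closed fB gB by (simp_all add: carr)
    have "inv\<^bsub>BijGroup ?I\<^esub> (f \<otimes>\<^bsub>BijGroup ?I\<^esub> g) =
        compose ?I (inv\<^bsub>BijGroup ?I\<^esub> g) (inv\<^bsub>BijGroup ?I\<^esub> f)"
      using B.inv_mult_group fB gB iB by (simp add: carr mult)
    moreover have "C2_unit (compose ?I (inv\<^bsub>BijGroup ?I\<^esub> g) (inv\<^bsub>BijGroup ?I\<^esub> f))"
      using f g into[OF iB(1)] by (intro C2_unit_compose) (auto simp: Diff2_def)
    moreover have "C2_unit (f \<otimes>\<^bsub>BijGroup ?I\<^esub> g)"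
      using f g into[OF gB] by (auto simp: mult fB gB Diff2_def intro!: C2_unit_compose)
    moreover have "strict_mono_on ?I (f \<otimes>\<^bsub>BijGroup ?I\<^esub> g)"
    proof (rule strict_mono_onI)
      fix r s :: real assume rs: "r \<in> ?I" "s \<in> ?I" "r < s"
      have m: "strict_mono_on ?I f" "strict_mono_on ?I g" using f g by (auto simp: Diff2_def)
      have "g r \<in> ?I" "g s \<in> ?I" using into[OF gB] rs by blast+
      then show "(f \<otimes>\<^bsub>BijGroup ?I\<^esub> g) r < (f \<otimes>\<^bsub>BijGroup ?I\<^esub> g) s"
        using strict_mono_onD[OF m(1)] strict_mono_onD[OF m(2) rs] rs
        by (simp add: mult fB gB compose_eq)
    qed
    moreover have "f \<otimes>\<^bsub>BijGroup ?I\<^esub> g \<in> Bij ?I"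
      using B.m_closed fB gB by (simp add: carr)
    ultimately show "f \<otimes>\<^bsub>BijGroup ?I\<^esub> g \<in> Diff2" by (simp add: Diff2_def)
  qed
qed

lemma Diff2_D1_pos:
  assumes f: "f \<in> Diff2" and x: "x \<in> {0..1}"
  shows "0 < D1 f x"
proof -
  let ?I = "{0..1::real}"
  let ?g = "inv\<^bsub>BijGroup ?I\<^esub> f"
  have fB: "f \<in> Bij ?I" and m: "strict_mono_on ?I f" using f by (auto simp: Diff2_def)
  have im: "f ` ?I = ?I" and inj: "inj_on f ?I" using fB by (auto simp: Bij_def bij_betw_def)
  have "D1 (compose ?I ?g f) x = D1 ?g (f x) * D1 f x"
    using f x im by (intro C2_unit_compose(2)) (auto simp: Diff2_def)
  moreover have "D1 (compose ?I ?g f) x = 1"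
  proof (rule D1_eqI[OF _ x])
    have "compose ?I ?g f y = y" if "y \<in> ?I" for y
      using that im inj by (auto simp: compose_eq inv_BijGroup[OF fB] inv_into_f_f)
    then show "(compose ?I ?g f has_real_derivative 1) (at x within ?I)"
      using x by (intro has_field_derivative_transform_within[OF DERIV_ident, where d=1]) auto
  qed
  ultimately have nz: "D1 f x \<noteq> 0" by auto
  have d: "(f has_real_derivative D1 f x) (at x within ?I)"
    using f x by (intro has_D1) (auto simp: Diff2_def C2_unit_def)
  have "0 \<le> D1 f x"
  proof (rule tendsto_lowerbound)
    show "((\<lambda>y. (f y - f x) / (y - x)) \<longlongrightarrow> D1 f x) (at x within ?I)"
      using d by (simp add: has_field_derivative_iff)
    have "0 \<le> (f y - f x) / (y - x)" if "y \<in> ?I" for y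
      using strict_mono_onD[OF m x that] strict_mono_onD[OF m that x]
      by (cases x y rule: linorder_cases) (auto simp: zero_le_divide_iff)
    then show "\<forall>\<^sub>F y in at x within ?I. 0 \<le> (f y - f x) / (y - x)"
      by (auto simp: eventually_at_filter)
    show "at x within ?I \<noteq> bot"
      using x islimpt_Icc[of 0 1 x] by (simp add: trivial_limit_within)
  qed
  with nz show ?thesis by simp
qed

lemma total_variation_bdd:
  fixes a b K :: real and g :: "real \<Rightarrow> real"
  assumes "\<And>x y. x \<in> {a..b} \<Longrightarrow> y \<in> {a..b} \<Longrightarrow> \<bar>g x - g y\<bar> \<le> K * \<bar>x - y\<bar>"
  shows "bdd_above ((\<lambda>(n, t). \<Sum>i<n. \<bar>g (t (Suc i)) - g (t i)\<bar>) `
           {(n::nat, t). t 0 = a \<and> t n = b \<and> mono_on {..n} t})"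
proof (rule bdd_aboveI2[where M="K * (b - a)"], clarsimp)
  fix n :: nat and t :: "nat \<Rightarrow> real"
  assume t: "a = t 0" "b = t n" "mono_on {..n} t"
  have le: "t i \<le> t j" if "i \<le> j" "j \<le> n" for i j
    using t(3) that by (auto intro: mono_onD)
  have "(\<Sum>i<n. \<bar>g (t (Suc i)) - g (t i)\<bar>) \<le> (\<Sum>i<n. K * (t (Suc i) - t i))"
  proof (rule sum_mono)
    fix i assume "i \<in> {..<n}"
    then show "\<bar>g (t (Suc i)) - g (t i)\<bar> \<le> K * (t (Suc i) - t i)"
      using assms[of "t (Suc i)" "t i"] le[of i "Suc i"] le[of 0 i] le[of 0 "Suc i"]
        le[of i n] le[of "Suc i" n] t(1,2) by auto
  qed
  also have "\<dots> = K * (t n - t 0)"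
    by (simp add: sum_distrib_left[symmetric] sum_lessThan_telescope)
  finally show "(\<Sum>i<n. \<bar>g (t (Suc i)) - g (t i)\<bar>) \<le> K * (t n - t 0)" .
qed

lemma log_variation_bdd:
  assumes f: "f \<in> Diff2"
  shows "bdd_above ((\<lambda>(n, t). \<Sum>i<n. \<bar>ln (D1 f (t (Suc i))) - ln (D1 f (t i))\<bar>) `
           {(n::nat, t). t 0 = 0 \<and> t n = 1 \<and> mono_on {..n} t})"
proof -
  let ?I = "{0..1::real}"
  have C: "D1 f differentiable_on ?I" "continuous_on ?I (D2 f)"
    using Diff2_C2[OF f] by (auto simp: C2_unit_def)
  have d: "((\<lambda>x. ln (D1 f x)) has_real_derivative D2 f x / D1 f x) (at x within ?I)"
    if "x \<in> ?I" for x
    using has_D1[OF C(1) that] Diff2_D1_pos[OF f that]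
    by (auto intro!: derivative_eq_intros simp: D2_def)
  have "continuous_on ?I (\<lambda>x. D2 f x / D1 f x)"
    using C(2) differentiable_imp_continuous_on[OF C(1)] Diff2_D1_pos[OF f]
    by (intro continuous_intros) force+
  then have "bounded ((\<lambda>x. D2 f x / D1 f x) ` ?I)"
    by (intro compact_imp_bounded compact_continuous_image) auto
  then obtain K where K: "\<And>x. x \<in> ?I \<Longrightarrow> \<bar>D2 f x / D1 f x\<bar> \<le> K"
    unfolding bounded_iff by (metis imageI real_norm_def)
  show ?thesis
  proof (rule total_variation_bdd[where K=K])
    fix x y :: real assume "x \<in> ?I" "y \<in> ?I"
    then show "\<bar>ln (D1 f x) - ln (D1 f y)\<bar> \<le> K * \<bar>x - y\<bar>"
      using field_differentiable_bound[of ?I "\<lambda>x. ln (D1 f x)" "\<lambda>x. D2 f x / D1 f x" K x y] d K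
      by auto
  qed
qed

end

theory Submission
  imports Defs
begin

text \<open>
  Every conjugacy \<open>hfh\<^sup>-\<^sup>1 = f\<^sup>2\<close> forces \<open>2 V\<^sub>\<infinity>(f) = V\<^sub>\<infinity>(f)\<close>, which gives the inclusion.

  For density let \<open>V\<^sub>\<infinity>(f) = 0\<close>. Then \<open>f\<close> is parabolic at its fixed points, and on a component
  \<open>(a,b)\<close> of their complement the limits of \<open>D log Df\<^sup>n\<close> for \<open>n \<rightarrow> \<infinity>\<close> and \<open>n \<rightarrow> -\<infinity>\<close> agree (the Mather
  invariant is trivial), since otherwise \<open>V(f\<^sup>n)\<close> would grow linearly. Replace \<open>f\<close> very close to
  each end by a model germ, the time-one map of \<open>c (x - a)\<^sup>2 \<partial>\<^sub>x\<close> or, if \<open>f''(a)\<close> is small,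
  of \<open>\<plusminus>(x - a)\<^sup>3 \<partial>\<^sub>x\<close>. The model time coordinate at an end extends by iteration to a coordinate of
  \<open>(a,b)\<close> in which the modified map is a translation. As the modification shrinks, the left and the
  right coordinate converge in \<open>C\<^sup>2\<close> on compact sets to the same limit, so blending them in the
  middle gives a coordinate \<open>K\<close> for which \<open>g = K\<^sup>-\<^sup>1 \<circ> (K \<plusminus> 1)\<close> is \<open>C\<^sup>2\<close>-close to \<open>f\<close>. The maps
  \<open>K\<^sup>-\<^sup>1 \<circ> (kK + s)\<close> conjugate \<open>g\<close> to \<open>g\<^sup>k\<close> and, thanks to the model germs, are \<open>C\<^sup>2\<close> up to the ends;
  the parameter \<open>s\<close> serves to match second derivatives at common end points of adjacent components.
  Between nearby fixed points \<open>f''\<close> is small, and there \<open>g\<close> is the identity.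
\<close>

section \<open>Twice continuously differentiable functions with explicit derivatives\<close>

text \<open>The obstacle is smoothness of the conjugacies at the fixed points. A germ that is affine
  with slope \<open>k\<close> in the coordinate \<open>1/X^m\<close> has derivative
  \<open>k powr (-1/m)\<close> at its fixed point, so the order \<open>m\<close> must agree on both
  sides of that point; it is therefore read off from \<open>f''\<close> at the point alone. For
  \<open>m = 2\<close> the second derivative of such a germ vanishes there, for \<open>m = 1\<close>
  it moves with \<open>s\<close>. Each component has a single \<open>s\<close>, spent at its left
  end; the value that results at the right end is handed on to the next component, so gluing runs in
  one direction. It gets to the end of the interval because fixed points closer than some \<epsilon>
  are bridged by one identity piece.

  Coordinates are compared through their nonlinearity \<open>L''/L'\<close>. It obeys a cocycle
  equation whose only solution of size O(1/(x - a)) is the limit of D log Df^n. That limit is a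
  series whose tails are controlled by a bound on the nonlinearity of \<open>f\<close>, so changing
  \<open>f\<close> close to an end while keeping the bound hardly moves the limit on compact
  sets.\<close>

definition c2 :: "real set \<Rightarrow> (real \<Rightarrow> real) \<Rightarrow> (real \<Rightarrow> real) \<Rightarrow> (real \<Rightarrow> real) \<Rightarrow> bool" where
  "c2 S f f' f'' \<longleftrightarrow>
     (\<forall>x\<in>S. (f has_real_derivative f' x) (at x within S)
           \<and> (f' has_real_derivative f'' x) (at x within S)) \<and> continuous_on S f''"

lemma c2D:
  assumes "c2 S f f' f''"
  shows "x \<in> S \<Longrightarrow> (f has_real_derivative f' x) (at x within S)"
    and "x \<in> S \<Longrightarrow> (f' has_real_derivative f'' x) (at x within S)"
    and "continuous_on S f''" "continuous_on S f'" "continuous_on S f"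
  using assms unfolding c2_def by (auto intro: DERIV_continuous_on)

lemma c2_D:
  assumes "c2 S f f' f''" "open S" "x \<in> S"
  shows "(f has_real_derivative f' x) (at x)" "(f' has_real_derivative f'' x) (at x)"
  using c2D(1,2)[OF assms(1,3)] unfolding at_within_open[OF assms(3,2)] .

lemma c2_subset: "c2 S f f' f'' \<Longrightarrow> T \<subseteq> S \<Longrightarrow> c2 T f f' f''"
  unfolding c2_def by (meson continuous_on_subset has_field_derivative_subset subsetD)

lemma c2_cong:
  assumes "c2 S f f' f''"
    and "\<And>x. x \<in> S \<Longrightarrow> g x = f x" "\<And>x. x \<in> S \<Longrightarrow> g' x = f' x" "\<And>x. x \<in> S \<Longrightarrow> g'' x = f'' x"
  shows "c2 S g g' g''"
  using assms unfolding c2_def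
  by (auto cong: continuous_on_cong
      intro: has_field_derivative_transform_within[where d=1 and f=f]
        has_field_derivative_transform_within[where d=1 and f=f'])

text \<open>Derivatives and continuity within \<open>S\<close> depend only on \<open>S\<close> near
  the point. Maps given by one formula near an end and by another in the interior are shown to be
  \<open>C^2\<close> in this way, on overlapping relatively open pieces.\<close>

lemma c2_local:
  assumes "\<And>x. x \<in> S \<Longrightarrow> \<exists>U. open U \<and> x \<in> U \<and> c2 (S \<inter> U) f f' f''"
  shows "c2 S f f' f''"
proof -
  have *: "(f has_real_derivative f' x) (at x within S)
      \<and> (f' has_real_derivative f'' x) (at x within S) \<and> continuous (at x within S) f''"
    if x: "x \<in> S" for x
  proof -
    obtain U where U: "open U" "x \<in> U" "c2 (S \<inter> U) f f' f''" using assms x by blast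
    have "at x within S = at x within (S \<inter> U)"
      using U by (intro at_within_nhd[of x U]) auto
    with U x show ?thesis
      by (auto simp: c2_def continuous_on_eq_continuous_within)
  qed
  then show ?thesis by (simp add: c2_def continuous_on_eq_continuous_within)
qed

lemma c2_const [simp]: "c2 S (\<lambda>x. c) (\<lambda>x. 0) (\<lambda>x. 0)"
  and c2_id [simp]: "c2 S (\<lambda>x. x) (\<lambda>x. 1) (\<lambda>x. 0)"
  by (auto simp: c2_def intro!: derivative_eq_intros)

lemma c2_add:
  "c2 S f f' f'' \<Longrightarrow> c2 S g g' g'' \<Longrightarrow>
    c2 S (\<lambda>x. f x + g x) (\<lambda>x. f' x + g' x) (\<lambda>x. f'' x + g'' x)"
  by (auto simp: c2_def intro!: derivative_eq_intros continuous_intros)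

lemma c2_diff:
  "c2 S f f' f'' \<Longrightarrow> c2 S g g' g'' \<Longrightarrow>
    c2 S (\<lambda>x. f x - g x) (\<lambda>x. f' x - g' x) (\<lambda>x. f'' x - g'' x)"
  by (auto simp: c2_def intro!: derivative_eq_intros continuous_intros)

lemma c2_cmult:
  "c2 S f f' f'' \<Longrightarrow> c2 S (\<lambda>x. c * f x) (\<lambda>x. c * f' x) (\<lambda>x. c * f'' x)"
  by (auto simp: c2_def intro!: derivative_eq_intros continuous_intros)

lemma c2_mult:
  assumes f: "c2 S f f' f''" and g: "c2 S g g' g''"
  shows "c2 S (\<lambda>x. f x * g x) (\<lambda>x. f' x * g x + f x * g' x)
      (\<lambda>x. f'' x * g x + 2 * f' x * g' x + f x * g'' x)"
  using f g c2D(3-5)[OF f] c2D(3-5)[OF g] unfolding c2_def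
  by (auto intro!: derivative_eq_intros continuous_intros simp: algebra_simps)

lemma c2_compose:
  assumes f: "c2 S f f' f''" and g: "c2 T g g' g''" and into: "f ` S \<subseteq> T"
  shows "c2 S (\<lambda>x. g (f x)) (\<lambda>x. g' (f x) * f' x)
      (\<lambda>x. g'' (f x) * (f' x)\<^sup>2 + g' (f x) * f'' x)"
proof -
  have chain: "((\<lambda>x. u (f x)) has_real_derivative u' (f x) * f' x) (at x within S)"
    if "\<And>y. y \<in> T \<Longrightarrow> (u has_real_derivative u' y) (at y within T)" "x \<in> S" for u u' x
  proof -
    have "(u has_real_derivative u' (f x)) (at (f x) within f ` S)"
      using that into by (meson has_field_derivative_subset image_subset_iff)
    with c2D(1)[OF f that(2)] show ?thesis
      using DERIV_image_chain[of u _ f x S] by (simp add: o_def)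
  qed
  have cf: "continuous_on S (\<lambda>x. u (f x))" if "continuous_on T u" for u
    using continuous_on_compose2[OF that c2D(5)[OF f] into] .
  have "((\<lambda>x. g' (f x) * f' x) has_real_derivative
      g'' (f x) * (f' x)\<^sup>2 + g' (f x) * f'' x) (at x within S)" if "x \<in> S" for x
    using DERIV_mult[OF chain[OF c2D(2)[OF g] that] c2D(2)[OF f that]]
    by (simp add: power2_eq_square algebra_simps)
  moreover have "continuous_on S (\<lambda>x. g'' (f x) * (f' x)\<^sup>2 + g' (f x) * f'' x)"
    using c2D[OF f] c2D[OF g] by (intro continuous_intros cf)
  ultimately show ?thesis
    using chain[OF c2D(1)[OF g]] by (simp add: c2_def)
qed

text \<open>The difference quotient of \<open>g\<close> is the reciprocal of that of
  \<open>f\<close> at the points \<open>g z\<close>, which differ from \<open>g y\<close> because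
  \<open>f\<close> undoes \<open>g\<close>. Arbitrary sets \<open>S\<close> and \<open>T\<close>
  cover one-sided derivatives at end points by the same argument.\<close>

lemma has_real_derivative_inverse_within:
  fixes f g :: "real \<Rightarrow> real"
  assumes f: "(f has_real_derivative D) (at (g y) within S)" and D: "D \<noteq> 0"
    and g: "continuous (at y within T) g" "g ` T \<subseteq> S" "y \<in> T"
    and inv: "\<And>z. z \<in> T \<Longrightarrow> f (g z) = z"
  shows "(g has_real_derivative 1 / D) (at y within T)"
proof -
  have "\<forall>\<^sub>F z in at y within T. g z \<in> S \<and> g z \<noteq> g y"
    unfolding eventually_at_filter using g(2,3) inv
    by (intro always_eventually) (metis image_subset_iff)
  then have "filterlim g (at (g y) within S) (at y within T)"
    using g(1) by (intro filterlim_at_withinI) (auto simp: continuous_within elim: eventually_mono)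
  then have "((\<lambda>z. (f (g z) - f (g y)) / (g z - g y)) \<longlongrightarrow> D) (at y within T)"
    using filterlim_compose f unfolding has_field_derivative_iff by blast
  then have "((\<lambda>z. 1 / ((f (g z) - f (g y)) / (g z - g y))) \<longlongrightarrow> 1 / D) (at y within T)"
    using D by (intro tendsto_intros)
  then have "((\<lambda>z. (g z - g y) / (z - y)) \<longlongrightarrow> 1 / D) (at y within T)"
    by (rule Lim_transform_eventually)
       (auto simp: eventually_at_filter inv g(3))
  then show ?thesis by (simp add: has_field_derivative_iff)
qed

lemma c2_inverse:
  assumes f: "c2 S f f' f''" and nz: "\<And>x. x \<in> S \<Longrightarrow> f' x \<noteq> 0"
    and g: "continuous_on T g" "g ` T \<subseteq> S" and inv: "\<And>y. y \<in> T \<Longrightarrow> f (g y) = y"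
  shows "c2 T g (\<lambda>y. 1 / f' (g y)) (\<lambda>y. - f'' (g y) / f' (g y) ^ 3)"
proof -
  have gS: "g y \<in> S" if "y \<in> T" for y using g(2) that by blast
  have d: "(g has_real_derivative 1 / f' (g y)) (at y within T)" if "y \<in> T" for y
    using that c2D(1)[OF f gS] nz[OF gS] g inv
    by (intro has_real_derivative_inverse_within[of f _ g y S])
       (auto simp: continuous_on_eq_continuous_within)
  have d2: "((\<lambda>y. 1 / f' (g y)) has_real_derivative - f'' (g y) / f' (g y) ^ 3) (at y within T)"
    if "y \<in> T" for y
  proof -
    have "(f' has_real_derivative f'' (g y)) (at (g y) within g ` T)"
      using c2D(2)[OF f gS[OF that]] g(2) by (rule has_field_derivative_subset)
    then have "((\<lambda>y. f' (g y)) has_real_derivative f'' (g y) * (1 / f' (g y))) (at y within T)"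
      using DERIV_image_chain[of f' "f'' (g y)" g y T "1 / f' (g y)"] d[OF that]
      unfolding o_def by blast
    with nz[OF gS[OF that]] show ?thesis
      by (auto intro!: derivative_eq_intros simp: power3_eq_cube power2_eq_square)
  qed
  have "continuous_on T (\<lambda>y. - f'' (g y) / f' (g y) ^ 3)"
    using nz gS continuous_on_compose2[OF c2D(3)[OF f] g] continuous_on_compose2[OF c2D(4)[OF f] g]
    by (intro continuous_intros) auto
  with d d2 show ?thesis by (simp add: c2_def)
qed

text \<open>At the seam the limits of the difference quotients along both halves exist and agree, so
  the limit along the union exists.\<close>

lemma c2_glue:
  fixes u v w :: real
  assumes f: "c2 {u..v} f f' f''" and g: "c2 {v..w} g g' g''" and uvw: "u \<le> v" "v \<le> w"
    and eq: "f v = g v" "f' v = g' v" "f'' v = g'' v"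
  shows "c2 {u..w} (\<lambda>x. if x \<le> v then f x else g x) (\<lambda>x. if x \<le> v then f' x else g' x)
      (\<lambda>x. if x \<le> v then f'' x else g'' x)"
proof -
  let ?h = "\<lambda>f g x. if x \<le> v then f x else (g x :: real)"
  have un: "{u..w} = {u..v} \<union> {v..w}" using uvw by auto
  have deriv: "(?h f g has_real_derivative ?h f' g' x) (at x within {u..w})"
    if f: "\<And>x. x \<in> {u..v} \<Longrightarrow> (f has_real_derivative f' x) (at x within {u..v})"
      and g: "\<And>x. x \<in> {v..w} \<Longrightarrow> (g has_real_derivative g' x) (at x within {v..w})"
      and eq: "f v = g v" "f' v = g' v" and x: "x \<in> {u..w}" for f f' g g' x
  proof -
    have l: "(?h f g has_real_derivative ?h f' g' x) (at x within {u..v})" if "x \<le> v"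
      using f[of x] that x
      by (auto intro: has_field_derivative_transform_within[where d=1 and f=f])
    have r: "(?h f g has_real_derivative ?h f' g' x) (at x within {v..w})" if "v \<le> x"
      using g[of x] that x eq
      by (cases "x = v") (auto intro!: has_field_derivative_transform_within[where d=1 and f=g])
    consider "x < v" | "x = v" | "v < x" by linarith
    then show ?thesis
    proof cases
      case 1
      then have "at x within {u..w} = at x within {u..v}"
        using uvw by (intro at_within_nhd[of x "{..<v}"]) auto
      with 1 l show ?thesis by simp
    next
      case 2
      with l r show ?thesis
        unfolding un has_field_derivative_iff by (auto intro: Lim_Un)
    next
      case 3
      then have "at x within {u..w} = at x within {v..w}"
        using uvw by (intro at_within_nhd[of x "{v<..}"]) auto
      with 3 r show ?thesis by simp
    qed
  qed
  have cont: "continuous_on {u..w} (?h f'' g'')"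
    unfolding un using c2D(3)[OF f] c2D(3)[OF g] eq
    by (intro continuous_on_If) auto
  show ?thesis
    unfolding c2_def
    using deriv[of f f' g g'] deriv[of f' f'' g' g''] f g eq cont
    by (auto simp: c2_def)
qed

text \<open>With \<open>s = t = a + b\<close> this is conjugation by the reflection of
  \<open>[a,b]\<close>, the means by which results at a left end are carried to a right end. The
  sign of the second derivative flips, that of the first is kept.\<close>

lemma c2_shift_reflect:
  assumes "c2 S f f' f''"
  shows "c2 ((\<lambda>x. s - x) ` S) (\<lambda>x. t - f (s - x)) (\<lambda>x. f' (s - x)) (\<lambda>x. - f'' (s - x))"
proof -
  have r: "c2 ((\<lambda>x. s - x) ` S) (\<lambda>x. s - x) (\<lambda>x. -1) (\<lambda>x. 0)"
    using c2_diff[OF c2_const c2_id] by simp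
  have "c2 ((\<lambda>x. s - x) ` S) (\<lambda>x. f (s - x)) (\<lambda>x. f' (s - x) * -1)
      (\<lambda>x. f'' (s - x) * (-1)\<^sup>2 + f' (s - x) * 0)"
    by (rule c2_compose[OF r assms]) auto
  from c2_diff[OF c2_const this] show ?thesis
    by (rule c2_cong) auto
qed

lemma image_reflect_Icc: "(\<lambda>x::real. a + b - x) ` {a..b} = {a..b}"
  and image_reflect_Ioo: "(\<lambda>x::real. a + b - x) ` {a<..<b} = {a<..<b}"
proof -
  show "(\<lambda>x::real. a + b - x) ` {a..b} = {a..b}"
    using image_diff_atLeastAtMost[of "a + b" a b] by simp
  show "(\<lambda>x::real. a + b - x) ` {a<..<b} = {a<..<b}"
  proof -
    have "x \<in> (\<lambda>x. a + b - x) ` {a<..<b}" if "x \<in> {a<..<b}" for x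
      using that by (intro image_eqI[where x="a + b - x"]) auto
    then show ?thesis by auto
  qed
qed

section \<open>Increasing diffeomorphisms of a compact interval\<close>

definition diffeo :: "real \<Rightarrow> real \<Rightarrow> (real \<Rightarrow> real) \<Rightarrow> (real \<Rightarrow> real) \<Rightarrow> (real \<Rightarrow> real) \<Rightarrow> bool" where
  "diffeo a b f f' f'' \<longleftrightarrow> c2 {a..b} f f' f'' \<and> f a = a \<and> f b = b \<and> (\<forall>x\<in>{a..b}. 0 < f' x)"

lemma diffeo_c2: "diffeo a b f f' f'' \<Longrightarrow> c2 {a..b} f f' f''"
  by (simp add: diffeo_def)

lemma diffeo_less:
  assumes "diffeo a b f f' f''" "x \<in> {a..b}" "y \<in> {a..b}" "x < y"
  shows "f x < f y"
proof (rule DERIV_pos_imp_increasing_open[OF assms(4)])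
  have c: "c2 {a..b} f f' f''" using assms by (simp add: diffeo_def)
  show "continuous_on {x..y} f"
    using c2D(5)[OF c] by (rule continuous_on_subset) (use assms in auto)
  fix z assume z: "x < z" "z < y"
  have "c2 {a<..<b} f f' f''" by (rule c2_subset[OF c]) auto
  then have "(f has_real_derivative f' z) (at z)"
    using z assms(2,3) by (intro c2_D(1)) auto
  moreover have "0 < f' z" using assms z by (auto simp: diffeo_def)
  ultimately show "\<exists>d. (f has_real_derivative d) (at z) \<and> 0 < d" by blast
qed

lemma diffeo_less_iff:
  assumes "diffeo a b f f' f''" "x \<in> {a..b}" "y \<in> {a..b}"
  shows "f x < f y \<longleftrightarrow> x < y" "f x = f y \<longleftrightarrow> x = y" "f x \<le> f y \<longleftrightarrow> x \<le> y"
  using diffeo_less[OF assms(1), of x y] diffeo_less[OF assms(1), of y x] assms(2,3)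
  by (metis less_irrefl not_less_iff_gr_or_eq not_less order.strict_implies_order)+

lemma diffeo_interval:
  assumes "diffeo a b f f' f''"
  shows "x \<in> {a..b} \<Longrightarrow> f x \<in> {a..b}" "x \<in> {a<..<b} \<Longrightarrow> f x \<in> {a<..<b}"
  using assms diffeo_less_iff[OF assms, of a x] diffeo_less_iff[OF assms, of x b]
  by (auto simp: diffeo_def)

lemma diffeo_image: assumes f: "diffeo a b f f' f''" and "a \<le> b" shows "f ` {a..b} = {a..b}"
proof
  show "f ` {a..b} \<subseteq> {a..b}" using diffeo_interval[OF f] by blast
  show "{a..b} \<subseteq> f ` {a..b}"
  proof
    fix y assume "y \<in> {a..b}"
    then obtain x where "a \<le> x" "x \<le> b" "f x = y"
      using IVT'[of f a y b] f assms(2) c2D(5)[of "{a..b}" f] by (auto simp: diffeo_def)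
    then show "y \<in> f ` {a..b}" by auto
  qed
qed

lemma diffeo_inverse:
  assumes f: "diffeo a b f f' f''" and ab: "a \<le> b"
  defines "g \<equiv> inv_into {a..b} f"
  shows "diffeo a b g (\<lambda>y. 1 / f' (g y)) (\<lambda>y. - f'' (g y) / f' (g y) ^ 3)"
    and "\<And>y. y \<in> {a..b} \<Longrightarrow> f (g y) = y" "\<And>x. x \<in> {a..b} \<Longrightarrow> g (f x) = x"
proof -
  have inj: "inj_on f {a..b}" using diffeo_less_iff(2)[OF f] by (auto simp: inj_on_def)
  note im = diffeo_image[OF f ab]
  show fg: "f (g y) = y" if "y \<in> {a..b}" for y
    using that im by (simp add: g_def f_inv_into_f)
  show gf: "g (f x) = x" if "x \<in> {a..b}" for x
    using that inj by (simp add: g_def inv_into_f_f)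
  have gI: "g y \<in> {a..b}" if "y \<in> {a..b}" for y
    using that im inv_into_into[of y f "{a..b}"] by (simp add: g_def)
  have c: "c2 {a..b} f f' f''" using f by (simp add: diffeo_def)
  have "continuous_on {a..b} g"
    using continuous_on_inv[OF c2D(5)[OF c], of g] gf im by auto
  then have "c2 {a..b} g (\<lambda>y. 1 / f' (g y)) (\<lambda>y. - f'' (g y) / f' (g y) ^ 3)"
    using gI fg f by (intro c2_inverse[OF c]) (force simp: diffeo_def)+
  moreover have "g a = a" "g b = b"
    using gf[of a] gf[of b] f ab by (simp_all add: diffeo_def)
  ultimately show "diffeo a b g (\<lambda>y. 1 / f' (g y)) (\<lambda>y. - f'' (g y) / f' (g y) ^ 3)"
    using f gI by (auto simp: diffeo_def)
qed

lemma diffeo_compose: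
  assumes f: "diffeo a b f f' f''" and g: "diffeo a b g g' g''"
  shows "diffeo a b (\<lambda>x. g (f x)) (\<lambda>x. g' (f x) * f' x) (\<lambda>x. g'' (f x) * (f' x)\<^sup>2 + g' (f x) * f'' x)"
  using f g diffeo_interval(1)[OF f] unfolding diffeo_def
  by (auto intro!: c2_compose[where T="{a..b}"])

lemma diffeo_id: "diffeo a b (\<lambda>x. x) (\<lambda>x. 1) (\<lambda>x. 0)"
  by (simp add: diffeo_def)

lemma diffeo_reflect:
  assumes "diffeo a b f f' f''"
  shows "diffeo a b (\<lambda>x. a + b - f (a + b - x)) (\<lambda>x. f' (a + b - x)) (\<lambda>x. - f'' (a + b - x))"
  using assms c2_shift_reflect[of "{a..b}" f f' f'' "a + b" "a + b"]
  unfolding diffeo_def image_reflect_Icc by auto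

lemma mvt_within:
  fixes f :: "real \<Rightarrow> real"
  assumes "\<And>x. x \<in> S \<Longrightarrow> (f has_real_derivative f' x) (at x within S)" "{x..y} \<subseteq> S" "x < y"
  obtains z where "x < z" "z < y" "f y - f x = f' z * (y - x)"
proof -
  have "(f has_derivative (\<lambda>h. f' z * h)) (at z within {x..y})" if "x \<le> z" "z \<le> y" for z
    using has_field_derivative_subset[OF assms(1)[of z] assms(2)] assms(2) that
    by (auto simp: has_field_derivative_def)
  from mvt_simple[OF assms(3) this] that show ?thesis by auto
qed

text \<open>An identity between functions on an open set carries over to their explicit derivatives.
  Functional equations such as \<open>L (\<phi> x) = L x - 1\<close> are differentiated twice in
  this way.\<close>

lemma c2_unique_open:
  assumes f: "c2 S f f' f''" and g: "c2 S g g' g''" and S: "open S"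
    and eq: "\<And>x. x \<in> S \<Longrightarrow> f x = g x" and x: "x \<in> S"
  shows "f' x = g' x" "f'' x = g'' x"
proof -
  have 1: "f' y = g' y" if y: "y \<in> S" for y
    using has_field_derivative_transform_within_open[OF c2_D(1)[OF f S y] S y eq]
      c2_D(1)[OF g S y] DERIV_unique by blast
  show "f' x = g' x" using 1 x .
  show "f'' x = g'' x"
    using has_field_derivative_transform_within_open[OF c2_D(2)[OF f S x] S x 1]
      c2_D(2)[OF g S x] DERIV_unique by blast
qed

section \<open>Variation and asymptotic variation\<close>

abbreviation BG where "BG \<equiv> BijGroup {0..1::real}"

interpretation BG: group BG by (rule group_BijGroup)

lemma carrier_BG [simp]: "carrier BG = Bij {0..1}"
  by (simp add: BijGroup_def)

lemma Diff2_Bij: "f \<in> Diff2 \<Longrightarrow> f \<in> Bij {0..1}"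
  by (simp add: Diff2_def)

lemma BG_mult: "f \<in> Diff2 \<Longrightarrow> g \<in> Diff2 \<Longrightarrow> f \<otimes>\<^bsub>BG\<^esub> g = compose {0..1} f g"
  by (simp add: BijGroup_def Diff2_def)

lemma Diff2_closed [simp]:
  "f \<in> Diff2 \<Longrightarrow> g \<in> Diff2 \<Longrightarrow> f \<otimes>\<^bsub>BG\<^esub> g \<in> Diff2"
  "f \<in> Diff2 \<Longrightarrow> inv\<^bsub>BG\<^esub> f \<in> Diff2"
  "\<one>\<^bsub>BG\<^esub> \<in> Diff2"
  using Diff2_subgroup by (auto simp: subgroup.m_closed subgroup.m_inv_closed subgroup.one_closed)

lemma Diff2_pow_closed [simp]: "f \<in> Diff2 \<Longrightarrow> f [^]\<^bsub>BG\<^esub> (n::nat) \<in> Diff2"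
  by (induction n) auto

lemma Diff2_maps: "f \<in> Diff2 \<Longrightarrow> x \<in> {0..1} \<Longrightarrow> f x \<in> {0..1}"
  by (drule Diff2_Bij) (auto simp: Bij_def bij_betw_def)

lemma Diff2_dif: assumes "f \<in> Diff2" shows "diffeo 0 1 f (D1 f) (D2 f)"
proof -
  have "C2_unit f" using Diff2_C2[OF assms] .
  then have "c2 {0..1} f (D1 f) (D2 f)"
    by (auto simp: c2_def C2_unit_def D2_def intro: has_D1)
  then show ?thesis
    using Diff2_endpoints[OF assms] Diff2_D1_pos[OF assms] by (simp add: diffeo_def)
qed

lemma c2_C2_unit:
  assumes "c2 {0..1} f f' f''"
  shows "C2_unit f" "x \<in> {0..1} \<Longrightarrow> D1 f x = f' x" "x \<in> {0..1} \<Longrightarrow> D2 f x = f'' x"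
proof -
  show "C2_unit f" using C2_unitI[of f f' f''] assms by (auto simp: c2_def)
  show d: "D1 f x = f' x" if "x \<in> {0..1}" for x using D1_eqI c2D(1)[OF assms that] that by blast
  have "f' differentiable_on {0..1}"
    using c2D(2)[OF assms] by (meson differentiable_on_def real_differentiable_def)
  then show "D2 f x = f'' x" if "x \<in> {0..1}" for x
    unfolding D2_def using D1_cong[of "D1 f" f' x] d that D1_eqI[OF c2D(2)[OF assms that] that] by simp
qed

text \<open>Bridge to the group of the theorem: positivity of \<open>f'\<close> on the closed
  interval makes the inverse \<open>C^2\<close> as well, and \<open>restrict\<close> supplies the
  extensionality that \<open>Bij\<close> demands.\<close>

lemma diffeo_Diff2:
  assumes f: "diffeo 0 1 f f' f''"
  shows "restrict f {0..1} \<in> Diff2"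
    and "x \<in> {0..1} \<Longrightarrow> D1 (restrict f {0..1}) x = f' x"
    and "x \<in> {0..1} \<Longrightarrow> D2 (restrict f {0..1}) x = f'' x"
proof -
  let ?I = "{0..1::real}" and ?F = "restrict f {0..1}"
  have c: "c2 ?I ?F f' f''" using f c2_cong[of ?I f f' f'' ?F] by (simp add: diffeo_def)
  have inj: "inj_on f ?I" using diffeo_less_iff(2)[OF f] by (auto simp: inj_on_def)
  have im: "f ` ?I = ?I" using diffeo_image[OF f] by simp
  have B: "?F \<in> Bij ?I" using inj im by (auto simp: Bij_def bij_betw_def inj_on_def)
  have inv: "(inv\<^bsub>BG\<^esub> ?F) x = inv_into ?I f x" if "x \<in> ?I" for x
    using that by (simp add: inv_BijGroup[OF B] inv_into_def cong: conj_cong)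
  have "c2 ?I (inv_into ?I f) (\<lambda>y. 1 / f' (inv_into ?I f y))
      (\<lambda>y. - f'' (inv_into ?I f y) / f' (inv_into ?I f y) ^ 3)"
    using diffeo_inverse(1)[OF f zero_le_one] unfolding diffeo_def by (rule conjunct1)
  then have "c2 ?I (inv\<^bsub>BG\<^esub> ?F) (\<lambda>y. 1 / f' (inv_into ?I f y))
      (\<lambda>y. - f'' (inv_into ?I f y) / f' (inv_into ?I f y) ^ 3)"
    by (rule c2_cong[OF _ inv refl refl])
  moreover have "strict_mono_on ?I ?F"
    using diffeo_less[OF f] by (auto simp: strict_mono_on_def)
  ultimately show "?F \<in> Diff2"
    using B c2_C2_unit(1)[OF c] c2_C2_unit(1) by (auto simp: Diff2_def)
  show "x \<in> {0..1} \<Longrightarrow> D1 ?F x = f' x" "x \<in> {0..1} \<Longrightarrow> D2 ?F x = f'' x"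
    using c2_C2_unit(2,3)[OF c] by auto
qed

lemma D1_mult:
  assumes "f \<in> Diff2" "g \<in> Diff2" "x \<in> {0..1}"
  shows "D1 (f \<otimes>\<^bsub>BG\<^esub> g) x = D1 f (g x) * D1 g x"
  using C2_unit_compose(2)[of f g, OF _ _ _ assms(3)] Diff2_C2 Diff2_maps[OF assms(2)] assms
  by (simp add: BG_mult image_subset_iff)

lemma Diff2_pow_apply:
  assumes "f \<in> Diff2" "x \<in> {0..1}"
  shows "(f [^]\<^bsub>BG\<^esub> (n::nat)) x = (f ^^ n) x" "(f ^^ n) x \<in> {0..1}"
  using assms(2)
proof (induction n arbitrary: x)
  case 0
  { case 1 then show ?case by (simp add: BijGroup_def) }
  { case 2 then show ?case by simp }
next
  case (Suc n)
  { case 1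
    with assms(1) Suc Diff2_maps[OF assms(1)] show ?case
      by (simp add: BG_mult compose_def funpow_Suc_right del: funpow.simps) }
  { case 2
    with assms(1) Suc Diff2_maps[OF assms(1)] show ?case by simp }
qed

lemma D1_pow:
  assumes "f \<in> Diff2" "x \<in> {0..1}"
  shows "D1 (f [^]\<^bsub>BG\<^esub> (n::nat)) x = (\<Prod>i<n. D1 f ((f ^^ i) x))"
  using assms(2)
proof (induction n arbitrary: x)
  case 0
  have "c2 {0..1} \<one>\<^bsub>BG\<^esub> (\<lambda>x. 1) (\<lambda>x. 0)"
    by (rule c2_cong[OF c2_id]) (auto simp: BijGroup_def)
  then have "D1 \<one>\<^bsub>BG\<^esub> x = 1" by (rule c2_C2_unit(2)) (use 0 in auto)
  then show ?case by simp
next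
  case (Suc n)
  then show ?case
    using assms(1) Diff2_maps[OF assms(1)]
    by (simp add: D1_mult Diff2_pow_apply prod.lessThan_Suc_shift funpow_Suc_right
        del: prod.lessThan_Suc funpow.simps)
qed

lemma log_variation_upper:
  assumes f: "f \<in> Diff2" and u: "mono_on {..n} u" "\<And>i. i \<le> n \<Longrightarrow> u i \<in> {0..1}"
  shows "(\<Sum>i<n. \<bar>ln (D1 f (u (Suc i))) - ln (D1 f (u i))\<bar>) \<le> log_variation f"
proof -
  let ?F = "\<lambda>x. ln (D1 f x)"
  \<comment> \<open>The chain is padded with 0 and 1, since \<open>total_variation\<close> admits
    only partitions of the whole interval; the extra terms are nonnegative.\<close>
  define t where "t i = (if i = 0 then 0 else if i \<le> Suc n then u (i - 1) else 1)" for i :: nat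
  have "mono_on {..n+2} t"
    using u unfolding t_def by (auto simp: mono_on_def intro!: u(1)[unfolded mono_on_def, rule_format])
  then have "(n + 2, t) \<in> {(n::nat, t). t 0 = 0 \<and> t n = 1 \<and> mono_on {..n} t}"
    by (simp add: t_def)
  from cSUP_upper[OF this log_variation_bdd[OF f]]
  have "(\<Sum>i<n+2. \<bar>?F (t (Suc i)) - ?F (t i)\<bar>) \<le> log_variation f"
    by (simp add: log_variation_def total_variation_def)
  moreover have "(\<Sum>i<n+2. \<bar>?F (t (Suc i)) - ?F (t i)\<bar>)
      = \<bar>?F (t 1) - ?F (t 0)\<bar> + (\<Sum>i<n. \<bar>?F (t (Suc (Suc i))) - ?F (t (Suc i))\<bar>)
        + \<bar>?F (t (n + 2)) - ?F (t (n + 1))\<bar>"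
    using sum.lessThan_Suc_shift[of "\<lambda>i. \<bar>?F (t (Suc i)) - ?F (t i)\<bar>" n] by simp
  moreover have "(\<Sum>i<n. \<bar>?F (t (Suc (Suc i))) - ?F (t (Suc i))\<bar>) = (\<Sum>i<n. \<bar>?F (u (Suc i)) - ?F (u i)\<bar>)"
    by (intro sum.cong) (auto simp: t_def)
  ultimately show ?thesis by linarith
qed

lemma log_variation_least:
  assumes "\<And>n t. mono_on {..n} t \<Longrightarrow> (\<And>i. i \<le> n \<Longrightarrow> t i \<in> {0..1}) \<Longrightarrow>
      (\<Sum>i<n. \<bar>ln (D1 f (t (Suc i))) - ln (D1 f (t i))\<bar>) \<le> M"
  shows "log_variation f \<le> M"
  unfolding log_variation_def total_variation_def
proof (rule cSUP_least)
  have "(1, \<lambda>i. if i = 0 then 0 else 1) \<in> {(n::nat, t::nat \<Rightarrow> real). t 0 = 0 \<and> t n = 1 \<and> mono_on {..n} t}"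
    by (auto simp: mono_on_def)
  then show "{(n::nat, t::nat \<Rightarrow> real). t 0 = 0 \<and> t n = 1 \<and> mono_on {..n} t} \<noteq> {}"
    unfolding ex_in_conv[symmetric] by (rule exI)
  fix nt :: "nat \<times> (nat \<Rightarrow> real)"
  assume nt: "nt \<in> {(n, t). t 0 = 0 \<and> t n = 1 \<and> mono_on {..n} t}"
  obtain n t where [simp]: "nt = (n, t)" by (cases nt)
  have t: "t 0 = 0" "t n = 1" "mono_on {..n} t" using nt by auto
  have "t i \<in> {0..1}" if "i \<le> n" for i
    using mono_onD[OF t(3), of 0 i] mono_onD[OF t(3), of i n] t that by auto
  with assms[of n t] t show
    "(case nt of (n, t) \<Rightarrow> \<Sum>i<n. \<bar>ln (D1 f (t (Suc i))) - ln (D1 f (t i))\<bar>) \<le> M" by simp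
qed

lemma log_variation_two:
  assumes "f \<in> Diff2" "x \<in> {0..1}" "y \<in> {0..1}"
  shows "\<bar>ln (D1 f x) - ln (D1 f y)\<bar> \<le> log_variation f"
proof -
  have "\<bar>ln (D1 f x) - ln (D1 f y)\<bar> \<le> log_variation f" if "x \<le> y" "x \<in> {0..1}" "y \<in> {0..1}" for x y
    using log_variation_upper[OF assms(1), of 1 "\<lambda>i. if i = 0 then x else y"] that
    by (auto simp: mono_on_def abs_minus_commute)
  from this[of x y] this[of y x] show ?thesis
    using assms(2,3) by (cases "x \<le> y") (auto simp: abs_minus_commute)
qed

lemma log_variation_nonneg: "f \<in> Diff2 \<Longrightarrow> 0 \<le> log_variation f"
  using log_variation_two[of f 0 0] by simp

lemma log_variation_mult:
  assumes f: "f \<in> Diff2" and g: "g \<in> Diff2"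
  shows "log_variation (f \<otimes>\<^bsub>BG\<^esub> g) \<le> log_variation f + log_variation g"
proof (rule log_variation_least)
  fix n and t :: "nat \<Rightarrow> real"
  assume t: "mono_on {..n} t" "\<And>i. i \<le> n \<Longrightarrow> t i \<in> {0..1}"
  let ?F = "\<lambda>f x. ln (D1 f x)"
  have gt: "g (t i) \<in> {0..1}" if "i \<le> n" for i using t that Diff2_maps[OF g] by blast
  have "mono_on {..n} (\<lambda>i. g (t i))"
    using t diffeo_less_iff(3)[OF Diff2_dif[OF g]] by (auto simp: mono_on_def)
  then have "(\<Sum>i<n. \<bar>?F f (g (t (Suc i))) - ?F f (g (t i))\<bar>) \<le> log_variation f"
    using gt by (rule log_variation_upper[OF f])
  moreover have "(\<Sum>i<n. \<bar>?F g (t (Suc i)) - ?F g (t i)\<bar>) \<le> log_variation g"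
    using t by (rule log_variation_upper[OF g])
  moreover have "?F (f \<otimes>\<^bsub>BG\<^esub> g) (t i) = ?F f (g (t i)) + ?F g (t i)" if "i \<le> n" for i
    using D1_mult[OF f g] t(2)[OF that] gt[OF that] Diff2_D1_pos[OF f gt[OF that]]
      Diff2_D1_pos[OF g t(2)[OF that]] by (simp add: ln_mult)
  then have "(\<Sum>i<n. \<bar>?F (f \<otimes>\<^bsub>BG\<^esub> g) (t (Suc i)) - ?F (f \<otimes>\<^bsub>BG\<^esub> g) (t i)\<bar>)
      \<le> (\<Sum>i<n. \<bar>?F f (g (t (Suc i))) - ?F f (g (t i))\<bar> + \<bar>?F g (t (Suc i)) - ?F g (t i)\<bar>)"
    by (intro sum_mono) auto
  ultimately show "(\<Sum>i<n. \<bar>?F (f \<otimes>\<^bsub>BG\<^esub> g) (t (Suc i)) - ?F (f \<otimes>\<^bsub>BG\<^esub> g) (t i)\<bar>)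
      \<le> log_variation f + log_variation g"
    by (simp add: sum.distrib)
qed

text \<open>Division with remainder bounds \<open>a n / n\<close> by \<open>a m / m\<close> up to an
  error of order \<open>1 / n\<close>, for each fixed \<open>m\<close>. Convergence has to be
  established because \<open>lim\<close> in \<open>asymptotic_variation\<close> carries no
  information about a divergent sequence.\<close>

lemma fekete:
  fixes a :: "nat \<Rightarrow> real"
  assumes sub: "\<And>m n. a (m + n) \<le> a m + a n" and nn: "\<And>n. 0 \<le> a n"
  shows "convergent (\<lambda>n. a n / real n)"
proof -
  define L where "L = (INF m\<in>{1..}. a m / real m)"
  have bdd: "bdd_below ((\<lambda>m. a m / real m) ` {1..})"
    by (rule bdd_belowI2[where m=0]) (simp add: nn)
  have mult: "a (q * m + r) \<le> real q * a m + a r" for q m r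
  proof (induction q)
    case (Suc q)
    have "a (Suc q * m + r) \<le> a m + a (q * m + r)" using sub[of m "q * m + r"] by (simp add: algebra_simps)
    with Suc show ?case by (simp add: algebra_simps)
  qed simp
  have lower: "L \<le> a n / real n" if "n \<ge> 1" for n
    unfolding L_def using cINF_lower[OF bdd] that by simp
  have "(\<lambda>n. a n / real n) \<longlonglongrightarrow> L"
  proof (rule LIMSEQ_I)
    fix e :: real assume e: "0 < e"
    have "\<exists>m\<in>{1..}. a m / real m < L + e / 2"
      using cINF_less_iff[of "{1..}", OF _ bdd, of "L + e/2"] e by (auto simp: L_def)
    then obtain m where m: "m \<ge> 1" "a m / real m < L + e / 2" by auto
    \<comment> \<open>Bounds the contribution of every possible remainder modulo \<open>m\<close> at
      once.\<close>
    define M where "M = (\<Sum>r<m. a r)"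
    obtain N where N: "real N > 2 * M / e" using reals_Archimedean2 by blast
    have "\<bar>a n / real n - L\<bar> < e" if n: "n \<ge> max 1 N" for n
    proof -
      have np: "real n > 0" using n by simp
      have "a n \<le> real (n div m) * a m + a (n mod m)" using mult[of "n div m" m "n mod m"] by simp
      moreover have "a (n mod m) \<le> M"
        unfolding M_def using m nn by (intro member_le_sum) auto
      moreover have "real (n div m) * a m \<le> (real n / real m) * a m"
        using of_nat_div_le_of_nat[of n m, where 'a=real] nn by (intro mult_right_mono) auto
      ultimately have "a n \<le> real n * (a m / real m) + M" by simp
      then have "a n / real n \<le> (real n * (a m / real m) + M) / real n"
        using np by (intro divide_right_mono) auto
      also have "\<dots> = a m / real m + M / real n" using np by (simp add: add_divide_distrib)
      also have "M / real n < e / 2"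
      proof -
        have "real n > 2 * M / e" using N n by simp
        then show ?thesis using e np by (simp add: field_simps)
      qed
      finally have "a n / real n < L + e" using m(2) by linarith
      with lower[of n] n show ?thesis by simp
    qed
    then show "\<exists>no. \<forall>n\<ge>no. norm (a n / real n - L) < e" by (metis real_norm_def)
  qed
  then show ?thesis by (rule convergentI)
qed

lemma asymptotic_variation_tendsto:
  assumes f: "f \<in> Diff2"
  shows "(\<lambda>n. log_variation (f [^]\<^bsub>BG\<^esub> n) / real n) \<longlonglongrightarrow> asymptotic_variation f"
proof -
  have "convergent (\<lambda>n::nat. log_variation (f [^]\<^bsub>BG\<^esub> n) / real n)"
  proof (rule fekete)
    show "log_variation (f [^]\<^bsub>BG\<^esub> (m + n)) \<le> log_variation (f [^]\<^bsub>BG\<^esub> m) + log_variation (f [^]\<^bsub>BG\<^esub> n)"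
      for m n :: nat
      using log_variation_mult[of "f [^]\<^bsub>BG\<^esub> m" "f [^]\<^bsub>BG\<^esub> n"] f
      by (simp add: BG.nat_pow_mult Diff2_Bij)
  qed (use f in \<open>simp add: log_variation_nonneg\<close>)
  then show ?thesis by (simp add: asymptotic_variation_def convergent_LIMSEQ_iff)
qed

lemma conj_pow:
  assumes "f \<in> Diff2" "h \<in> Diff2"
  shows "(h \<otimes>\<^bsub>BG\<^esub> f \<otimes>\<^bsub>BG\<^esub> inv\<^bsub>BG\<^esub> h) [^]\<^bsub>BG\<^esub> (n::nat) = h \<otimes>\<^bsub>BG\<^esub> (f [^]\<^bsub>BG\<^esub> n) \<otimes>\<^bsub>BG\<^esub> inv\<^bsub>BG\<^esub> h"
proof (induction n)
  case (Suc n)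
  let ?p = "f [^]\<^bsub>BG\<^esub> n" and ?i = "inv\<^bsub>BG\<^esub> h"
  note [simp] = Diff2_Bij[OF assms(1)] Diff2_Bij[OF assms(2)] Diff2_Bij[OF Diff2_pow_closed[OF assms(1)]]
    Diff2_Bij[OF Diff2_closed(2)[OF assms(2)]]
  have c: "f \<in> carrier BG" "h \<in> carrier BG" "?p \<in> carrier BG" "?i \<in> carrier BG" by simp_all
  have "(h \<otimes>\<^bsub>BG\<^esub> ?p \<otimes>\<^bsub>BG\<^esub> ?i) \<otimes>\<^bsub>BG\<^esub> (h \<otimes>\<^bsub>BG\<^esub> f \<otimes>\<^bsub>BG\<^esub> ?i)
      = h \<otimes>\<^bsub>BG\<^esub> ?p \<otimes>\<^bsub>BG\<^esub> (?i \<otimes>\<^bsub>BG\<^esub> h) \<otimes>\<^bsub>BG\<^esub> f \<otimes>\<^bsub>BG\<^esub> ?i"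
    using c by (simp only: BG.m_assoc BG.m_closed)
  also have "\<dots> = h \<otimes>\<^bsub>BG\<^esub> (?p \<otimes>\<^bsub>BG\<^esub> f) \<otimes>\<^bsub>BG\<^esub> ?i"
    using c by (simp only: BG.l_inv BG.r_one BG.m_assoc BG.m_closed)
  finally show ?case using Suc by simp
qed (use assms in \<open>simp add: Diff2_Bij\<close>)

lemma conj_to_powers_subset: "conj_to_powers \<subseteq> Diff2_V"
proof
  fix f assume "f \<in> conj_to_powers"
  then obtain h where f: "f \<in> Diff2" and h: "h \<in> Diff2"
    and eq: "h \<otimes>\<^bsub>BG\<^esub> f \<otimes>\<^bsub>BG\<^esub> inv\<^bsub>BG\<^esub> h = f [^]\<^bsub>BG\<^esub> (2::nat)"
    unfolding conj_to_powers_def by blast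
  define a where "a n = log_variation (f [^]\<^bsub>BG\<^esub> n)" for n :: nat
  define C where "C = log_variation h + log_variation (inv\<^bsub>BG\<^esub> h)"
  let ?L = "asymptotic_variation f"
  have lim: "(\<lambda>n. a n / real n) \<longlonglongrightarrow> ?L"
    unfolding a_def by (rule asymptotic_variation_tendsto[OF f])
  \<comment> \<open>Subadditivity applied to the factors \<open>h\<close> and its inverse costs a
    constant that does not grow with \<open>n\<close>.\<close>
  have le: "a (2 * n) \<le> a n + C" for n
  proof -
    have "f [^]\<^bsub>BG\<^esub> (2 * n) = h \<otimes>\<^bsub>BG\<^esub> (f [^]\<^bsub>BG\<^esub> n) \<otimes>\<^bsub>BG\<^esub> inv\<^bsub>BG\<^esub> h"
      using conj_pow[OF f h, of n] BG.nat_pow_pow[of f 2 n] Diff2_Bij[OF f] by (simp add: eq)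
    then show ?thesis
      using log_variation_mult[of "h \<otimes>\<^bsub>BG\<^esub> (f [^]\<^bsub>BG\<^esub> n)" "inv\<^bsub>BG\<^esub> h"]
        log_variation_mult[of h "f [^]\<^bsub>BG\<^esub> n"] f h by (simp add: a_def C_def)
  qed
  have "(\<lambda>n. a (2 * n) / real (2 * n)) \<longlonglongrightarrow> ?L"
    using LIMSEQ_subseq_LIMSEQ[OF lim, of "\<lambda>n. 2 * n"] by (simp add: strict_mono_def o_def)
  moreover have "(\<lambda>n. (a n / real n + C / real n) / 2) \<longlonglongrightarrow> (?L + 0) / 2"
    by (intro tendsto_intros lim lim_const_over_n) simp
  ultimately have "?L \<le> (?L + 0) / 2"
  proof (rule LIMSEQ_le, intro exI allI impI)
    fix n :: nat
    show "a (2 * n) / real (2 * n) \<le> (a n / real n + C / real n) / 2"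
      using divide_right_mono[OF le[of n], of "2 * real n"] by (simp add: add_divide_distrib)
  qed
  moreover have "0 \<le> ?L"
    using lim by (rule LIMSEQ_le_const) (use f in \<open>auto simp: a_def log_variation_nonneg\<close>)
  ultimately show "f \<in> Diff2_V" using f by (simp add: Diff2_V_def)
qed

text \<open>The derivative of \<open>f^n\<close> equals 1 somewhere, by the mean value theorem on
  \<open>[0,1]\<close>, and equals \<open>D1 f p ^ n\<close> at \<open>p\<close>. The variation of
  its logarithm is therefore at least \<open>n * \<bar>ln (D1 f p)\<bar>\<close>, which is linear
  growth unless \<open>p\<close> is parabolic.\<close>

lemma Diff2_V_parabolic:
  assumes "f \<in> Diff2_V" and p: "p \<in> {0..1}" "f p = p"
  shows "D1 f p = 1"
proof -
  have f: "f \<in> Diff2" and V: "(\<lambda>n. log_variation (f [^]\<^bsub>BG\<^esub> n) / real n) \<longlonglongrightarrow> 0"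
    using assms(1) asymptotic_variation_tendsto[of f] by (auto simp: Diff2_V_def)
  have le: "\<bar>ln (D1 f p)\<bar> \<le> log_variation (f [^]\<^bsub>BG\<^esub> n) / real n" if "n \<ge> 1" for n :: nat
  proof -
    let ?g = "f [^]\<^bsub>BG\<^esub> n"
    have g: "?g \<in> Diff2" using f by simp
    have c: "c2 {0..1} ?g (D1 ?g) (D2 ?g)" using Diff2_dif[OF g] by (simp add: diffeo_def)
    obtain z where z: "0 < z" "z < 1" "?g 1 - ?g 0 = D1 ?g z * (1 - 0)"
      using mvt_within[OF c2D(1)[OF c], of 0 1] by auto
    then have "D1 ?g z = 1" using Diff2_endpoints[OF g] by simp
    moreover have "D1 ?g p = D1 f p ^ n"
    proof -
      have "(f ^^ i) p = p" for i by (induction i) (auto simp: p)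
      then show ?thesis by (simp add: D1_pow[OF f p(1)])
    qed
    ultimately have "\<bar>real n * ln (D1 f p)\<bar> \<le> log_variation ?g"
      using log_variation_two[OF g p(1), of z] z Diff2_D1_pos[OF f p(1)] by (simp add: ln_realpow)
    then show ?thesis using that by (simp add: field_simps abs_mult)
  qed
  have "\<bar>ln (D1 f p)\<bar> \<le> 0"
    using V by (rule LIMSEQ_le_const) (use le in auto)
  then show ?thesis using Diff2_D1_pos[OF f p(1)] by simp
qed

section \<open>Parabolic contractions\<close>

definition iter_deriv :: "(real \<Rightarrow> real) \<Rightarrow> (real \<Rightarrow> real) \<Rightarrow> nat \<Rightarrow> real \<Rightarrow> real" where
  "iter_deriv f f' n x = (\<Prod>i<n. f' ((f ^^ i) x))"

text \<open>The derivative of log D(f^n): by the chain rule a sum of nonlinearities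
  \<open>f''/f'\<close> along the orbit, each weighted with the derivative of the iterate leading
  there. Its product with \<open>iter_deriv\<close> is the second derivative of
  \<open>f^n\<close>.\<close>

definition iter_nonlin ::
    "(real \<Rightarrow> real) \<Rightarrow> (real \<Rightarrow> real) \<Rightarrow> (real \<Rightarrow> real) \<Rightarrow> nat \<Rightarrow> real \<Rightarrow> real" where
  "iter_nonlin f f' f'' n x = (\<Sum>i<n. f'' ((f ^^ i) x) / f' ((f ^^ i) x) * iter_deriv f f' i x)"

definition lim_nonlin :: "(real \<Rightarrow> real) \<Rightarrow> (real \<Rightarrow> real) \<Rightarrow> (real \<Rightarrow> real) \<Rightarrow> real \<Rightarrow> real" where
  "lim_nonlin f f' f'' x = lim (\<lambda>n. iter_nonlin f f' f'' n x)"

lemma diffeo_funpow: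
  assumes f: "diffeo a b f f' f''"
  shows "diffeo a b (f ^^ n) (iter_deriv f f' n) (\<lambda>x. iter_nonlin f f' f'' n x * iter_deriv f f' n x)"
proof (induction n)
  case 0
  then show ?case using diffeo_id[of a b] by (simp add: iter_deriv_def[abs_def] iter_nonlin_def id_def)
next
  case (Suc n)
  let ?g = "f ^^ n" and ?D = "iter_deriv f f'" and ?S = "iter_nonlin f f' f''"
  have in_: "?g x \<in> {a..b}" if "x \<in> {a..b}" for x using diffeo_interval(1)[OF Suc that] .
  have D: "?D (Suc n) x = f' (?g x) * ?D n x" for x by (simp add: iter_deriv_def mult.commute)
  have S: "?S (Suc n) x = ?S n x + f'' (?g x) / f' (?g x) * ?D n x" for x by (simp add: iter_nonlin_def)
  have SD: "?S (Suc n) x * ?D (Suc n) x = f'' (?g x) * (?D n x)\<^sup>2 + f' (?g x) * (?S n x * ?D n x)"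
    if "x \<in> {a..b}" for x
  proof -
    have "f' (?g x) \<noteq> 0" using in_[OF that] f by (force simp: diffeo_def)
    then show ?thesis unfolding D S by (simp add: power2_eq_square field_simps)
  qed
  have *: "diffeo a b (\<lambda>x. f (?g x)) (\<lambda>x. f' (?g x) * ?D n x)
      (\<lambda>x. f'' (?g x) * (?D n x)\<^sup>2 + f' (?g x) * (?S n x * ?D n x))"
    by (rule diffeo_compose[OF Suc f])
  then have "c2 {a..b} (\<lambda>x. f (?g x)) (?D (Suc n)) (\<lambda>x. ?S (Suc n) x * ?D (Suc n) x)"
    unfolding diffeo_def by (elim conjE, intro c2_cong[OF _ refl D SD])
  with * show ?case
    unfolding diffeo_def D by (simp add: o_def)
qed

text \<open>\<open>a\<close> is the attracting end and \<open>b\<close> the other fixed point. The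
  bound \<open>B\<close> is a parameter so that several maps can share it: the constants in the
  estimates, \<open>B\<close> and \<open>E\<close>, involve only \<open>B\<close> and
  \<open>b - a\<close>, which makes them uniform over all maps with the same
  \<open>B\<close>.\<close>

locale contraction =
  fixes a b :: real and \<phi> \<phi>' \<phi>'' :: "real \<Rightarrow> real" and B :: real
  assumes ab: "a < b" and diffeo: "diffeo a b \<phi> \<phi>' \<phi>''" and par: "\<phi>' a = 1"
    and less: "x \<in> {a<..<b} \<Longrightarrow> \<phi> x < x"
    and bound: "x \<in> {a..b} \<Longrightarrow> \<bar>\<phi>'' x / \<phi>' x\<bar> \<le> B"
begin

abbreviation "D \<equiv> iter_deriv \<phi> \<phi>'"
abbreviation "S \<equiv> iter_nonlin \<phi> \<phi>' \<phi>''"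
abbreviation "A \<equiv> lim_nonlin \<phi> \<phi>' \<phi>''"

definition "E = exp (B * (b - a))"

lemma B_nonneg: "0 \<le> B" using bound[of a] ab by (meson abs_ge_zero atLeastAtMost_iff less_imp_le order.trans order_refl)

lemma E_pos: "0 < E" by (simp add: E_def)

lemma c2_phi: "c2 {a..b} \<phi> \<phi>' \<phi>''" and phi'_pos: "x \<in> {a..b} \<Longrightarrow> 0 < \<phi>' x"
  and phi_a: "\<phi> a = a"
  using diffeo by (auto simp: diffeo_def)

lemmas it_dif = diffeo_funpow[OF diffeo]

lemma it_in: "x \<in> {a<..<b} \<Longrightarrow> (\<phi> ^^ n) x \<in> {a<..<b}"
  using diffeo_interval(2)[OF it_dif] .

lemma it_in': "x \<in> {a..b} \<Longrightarrow> (\<phi> ^^ n) x \<in> {a..b}"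
  using diffeo_interval(1)[OF it_dif] .

lemma D_pos: "x \<in> {a..b} \<Longrightarrow> 0 < D n x"
  using it_dif[of n] by (simp add: diffeo_def)

lemma it_Suc_less: "x \<in> {a<..<b} \<Longrightarrow> (\<phi> ^^ Suc n) x < (\<phi> ^^ n) x"
  using less[OF it_in] by simp

lemma it_antimono:
  assumes "x \<in> {a<..<b}" "m \<le> n"
  shows "(\<phi> ^^ n) x \<le> (\<phi> ^^ m) x"
  using assms(2)
proof (induction n rule: dec_induct)
  case (step n)
  then show ?case using it_Suc_less[OF assms(1), of n] by linarith
qed simp

lemma it_tendsto:
  assumes x: "x \<in> {a<..<b}"
  shows "(\<lambda>n. (\<phi> ^^ n) x) \<longlonglongrightarrow> a"
proof -
  have "decseq (\<lambda>n. (\<phi> ^^ n) x)" using it_antimono[OF x] by (simp add: decseq_def)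
  moreover have ge: "a \<le> (\<phi> ^^ n) x" for n using it_in[OF x, of n] by simp
  ultimately obtain l where l: "(\<lambda>n. (\<phi> ^^ n) x) \<longlonglongrightarrow> l" "\<And>n. l \<le> (\<phi> ^^ n) x"
    using decseq_convergent by blast
  have la: "a \<le> l" using l(1) by (rule LIMSEQ_le_const) (use ge in blast)
  have lb: "l < b" using l(2)[of 0] x by simp
  have "(\<lambda>n. \<phi> ((\<phi> ^^ n) x)) \<longlonglongrightarrow> \<phi> l"
    using continuous_on_tendsto_compose[OF c2D(5)[OF c2_phi] l(1)] la lb it_in[OF x]
    by (force simp: less_imp_le)
  moreover have "(\<lambda>n. \<phi> ((\<phi> ^^ n) x)) \<longlonglongrightarrow> l" using LIMSEQ_Suc[OF l(1)] by simp
  ultimately have "\<phi> l = l" using LIMSEQ_unique by blast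
  then have "l = a" using less[of l] la lb by force
  with l(1) show ?thesis by simp
qed

text \<open>Bounded distortion on the fundamental domain from \<open>\<phi> x\<close> to
  \<open>x\<close>: its images under the iterates do not overlap, so log \<open>D i\<close> varies
  on it by at most \<open>B * (b - a)\<close>. The mean value theorem provides a point
  \<open>z\<close> in it where \<open>D i z\<close> is the exact ratio of the gap lengths, and
  \<open>D i x\<close> is compared with that.\<close>

lemma distortion:
  assumes x: "x \<in> {a<..<b}"
  shows "D i x * (x - \<phi> x) \<le> E * ((\<phi> ^^ i) x - (\<phi> ^^ Suc i) x)"
proof -
  have px: "\<phi> x < x" "\<phi> x \<in> {a<..<b}" using less x diffeo_interval(2)[OF diffeo] by auto
  obtain z where z: "\<phi> x < z" "z < x" "(\<phi> ^^ i) x - (\<phi> ^^ i) (\<phi> x) = D i z * (x - \<phi> x)"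
  proof (rule mvt_within[of "{a..b}" "\<phi> ^^ i" "D i" "\<phi> x" x])
    show "((\<phi> ^^ i) has_real_derivative D i w) (at w within {a..b})" if "w \<in> {a..b}" for w
      using it_dif[of i] c2D(1) that unfolding diffeo_def by blast
  qed (use px x in auto)
  have zI: "z \<in> {a<..<b}" using z px x by auto
  \<comment> \<open>Both orbits stay in the same image of the fundamental domain, whose length
    bounds their distance.\<close>
  have step: "ln (\<phi>' ((\<phi> ^^ j) x)) - ln (\<phi>' ((\<phi> ^^ j) z)) \<le> B * ((\<phi> ^^ j) x - (\<phi> ^^ Suc j) x)" for j
  proof -
    let ?u = "(\<phi> ^^ j) z" and ?v = "(\<phi> ^^ j) x"
    have uv: "?u < ?v" "(\<phi> ^^ Suc j) x < ?u"
      using z diffeo_less_iff(1)[OF it_dif[of j]] zI x px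
      by (auto simp: funpow_Suc_right simp del: funpow.simps)
    have d: "((\<lambda>x. ln (\<phi>' x)) has_real_derivative \<phi>'' y / \<phi>' y) (at y within {a..b})"
      if "y \<in> {a..b}" for y
      using c2D(2)[OF c2_phi that] phi'_pos[OF that] by (auto intro!: derivative_eq_intros)
    have "?u \<in> {a<..<b}" "?v \<in> {a<..<b}" using it_in zI x by auto
    then obtain y where y: "?u < y" "y < ?v" "ln (\<phi>' ?v) - ln (\<phi>' ?u) = \<phi>'' y / \<phi>' y * (?v - ?u)"
      using mvt_within[OF d, of ?u ?v] uv(1) by auto
    have "y \<in> {a..b}" using y \<open>?u \<in> _\<close> \<open>?v \<in> _\<close> by auto
    then have "\<phi>'' y / \<phi>' y * (?v - ?u) \<le> B * (?v - ?u)"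
      using abs_le_D1[OF bound[of y]] uv(1) by (intro mult_right_mono) auto
    also have "\<dots> \<le> B * (?v - (\<phi> ^^ Suc j) x)"
      using uv B_nonneg by (intro mult_left_mono) auto
    finally show ?thesis using y(3) by simp
  qed
  have lnD: "ln (D i w) = (\<Sum>j<i. ln (\<phi>' ((\<phi> ^^ j) w)))" if "w \<in> {a<..<b}" for w
    unfolding iter_deriv_def 
  proof (intro ln_prod)
    show "\<phi>' ((\<phi> ^^ j) w) \<noteq> 0" for j
      using phi'_pos[OF it_in'[of w j]] that by auto
  qed simp
  have "ln (D i x) - ln (D i z) \<le> (\<Sum>j<i. B * ((\<phi> ^^ j) x - (\<phi> ^^ Suc j) x))"
    unfolding lnD[OF x] lnD[OF zI] sum_subtractf[symmetric] by (intro sum_mono step)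
  also have "\<dots> = B * (x - (\<phi> ^^ i) x)"
    unfolding sum_distrib_left[symmetric] sum_lessThan_telescope'[of "\<lambda>j. (\<phi> ^^ j) x"] by simp
  also have "\<dots> \<le> B * (b - a)"
    using it_in[OF x, of i] x B_nonneg by (intro mult_left_mono) auto
  finally have "ln (D i x) \<le> ln (E * D i z)"
    using D_pos[of z i] zI by (simp add: E_def ln_mult)
  then have "D i x \<le> E * D i z"
    using D_pos[of z i] D_pos[of x i] zI x E_pos by simp
  then have "D i x * (x - \<phi> x) \<le> E * D i z * (x - \<phi> x)"
    using px by (intro mult_right_mono) auto
  also have "\<dots> = E * ((\<phi> ^^ i) x - (\<phi> ^^ Suc i) x)"
    using z(3) by (simp add: funpow_swap1 mult.assoc)
  finally show ?thesis .
qed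

text \<open>By \<open>distortion\<close> the \<open>i\<close>-th term of the series is at most
  \<open>B * E / (x - \<phi> x)\<close> times the \<open>i\<close>-th gap of the orbit, and the gaps
  telescope. The factor \<open>x - \<phi> x\<close> stays on the left because the quotient
  degenerates at the ends.\<close>

lemma S_cauchy:
  assumes x: "x \<in> {a<..<b}" and nm: "n \<le> m"
  shows "\<bar>S m x - S n x\<bar> * (x - \<phi> x) \<le> B * E * ((\<phi> ^^ n) x - a)"
proof -
  have px: "\<phi> x < x" using less x by auto
  let ?N = "\<lambda>i. \<phi>'' ((\<phi> ^^ i) x) / \<phi>' ((\<phi> ^^ i) x)"
  have "S m x = S n x + (\<Sum>i\<in>{n..<m}. ?N i * D i x)"
    unfolding iter_nonlin_def lessThan_atLeast0 
    by (rule sum.atLeastLessThan_concat[OF _ nm, symmetric]) simp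
  then have "\<bar>S m x - S n x\<bar> * (x - \<phi> x) \<le> (\<Sum>i\<in>{n..<m}. \<bar>?N i * D i x\<bar>) * (x - \<phi> x)"
    using px sum_abs[of "\<lambda>i. ?N i * D i x" "{n..<m}"] by (intro mult_right_mono) simp_all
  also have "\<dots> = (\<Sum>i\<in>{n..<m}. \<bar>?N i * D i x\<bar> * (x - \<phi> x))" by (rule sum_distrib_right)
  also have "\<dots> \<le> (\<Sum>i\<in>{n..<m}. B * (E * ((\<phi> ^^ i) x - (\<phi> ^^ Suc i) x)))"
  proof (rule sum_mono)
    fix i
    have "\<bar>?N i * D i x\<bar> * (x - \<phi> x) = \<bar>?N i\<bar> * (D i x * (x - \<phi> x))"
      using D_pos[of x i] x by (simp add: abs_mult)
    also have "\<dots> \<le> B * (E * ((\<phi> ^^ i) x - (\<phi> ^^ Suc i) x))"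
      using x px D_pos[of x i] B_nonneg
      by (intro mult_mono[OF bound[OF it_in'] distortion]) auto
    finally show "\<bar>?N i * D i x\<bar> * (x - \<phi> x) \<le> B * (E * ((\<phi> ^^ i) x - (\<phi> ^^ Suc i) x))" .
  qed
  also have "\<dots> = B * E * ((\<phi> ^^ n) x - (\<phi> ^^ m) x)"
  proof -
    have "(\<Sum>i\<in>{n..<m}. (\<phi> ^^ i) x - (\<phi> ^^ Suc i) x) = (\<phi> ^^ n) x - (\<phi> ^^ m) x"
      using sum_Suc_diff'[OF nm, of "\<lambda>i. - (\<phi> ^^ i) x"] by (simp add: algebra_simps)
    then show ?thesis by (simp add: sum_distrib_left[symmetric] mult.assoc)
  qed
  also have "\<dots> \<le> B * E * ((\<phi> ^^ n) x - a)"
    using it_in[OF x, of m] B_nonneg E_pos by (intro mult_left_mono) auto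
  finally show ?thesis .
qed

lemma S_tendsto:
  assumes x: "x \<in> {a<..<b}"
  shows "(\<lambda>n. S n x) \<longlonglongrightarrow> A x"
proof -
  have px: "x - \<phi> x > 0" using less x by auto
  have "Cauchy (\<lambda>n. S n x)"
  proof (rule metric_CauchyI)
    fix e :: real assume e: "0 < e"
    have "(\<lambda>n. B * E * ((\<phi> ^^ n) x - a)) \<longlonglongrightarrow> B * E * (a - a)"
      by (intro tendsto_intros it_tendsto x)
    then have "\<forall>\<^sub>F n in sequentially. B * E * ((\<phi> ^^ n) x - a) < e / 2 * (x - \<phi> x)"
      using e px by (intro order_tendstoD(2)) auto
    then obtain n where n: "B * E * ((\<phi> ^^ n) x - a) < e / 2 * (x - \<phi> x)"
      by (auto simp: eventually_sequentially)
    have *: "\<bar>S m x - S n x\<bar> < e / 2" if "m \<ge> n" for m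
      using S_cauchy[OF x that] n px by (meson le_less_trans mult_less_cancel_right_pos)
    have "dist (S m x) (S k x) < e" if "m \<ge> n" "k \<ge> n" for m k
      using *[OF that(1)] *[OF that(2)] unfolding dist_real_def by linarith
    then show "\<exists>M. \<forall>m\<ge>M. \<forall>k\<ge>M. dist (S m x) (S k x) < e" by blast
  qed
  then show ?thesis
    by (simp add: Cauchy_convergent_iff convergent_LIMSEQ_iff lim_nonlin_def)
qed

lemma A_bound:
  assumes x: "x \<in> {a<..<b}"
  shows "\<bar>A x - S n x\<bar> * (x - \<phi> x) \<le> B * E * ((\<phi> ^^ n) x - a)"
proof (rule LIMSEQ_le_const2)
  show "(\<lambda>m. \<bar>S m x - S n x\<bar> * (x - \<phi> x)) \<longlonglongrightarrow> \<bar>A x - S n x\<bar> * (x - \<phi> x)"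
    by (intro tendsto_intros S_tendsto x)
  show "\<exists>N. \<forall>m\<ge>N. \<bar>S m x - S n x\<bar> * (x - \<phi> x) \<le> B * E * ((\<phi> ^^ n) x - a)"
    using S_cauchy[OF x] by blast
qed

lemma gap_pos:
  assumes z: "a < z1" "z1 \<le> z2" "z2 < b"
  obtains m where "0 < m" "\<And>x. x \<in> {z1..z2} \<Longrightarrow> m \<le> x - \<phi> x"
proof -
  have "continuous_on {z1..z2} (\<lambda>x. x - \<phi> x)"
    by (intro continuous_intros continuous_on_subset[OF c2D(5)[OF c2_phi]]) (use z in auto)
  then obtain y where y: "y \<in> {z1..z2}" "\<And>x. x \<in> {z1..z2} \<Longrightarrow> y - \<phi> y \<le> x - \<phi> x"
    using continuous_attains_inf[of "{z1..z2}" "\<lambda>x. x - \<phi> x"] z(2) by auto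
  with less[of y] z show ?thesis by (intro that[of "y - \<phi> y"]) auto
qed

text \<open>The tail bound is largest at \<open>z2\<close>, the iterates being increasing, and
  \<open>x - \<phi> x\<close> is bounded away from 0 on the compact interval; hence one
  \<open>n\<close> serves all points.\<close>

lemma S_uniform_limit:
  assumes z: "a < z1" "z1 \<le> z2" "z2 < b"
  shows "uniform_limit {z1..z2} S A sequentially"
proof (rule uniform_limitI)
  fix e :: real assume e: "0 < e"
  obtain m where m: "0 < m" "\<And>x. x \<in> {z1..z2} \<Longrightarrow> m \<le> x - \<phi> x" using gap_pos[OF z] by blast
  have z2: "z2 \<in> {a<..<b}" using z by auto
  have "(\<lambda>n. B * E * ((\<phi> ^^ n) z2 - a)) \<longlonglongrightarrow> B * E * (a - a)"
    by (intro tendsto_intros it_tendsto z2)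
  then have "\<forall>\<^sub>F n in sequentially. B * E * ((\<phi> ^^ n) z2 - a) < e * m"
    using e m by (intro order_tendstoD(2)) auto
  then show "\<forall>\<^sub>F n in sequentially. \<forall>x\<in>{z1..z2}. dist (S n x) (A x) < e"
  proof eventually_elim
    case (elim n)
    show ?case
    proof
      fix x assume x: "x \<in> {z1..z2}"
      then have xI: "x \<in> {a<..<b}" using z by auto
      have "(\<phi> ^^ n) x \<le> (\<phi> ^^ n) z2"
        using diffeo_less_iff(3)[OF it_dif, of x z2 n] x xI z2 by auto
      then have "B * E * ((\<phi> ^^ n) x - a) \<le> B * E * ((\<phi> ^^ n) z2 - a)"
        using B_nonneg E_pos by (intro mult_left_mono) auto
      then have "\<bar>A x - S n x\<bar> * (x - \<phi> x) < e * m" using A_bound[OF xI, of n] elim by linarith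
      also have "\<dots> \<le> e * (x - \<phi> x)" using m(2)[OF x] e by simp
      finally show "dist (S n x) (A x) < e"
        using m(1) m(2)[OF x] by (simp add: dist_real_def abs_minus_commute)
    qed
  qed
qed

lemma S_continuous: "continuous_on {a..b} (S n)"
proof -
  have "continuous_on {a..b} (\<lambda>x. (S n x * D n x) / D n x)"
  proof (rule continuous_on_divide)
    show "continuous_on {a..b} (\<lambda>x. S n x * D n x)" "continuous_on {a..b} (D n)"
      using it_dif[of n] unfolding diffeo_def by (blast dest: c2D(3,4))+
  qed (use D_pos[of _ n] in force)
  moreover have "S n x * D n x / D n x = S n x" if "x \<in> {a..b}" for x
    using D_pos[OF that, of n] by simp
  ultimately show ?thesis by (rule continuous_on_eq)
qed

lemma A_continuous: "continuous_on {a<..<b} A"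
proof -
  have "isCont A x" if x: "x \<in> {a<..<b}" for x
  proof -
    obtain z1 z2 where z: "a < z1" "z1 < x" "x < z2" "z2 < b"
      using x dense[of a x] dense[of x b] by auto
    have "continuous_on {z1..z2} A"
    proof (rule uniform_limit_theorem[OF _ S_uniform_limit])
      show "\<forall>\<^sub>F n in sequentially. continuous_on {z1..z2} (S n)"
        using z by (intro always_eventually allI continuous_on_subset[OF S_continuous]) auto
    qed (use z in auto)
    then show "isCont A x" using z by (intro continuous_on_interior[of "{z1..z2}"]) auto
  qed
  then show ?thesis by (intro continuous_at_imp_continuous_on) blast
qed

text \<open>Parabolicity enters here: the ratio tends to \<open>1 - \<phi>' a\<close>.\<close>

lemma gap_ratio:
  assumes x: "x \<in> {a<..<b}"
  shows "(\<lambda>n. ((\<phi> ^^ n) x - (\<phi> ^^ Suc n) x) / ((\<phi> ^^ n) x - a)) \<longlonglongrightarrow> 0"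
proof -
  have ne: "(\<phi> ^^ n) x \<in> {a..b} - {a}" for n using it_in[OF x, of n] by auto
  have "((\<lambda>y. (\<phi> y - \<phi> a) / (y - a)) \<longlongrightarrow> 1) (at a within {a..b})"
    using c2D(1)[OF c2_phi, of a] ab par by (simp add: has_field_derivative_iff)
  moreover have "filterlim (\<lambda>n. (\<phi> ^^ n) x) (at a within {a..b}) sequentially"
    using it_tendsto[OF x] by (rule filterlim_at_withinI) (intro always_eventually allI ne)
  ultimately have "(\<lambda>n. (\<phi> ((\<phi> ^^ n) x) - \<phi> a) / ((\<phi> ^^ n) x - a)) \<longlonglongrightarrow> 1"
    by (rule filterlim_compose)
  then have "(\<lambda>n. 1 - (\<phi> ((\<phi> ^^ n) x) - \<phi> a) / ((\<phi> ^^ n) x - a)) \<longlonglongrightarrow> 1 - 1"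
    by (intro tendsto_intros)
  moreover have "1 - (\<phi> ((\<phi> ^^ n) x) - \<phi> a) / ((\<phi> ^^ n) x - a)
      = ((\<phi> ^^ n) x - (\<phi> ^^ Suc n) x) / ((\<phi> ^^ n) x - a)" for n
    using ne[of n] by (simp add: phi_a field_simps)
  ultimately show ?thesis by simp
qed

text \<open>Iterating the equation gives \<open>k x = S n x + k y * D n x\<close>, where
  \<open>y\<close> is the \<open>n\<close>-th iterate of \<open>x\<close>. By
  \<open>distortion\<close>, \<open>D n x\<close> is at most a multiple of the gap at
  \<open>y\<close>, and \<open>k y\<close> is at most \<open>C / (y - a)\<close>, so the remainder
  is a multiple of the ratio in \<open>gap_ratio\<close> and tends to 0. The growth allowed is
  exactly that of the nonlinearity of a pole at \<open>a\<close>.\<close>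

lemma nonlin_eq_lim:
  assumes k: "\<And>x. x \<in> {a<..<b} \<Longrightarrow> k x = \<phi>'' x / \<phi>' x + k (\<phi> x) * \<phi>' x"
    and C: "0 < e" "\<And>x. x \<in> {a<..<b} \<Longrightarrow> x < a + e \<Longrightarrow> \<bar>k x\<bar> * (x - a) \<le> C"
    and x: "x \<in> {a<..<b}"
  shows "k x = A x"
proof -
  have px: "x - \<phi> x > 0" using less x by auto
  have it: "k x = S n x + k ((\<phi> ^^ n) x) * D n x" for n
  proof (induction n)
    case (Suc n)
    then show ?case using k[OF it_in[OF x, of n]]
      by (simp add: iter_nonlin_def iter_deriv_def algebra_simps)
  qed (simp add: iter_nonlin_def iter_deriv_def)
  let ?y = "\<lambda>n. (\<phi> ^^ n) x"
  have "\<forall>\<^sub>F n in sequentially. ?y n < a + e"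
    using it_tendsto[OF x] C(1) by (intro order_tendstoD(2)) auto
  then have "\<forall>\<^sub>F n in sequentially. norm (k (?y n) * D n x) \<le>
      (C * E / (x - \<phi> x)) * ((?y n - ?y (Suc n)) / (?y n - a))"
  proof eventually_elim
    case (elim n)
    have y: "?y n > a" using it_in[OF x, of n] by simp
    have gap: "0 < ?y n - ?y (Suc n)" using it_Suc_less[OF x, of n] by simp
    have kC: "\<bar>k (?y n)\<bar> \<le> C / (?y n - a)" using C(2)[OF it_in[OF x] elim] y by (simp add: field_simps)
    have "D n x \<le> E * (?y n - ?y (Suc n)) / (x - \<phi> x)"
      using distortion[OF x, of n] px by (simp add: field_simps)
    then have "\<bar>k (?y n)\<bar> * D n x \<le> C / (?y n - a) * (E * (?y n - ?y (Suc n)) / (x - \<phi> x))"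
      using kC D_pos[of x n] x by (intro mult_mono) auto
    then show ?case using D_pos[of x n] x by (simp add: abs_mult mult_ac)
  qed
  moreover have "(\<lambda>n. (C * E / (x - \<phi> x)) * ((?y n - ?y (Suc n)) / (?y n - a)))
      \<longlonglongrightarrow> (C * E / (x - \<phi> x)) * 0"
    by (intro tendsto_intros gap_ratio x)
  ultimately have "(\<lambda>n. k (?y n) * D n x) \<longlonglongrightarrow> 0"
    by (auto intro: Lim_null_comparison)
  then have "(\<lambda>n. S n x + k (?y n) * D n x) \<longlonglongrightarrow> A x + 0"
    by (intro tendsto_intros S_tendsto x)
  then show ?thesis by (simp add: it[symmetric] LIMSEQ_const_iff)
qed

text \<open>The value of \<open>L\<close> at \<open>x\<close> is \<open>m\<close> at the
  \<open>n\<close>-th iterate, plus \<open>n\<close>, for any \<open>n\<close> large enough that the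
  orbit has reached the domain of the germ \<open>m\<close>; the functional equation makes this
  independent of \<open>n\<close>. The nonlinearity of \<open>L\<close> solves the cocycle equation
  with the growth allowed in \<open>nonlin_eq_lim\<close>, so it equals \<open>A\<close> whatever
  germ was chosen.\<close>

lemma coordinate_exists:
  assumes m: "c2 {a<..<a+e} m m' m''" and e: "0 < e" "a + e \<le> b"
    and m': "\<And>x. x \<in> {a<..<a+e} \<Longrightarrow> 0 < m' x"
    and m1: "\<And>x. x \<in> {a<..<a+e} \<Longrightarrow> m (\<phi> x) = m x - 1"
    and C: "\<And>x. x \<in> {a<..<a+e} \<Longrightarrow> \<bar>m'' x / m' x\<bar> * (x - a) \<le> C"
  obtains L L' L'' where "c2 {a<..<b} L L' L''" "\<And>x. x \<in> {a<..<a+e} \<Longrightarrow> L x = m x"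
    "\<And>x. x \<in> {a<..<b} \<Longrightarrow> 0 < L' x" "\<And>x. x \<in> {a<..<b} \<Longrightarrow> L (\<phi> x) = L x - 1"
    "\<And>x. x \<in> {a<..<b} \<Longrightarrow> L'' x / L' x = A x"
proof -
  define F where "F n x = m ((\<phi> ^^ n) x) + real n" for n x
  define F' where "F' n x = m' ((\<phi> ^^ n) x) * D n x" for n x
  define F'' where "F'' n x = m'' ((\<phi> ^^ n) x) * (D n x)\<^sup>2 + m' ((\<phi> ^^ n) x) * (S n x * D n x)" for n x
  define U where "U n = {x \<in> {a<..<b}. (\<phi> ^^ n) x < a + e}" for n
  define \<nu> where "\<nu> x = (LEAST n. (\<phi> ^^ n) x < a + e)" for x
  have ciab: "c2 {a<..<b} (\<phi> ^^ n) (D n) (\<lambda>x. S n x * D n x)" for n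
    using it_dif[of n] unfolding diffeo_def by (elim conjE c2_subset) auto
  have oU: "open (U n)" for n
  proof -
    have "U n = {a<..<b} \<inter> (\<phi> ^^ n) -` {..<a + e}" by (auto simp: U_def)
    then show ?thesis using continuous_open_preimage[OF c2D(5)[OF ciab[of n]]] by auto
  qed
  have it_e: "(\<phi> ^^ n) x \<in> {a<..<a+e}" if "x \<in> U n" for n x
    using that it_in[of x n] by (auto simp: U_def)
  have cU: "c2 (U n) (F n) (F' n) (F'' n)" for n
  proof -
    have "c2 (U n) (\<phi> ^^ n) (D n) (\<lambda>x. S n x * D n x)"
      using ciab by (rule c2_subset) (auto simp: U_def)
    from c2_add[OF c2_compose[OF this m] c2_const[of _ "real n"]] it_e show ?thesis
      unfolding F_def F'_def F''_def add_0_right by blast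
  qed
  have Ustep: "U n \<subseteq> U (Suc n)" for n
    unfolding U_def using it_Suc_less[of _ n] by (blast intro: less_trans)
  have Umono: "U n \<subseteq> U k" if "n \<le> k" for n k
    using that Ustep by (rule lift_Suc_mono_le[rotated])
  have Fstep: "F (Suc n) x = F n x" if "x \<in> U n" for n x
    using m1[OF it_e[OF that]] by (simp add: F_def)
  have Feq: "F k x = F n x \<and> F' k x = F' n x \<and> F'' k x = F'' n x" if "n \<le> k" "x \<in> U n" for n k x
    using that(1)
  proof (induction k rule: dec_induct)
    case (step k)
    have x: "x \<in> U k" using Umono[OF step(1)] that(2) by blast
    with c2_unique_open[OF c2_subset[OF cU Ustep] cU oU Fstep x] Fstep step show ?case by simp
  qed simp
  have xU: "x \<in> U (\<nu> x)" if x: "x \<in> {a<..<b}" for x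
  proof -
    have "\<forall>\<^sub>F n in sequentially. (\<phi> ^^ n) x < a + e"
      using it_tendsto[OF x] e(1) by (intro order_tendstoD(2)) auto
    then have "\<exists>n. (\<phi> ^^ n) x < a + e" by (auto simp: eventually_sequentially)
    from LeastI_ex[OF this] x show ?thesis by (simp add: U_def \<nu>_def)
  qed
  have \<nu>_le: "\<nu> x \<le> n" if "x \<in> U n" for x n
    using that unfolding \<nu>_def U_def by (auto intro: Least_le)
  define L L' L'' where "L x = F (\<nu> x) x" "L' x = F' (\<nu> x) x" "L'' x = F'' (\<nu> x) x" for x
  note L_defs = this
  have LF: "L x = F n x \<and> L' x = F' n x \<and> L'' x = F'' n x" if "x \<in> U n" for x n
    using Feq[OF \<nu>_le[OF that] xU] that by (simp add: L_defs U_def)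
  have cL: "c2 {a<..<b} L L' L''"
  proof (rule c2_local)
    fix x assume x: "x \<in> {a<..<b}"
    have "c2 (U (\<nu> x)) L L' L''" by (rule c2_cong[OF cU[of "\<nu> x"]]) (use LF in auto)
    moreover have "{a<..<b} \<inter> U (\<nu> x) = U (\<nu> x)" by (auto simp: U_def)
    ultimately show "\<exists>V. open V \<and> x \<in> V \<and> c2 ({a<..<b} \<inter> V) L L' L''"
      using oU xU[OF x] by metis
  qed
  have L1: "L (\<phi> x) = L x - 1" if x: "x \<in> {a<..<b}" for x
  proof -
    have "x \<in> U (Suc (\<nu> x))" using xU[OF x] Ustep by blast
    then have "\<phi> x \<in> U (\<nu> x)"
      using x diffeo_interval(2)[OF diffeo x] by (simp add: U_def funpow_swap1)
    with \<open>x \<in> U (Suc (\<nu> x))\<close> LF show ?thesis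
      by (simp add: F_def funpow_swap1)
  qed
  have L'_pos: "0 < L' x" if x: "x \<in> {a<..<b}" for x
    using m'[OF it_e[OF xU[OF x]]] D_pos[of x "\<nu> x"] x by (simp add: L_defs F'_def)
  have U0: "U 0 = {a<..<a+e}" using e by (auto simp: U_def)
  have near: "L x = m x" "L' x = m' x" "L'' x = m'' x" if "x \<in> {a<..<a+e}" for x
    using LF[of x 0] that U0 by (simp_all add: F_def F'_def F''_def iter_deriv_def iter_nonlin_def)
  have phi_I: "\<phi> ` {a<..<b} \<subseteq> {a<..<b}" using diffeo_interval(2)[OF diffeo] by blast
  have "c2 {a<..<b} \<phi> \<phi>' \<phi>''" using c2_phi by (rule c2_subset) auto
  from c2_compose[OF this cL phi_I] have
    "c2 {a<..<b} (\<lambda>x. L (\<phi> x)) (\<lambda>x. L' (\<phi> x) * \<phi>' x) (\<lambda>x. L'' (\<phi> x) * (\<phi>' x)\<^sup>2 + L' (\<phi> x) * \<phi>'' x)" .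
  note c\<phi> = this
  have c1: "c2 {a<..<b} (\<lambda>x. L x - 1) (\<lambda>x. L' x) (\<lambda>x. L'' x)"
    using c2_diff[OF cL c2_const] by simp
  have D1: "L' (\<phi> x) * \<phi>' x = L' x"
    and D2: "L'' (\<phi> x) * (\<phi>' x)\<^sup>2 + L' (\<phi> x) * \<phi>'' x = L'' x" if "x \<in> {a<..<b}" for x
    using c2_unique_open[OF c\<phi> c1 open_greaterThanLessThan L1 that] by simp_all
  \<comment> \<open>The quotient of the functional equation differentiated twice by the one
    differentiated once.\<close>
  have "L'' x / L' x = \<phi>'' x / \<phi>' x + L'' (\<phi> x) / L' (\<phi> x) * \<phi>' x" if "x \<in> {a<..<b}" for x
  proof -
    have "L' (\<phi> x) \<noteq> 0" "\<phi>' x \<noteq> 0"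
      using L'_pos[of "\<phi> x"] phi_I phi'_pos[of x] that by force+
    then show ?thesis
      unfolding D1[OF that, symmetric] D2[OF that, symmetric]
      by (simp add: power2_eq_square field_simps)
  qed
  then have "L'' x / L' x = A x" if "x \<in> {a<..<b}" for x
  proof (rule nonlin_eq_lim[OF _ e(1) _ that])
    fix x assume "x \<in> {a<..<b}" "x < a + e"
    then show "\<bar>L'' x / L' x\<bar> * (x - a) \<le> C" using near[of x] C[of x] by simp
  qed
  with that[OF cL near(1) L'_pos L1] show ?thesis by blast
qed

end

text \<open>From a suitable \<open>n\<close> on, the tails of both series are at most
  \<open>\<eta> / 2\<close> on the compact interval, with the same constants because both maps share
  \<open>B\<close>. The first \<open>n\<close> terms involve only points of the orbit, which stay
  above \<open>c\<close>, where the maps coincide. Thus \<open>c\<close> depends on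
  \<open>\<phi>\<close> and \<open>B\<close>, not on the modified map.\<close>

lemma lim_nonlin_stable:
  assumes "contraction a b \<phi> \<phi>' \<phi>'' B" and z: "a < z1" "z1 \<le> z2" "z2 < b" and \<eta>: "0 < \<eta>"
  obtains c where "a < c" "\<And>\<psi> \<psi>' \<psi>''. contraction a b \<psi> \<psi>' \<psi>'' B \<Longrightarrow>
    (\<And>x. c \<le> x \<Longrightarrow> x \<le> b \<Longrightarrow> \<psi> x = \<phi> x \<and> \<psi>' x = \<phi>' x \<and> \<psi>'' x = \<phi>'' x) \<Longrightarrow>
    (\<And>x. x \<in> {z1..z2} \<Longrightarrow> \<bar>lim_nonlin \<psi> \<psi>' \<psi>'' x - lim_nonlin \<phi> \<phi>' \<phi>'' x\<bar> \<le> \<eta>)"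
proof -
  interpret contraction a b \<phi> \<phi>' \<phi>'' B by fact
  obtain m where m: "0 < m" "\<And>x. x \<in> {z1..z2} \<Longrightarrow> m \<le> x - \<phi> x" using gap_pos[OF z] by blast
  have zI: "z1 \<in> {a<..<b}" "z2 \<in> {a<..<b}" using z by auto
  have "(\<lambda>n. B * E * ((\<phi> ^^ n) z2 - a)) \<longlonglongrightarrow> B * E * (a - a)"
    by (intro tendsto_intros it_tendsto zI)
  then have "\<forall>\<^sub>F n in sequentially. B * E * ((\<phi> ^^ n) z2 - a) < \<eta> * m / 2"
    using \<eta> m by (intro order_tendstoD(2)) auto
  then obtain n where n: "B * E * ((\<phi> ^^ n) z2 - a) < \<eta> * m / 2"
    by (auto simp: eventually_sequentially)
  \<comment> \<open>The lowest point that the first \<open>n\<close> iterates of points of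
    \<open>{z1..z2}\<close> can reach.\<close>
  define c where "c = (\<phi> ^^ n) z1"
  show thesis
  proof (rule that[of c])
    show "a < c" using it_in[OF zI(1)] by (auto simp: c_def)
    fix \<psi> \<psi>' \<psi>'' x
    assume psi: "contraction a b \<psi> \<psi>' \<psi>'' B" and x: "x \<in> {z1..z2}"
      and eq: "\<And>x. c \<le> x \<Longrightarrow> x \<le> b \<Longrightarrow> \<psi> x = \<phi> x \<and> \<psi>' x = \<phi>' x \<and> \<psi>'' x = \<phi>'' x"
    interpret P: contraction a b \<psi> \<psi>' \<psi>'' B by (rule psi)
    have xI: "x \<in> {a<..<b}" using x z by auto
    have ge: "c \<le> (\<phi> ^^ i) x" if "i \<le> n" for i
      using diffeo_less_iff(3)[OF it_dif, of z1 x n] it_antimono[OF xI that] x xI zI by (auto simp: c_def)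
    have it: "(\<psi> ^^ i) x = (\<phi> ^^ i) x" if "i \<le> n" for i
      using that
    proof (induction i)
      case (Suc i)
      then show ?case using eq[of "(\<phi> ^^ i) x"] ge[of i] it_in[OF xI, of i] by auto
    qed simp
    have eq': "\<psi>' ((\<psi> ^^ i) x) = \<phi>' ((\<phi> ^^ i) x)" "\<psi>'' ((\<psi> ^^ i) x) = \<phi>'' ((\<phi> ^^ i) x)" if "i < n" for i
      using it[of i] eq[of "(\<phi> ^^ i) x"] ge[of i] it_in[OF xI, of i] that by auto
    have "P.D i x = D i x" if "i \<le> n" for i
      unfolding iter_deriv_def by (intro prod.cong) (use that eq' in auto)
    then have S: "P.S n x = S n x"
      unfolding iter_nonlin_def by (intro sum.cong) (use eq' in auto)
    have "\<psi> x = \<phi> x" using eq[of x] ge[of 0] xI by auto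
    have "P.E = E" by (simp add: E_def P.E_def)
    have "B * E * ((\<phi> ^^ n) x - a) \<le> B * E * ((\<phi> ^^ n) z2 - a)"
      using B_nonneg E_pos diffeo_less_iff(3)[OF it_dif, of x z2 n] x xI zI by (intro mult_left_mono) auto
    then have "\<bar>P.A x - S n x\<bar> * (x - \<phi> x) \<le> \<eta> * m / 2" "\<bar>A x - S n x\<bar> * (x - \<phi> x) \<le> \<eta> * m / 2"
      using P.A_bound[OF xI, of n] A_bound[OF xI, of n] n it[of n] S \<open>\<psi> x = \<phi> x\<close> \<open>P.E = E\<close> by auto
    moreover have "\<eta> * m / 2 \<le> \<eta> / 2 * (x - \<phi> x)" using m(2)[OF x] \<eta> by simp
    moreover have "x - \<phi> x > 0" using m(1) m(2)[OF x] by linarith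
    ultimately have "\<bar>P.A x - S n x\<bar> \<le> \<eta> / 2" "\<bar>A x - S n x\<bar> \<le> \<eta> / 2"
      by (meson mult_le_cancel_right_pos order_trans)+
    then show "\<bar>P.A x - A x\<bar> \<le> \<eta>" by linarith
  qed
qed

section \<open>Vanishing asymptotic variation\<close>

lemma funpow_cong_on:
  assumes "\<And>x. x \<in> S \<Longrightarrow> f x = g x" "\<And>x. x \<in> S \<Longrightarrow> g x \<in> S" "x \<in> S"
  shows "(f ^^ n) x = (g ^^ n) x"
proof -
  have "(f ^^ n) x = (g ^^ n) x \<and> (g ^^ n) x \<in> S" by (induction n) (use assms in auto)
  then show ?thesis ..
qed

lemma iter_deriv_add:
  "iter_deriv f f' (m + n) x = iter_deriv f f' m x * iter_deriv f f' n ((f ^^ m) x)"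
proof (induction n)
  case (Suc n)
  have "(f ^^ (m + n)) x = (f ^^ n) ((f ^^ m) x)"
    using funpow_add[of n m f] by (simp add: add.commute)
  with Suc show ?case by (simp add: iter_deriv_def)
qed (simp add: iter_deriv_def)

lemma funpow_reflect:
  "((\<lambda>x::real. s - f (s - x)) ^^ n) x = s - (f ^^ n) (s - x)"
  by (induction n) auto

lemma iter_deriv_reflect:
  "iter_deriv (\<lambda>x. s - f (s - x)) (\<lambda>x. f' (s - x)) n x = iter_deriv f f' n (s - x)"
  by (simp add: iter_deriv_def funpow_reflect)

lemma iter_nonlin_reflect:
  "iter_nonlin (\<lambda>x. s - f (s - x)) (\<lambda>x. f' (s - x)) (\<lambda>x. - f'' (s - x)) n x
    = - iter_nonlin f f' f'' n (s - x)"
  by (simp add: iter_nonlin_def funpow_reflect iter_deriv_reflect sum_negf)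

text \<open>The end points are interleaved into one chain p 0, q 0, p 1, q 1, and so on, of which
  only the steps with even index are kept.\<close>

lemma log_variation_intervals:
  fixes p q :: "nat \<Rightarrow> real"
  assumes f: "f \<in> Diff2"
    and pq: "\<And>m. m \<le> N \<Longrightarrow> p m \<le> q m" "\<And>m. m < N \<Longrightarrow> q m \<le> p (Suc m)"
    and I: "\<And>m. m \<le> N \<Longrightarrow> p m \<in> {0..1}" "\<And>m. m \<le> N \<Longrightarrow> q m \<in> {0..1}"
  shows "(\<Sum>m\<le>N. \<bar>ln (D1 f (q m)) - ln (D1 f (p m))\<bar>) \<le> log_variation f"
proof -
  define u where "u i = (if even i then p (i div 2) else q (i div 2))" for i :: nat
  let ?G = "\<lambda>i. \<bar>ln (D1 f (u (Suc i))) - ln (D1 f (u i))\<bar>"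
  have step: "u i \<le> u (Suc i)" if "i < 2 * N + 1" for i
  proof (cases "even i")
    case True
    then obtain j where "i = 2 * j" by blast
    with pq(1)[of j] that show ?thesis by (simp add: u_def)
  next
    case False
    then obtain j where "i = 2 * j + 1" by (blast elim: oddE)
    with pq(2)[of j] that show ?thesis by (simp add: u_def)
  qed
  have "u i \<le> u j" if "i \<le> j" "j \<le> 2 * N + 1" for i j
    using that
  proof (induction j rule: dec_induct)
    case (step j)
    then show ?case using \<open>\<And>i. i < 2 * N + 1 \<Longrightarrow> u i \<le> u (Suc i)\<close>[of j] by simp
  qed simp
  then have "mono_on {..2 * N + 1} u" by (auto simp: mono_on_def)
  moreover have "u i \<in> {0..1}" if "i \<le> 2 * N + 1" for i
    using I[of "i div 2"] that by (simp add: u_def)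
  ultimately have "(\<Sum>i<2 * N + 1. ?G i) \<le> log_variation f"
    by (rule log_variation_upper[OF f])
  moreover have "(\<Sum>m\<le>N. \<bar>ln (D1 f (q m)) - ln (D1 f (p m))\<bar>) = (\<Sum>i\<in>(\<lambda>m. 2 * m) ` {..N}. ?G i)"
    by (subst sum.reindex) (auto simp: inj_on_def u_def)
  moreover have "(\<Sum>i\<in>(\<lambda>m. 2 * m) ` {..N}. ?G i) \<le> (\<Sum>i<2 * N + 1. ?G i)"
    by (rule sum_mono2) auto
  ultimately show ?thesis by linarith
qed

text \<open>One map together with its inverse: \<open>\<phi>\<close> attracts to \<open>a\<close>
  and \<open>\<psi>\<close> to \<open>b\<close>. The second contraction is \<open>\<psi>\<close>
  seen through the reflection of the interval, so that the results about left ends apply at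
  \<open>b\<close>.\<close>

locale two_sided =
  fixes a b \<phi> \<phi>' \<phi>'' \<psi> \<psi>' \<psi>'' B
  assumes L: "contraction a b \<phi> \<phi>' \<phi>'' B"
    and R: "contraction a b (\<lambda>x. a + b - \<psi> (a + b - x)) (\<lambda>x. \<psi>' (a + b - x)) (\<lambda>x. - \<psi>'' (a + b - x)) B"
    and diffeo_psi: "diffeo a b \<psi> \<psi>' \<psi>''"
    and inv: "x \<in> {a..b} \<Longrightarrow> \<psi> (\<phi> x) = x" "x \<in> {a..b} \<Longrightarrow> \<phi> (\<psi> x) = x"
    and inv': "x \<in> {a..b} \<Longrightarrow> \<psi>' (\<phi> x) * \<phi>' x = 1"
begin

sublocale L: contraction a b \<phi> \<phi>' \<phi>'' B by (rule L)

sublocale R: contraction a b "\<lambda>x. a + b - \<psi> (a + b - x)" "\<lambda>x. \<psi>' (a + b - x)" "\<lambda>x. - \<psi>'' (a + b - x)" B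
  by (rule R)

text \<open>The limit of D log D\<psi>^n in the original coordinate; reflection changes the sign of
  a nonlinearity.\<close>

definition "Apsi x = - R.A (a + b - x)"

abbreviation "D\<psi> \<equiv> iter_deriv \<psi> \<psi>'"
abbreviation "S\<psi> \<equiv> iter_nonlin \<psi> \<psi>' \<psi>''"

lemma inv'': "x \<in> {a..b} \<Longrightarrow> \<phi>' (\<psi> x) * \<psi>' x = 1"
  using inv'[of "\<psi> x"] inv(2)[of x] diffeo_interval(1)[OF diffeo_psi, of x] by (simp add: mult.commute)

lemma pow_inv: "x \<in> {a..b} \<Longrightarrow> (\<psi> ^^ m) ((\<phi> ^^ m) x) = x" "x \<in> {a..b} \<Longrightarrow> (\<phi> ^^ m) ((\<psi> ^^ m) x) = x"
proof (induction m arbitrary: x)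
  case (Suc m)
  { case 1
    then show ?case using Suc inv(1)[of "(\<phi> ^^ m) x"] L.it_in'[of x m] by (simp add: funpow_swap1) }
  { case 2
    then show ?case using Suc inv(2)[of "(\<psi> ^^ m) x"] diffeo_interval(1)[OF diffeo_funpow[OF diffeo_psi], of x m]
      by (simp add: funpow_swap1) }
qed simp_all

lemma deriv_pow_inv:
  "x \<in> {a..b} \<Longrightarrow> D\<psi> m ((\<phi> ^^ m) x) * L.D m x = 1"
  "x \<in> {a..b} \<Longrightarrow> L.D m ((\<psi> ^^ m) x) * D\<psi> m x = 1"
proof (induction m arbitrary: x)
  case (Suc m)
  { case 1
    have "D\<psi> (Suc m) ((\<phi> ^^ Suc m) x) = \<psi>' (\<phi> ((\<phi> ^^ m) x)) * D\<psi> m ((\<phi> ^^ m) x)"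
      using iter_deriv_add[of \<psi> \<psi>' 1 m] inv(1)[OF L.it_in'[OF 1]] by (simp add: iter_deriv_def)
    moreover have "L.D (Suc m) x = L.D m x * \<phi>' ((\<phi> ^^ m) x)" by (simp add: iter_deriv_def)
    ultimately show ?case
      using Suc.IH(1)[OF 1] inv'[OF L.it_in'[OF 1, of m]] by (metis mult.commute mult.left_commute mult_1) }
  { case 2
    have it: "(\<psi> ^^ m) x \<in> {a..b}" using diffeo_interval(1)[OF diffeo_funpow[OF diffeo_psi] 2] .
    have "L.D (Suc m) ((\<psi> ^^ Suc m) x) = \<phi>' (\<psi> ((\<psi> ^^ m) x)) * L.D m ((\<psi> ^^ m) x)"
      using iter_deriv_add[of \<phi> \<phi>' 1 m] inv(2)[OF it] by (simp add: iter_deriv_def)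
    moreover have "D\<psi> (Suc m) x = D\<psi> m x * \<psi>' ((\<psi> ^^ m) x)" by (simp add: iter_deriv_def)
    ultimately show ?case
      using Suc.IH(2)[OF 2] inv''[OF it] by (metis mult.commute mult.left_commute mult_1) }
qed (simp_all add: iter_deriv_def)

lemma psi_pos: "x \<in> {a..b} \<Longrightarrow> 0 < D\<psi> n x"
  using diffeo_funpow[OF diffeo_psi, of n] by (simp add: diffeo_def)

lemma Spsi_uniform_limit:
  assumes "a < z1" "z1 \<le> z2" "z2 < b"
  shows "uniform_limit {z1..z2} S\<psi> Apsi sequentially"
proof -
  have "uniform_limit {a + b - z2..a + b - z1} R.S R.A sequentially"
    using assms by (intro R.S_uniform_limit) auto
  then have "uniform_limit {a + b - z2..a + b - z1} (\<lambda>n x. - R.S n x) (\<lambda>x. - R.A x) sequentially"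
    by (rule uniform_limit_uminus)
  then have "uniform_limit {z1..z2} (\<lambda>n x. - R.S n (a + b - x)) (\<lambda>x. - R.A (a + b - x)) sequentially"
    by (rule uniform_limit_compose'[where h="\<lambda>x. a + b - x"]) auto
  then show ?thesis by (simp add: Apsi_def[abs_def] iter_nonlin_reflect)
qed

lemma Apsi_continuous: "continuous_on {a<..<b} Apsi"
  unfolding Apsi_def
  by (intro continuous_intros continuous_on_compose2[OF R.A_continuous]) auto

text \<open>For \<open>m + j = N\<close> this is the increment of log D\<psi>^N from \<phi>^m y to
  \<phi>^m x, because \<psi>^N after \<phi>^m is \<psi>^j. Up to sign it is also the increment of
  log D\<phi>^N from \<psi>^j y to \<psi>^j x, so both directions of motion of \<open>f\<close> lead
  to the same sum of absolute values.\<close>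

definition "defect m j x y = (ln (D\<psi> j x) - ln (D\<psi> j y)) - (ln (L.D m x) - ln (L.D m y))"

lemma ln_deriv_psi:
  assumes x: "x \<in> {a..b}" and m: "m \<le> N"
  shows "ln (D\<psi> N ((\<phi> ^^ m) x)) = ln (D\<psi> (N - m) x) - ln (L.D m x)"
proof -
  have "D\<psi> N ((\<phi> ^^ m) x) = D\<psi> m ((\<phi> ^^ m) x) * D\<psi> (N - m) x"
    using iter_deriv_add[of \<psi> \<psi>' m "N - m" "(\<phi> ^^ m) x"] m pow_inv(1)[OF x] by simp
  also have "D\<psi> m ((\<phi> ^^ m) x) = 1 / L.D m x"
    using deriv_pow_inv(1)[OF x, of m] L.D_pos[OF x, of m] by (simp add: field_simps)
  finally show ?thesis using L.D_pos[OF x, of m] psi_pos[OF x, of "N - m"] by (simp add: ln_div)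
qed

lemma ln_deriv_phi:
  assumes x: "x \<in> {a..b}" and m: "m \<le> N"
  shows "ln (L.D N ((\<psi> ^^ m) x)) = ln (L.D (N - m) x) - ln (D\<psi> m x)"
proof -
  have "L.D N ((\<psi> ^^ m) x) = L.D m ((\<psi> ^^ m) x) * L.D (N - m) x"
    using iter_deriv_add[of \<phi> \<phi>' m "N - m" "(\<psi> ^^ m) x"] m pow_inv(2)[OF x] by simp
  also have "L.D m ((\<psi> ^^ m) x) = 1 / D\<psi> m x"
    using deriv_pow_inv(2)[OF x, of m] psi_pos[OF x, of m] by (simp add: field_simps)
  finally show ?thesis using psi_pos[OF x, of m] L.D_pos[OF x, of "N - m"] by (simp add: ln_div)
qed

lemma defect_sum:
  assumes f: "f \<in> Diff2" and I: "0 \<le> a" "b \<le> 1"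
    and f\<phi>: "(\<forall>x\<in>{a..b}. f x = \<phi> x \<and> D1 f x = \<phi>' x) \<or> (\<forall>x\<in>{a..b}. f x = \<psi> x \<and> D1 f x = \<psi>' x)"
    and xy: "x \<in> {a<..<b}" "y \<in> {a<..<b}" "\<phi> x \<le> y" "y \<le> x"
  shows "(\<Sum>m\<le>N. \<bar>defect m (N - m) x y\<bar>) \<le> log_variation (f [^]\<^bsub>BG\<^esub> N)"
  using f\<phi>
proof
  assume eq: "\<forall>x\<in>{a..b}. f x = \<psi> x \<and> D1 f x = \<psi>' x"
  have D: "D1 (f [^]\<^bsub>BG\<^esub> N) z = D\<psi> N z" if "z \<in> {a..b}" for z
  proof -
    have z: "z \<in> {0..1}" using that I by auto
    show ?thesis
      unfolding D1_pow[OF f z] iter_deriv_def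
      using funpow_cong_on[of "{a..b}" f \<psi>, OF _ diffeo_interval(1)[OF diffeo_psi] that] eq diffeo_interval(1)[OF diffeo_funpow[OF diffeo_psi] that]
      by (intro prod.cong refl) (metis (no_types))
  qed
  have xy': "x \<in> {a..b}" "y \<in> {a..b}" using xy by auto
  \<comment> \<open>Numbered backwards: \<open>\<phi>\<close> moves the intervals to the left, while
    \<open>log_variation_intervals\<close> wants them ordered to the right. They meet at most in end
    points because \<open>\<phi> x \<le> y\<close>.\<close>
  define p q where "p m = (\<phi> ^^ (N - m)) y" and "q m = (\<phi> ^^ (N - m)) x" for m
  have pI: "p m \<in> {a..b}" "q m \<in> {a..b}" for m
    unfolding p_def q_def using L.it_in'[of _ "N - m"] xy' by blast+
  have "(\<Sum>m\<le>N. \<bar>ln (D1 (f [^]\<^bsub>BG\<^esub> N) (q m)) - ln (D1 (f [^]\<^bsub>BG\<^esub> N) (p m))\<bar>)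
      \<le> log_variation (f [^]\<^bsub>BG\<^esub> N)"
  proof (rule log_variation_intervals)
    show "f [^]\<^bsub>BG\<^esub> N \<in> Diff2" using f by simp
    show "p m \<in> {0..1}" "q m \<in> {0..1}" for m using pI[of m] I by auto
    show "p m \<le> q m" for m
      unfolding p_def q_def using diffeo_less_iff(3)[OF L.it_dif, of y x "N - m"] xy xy' by simp
    fix m assume "m < N"
    then have s: "N - m = Suc (N - Suc m)" by simp
    show "q m \<le> p (Suc m)"
      unfolding p_def q_def s funpow_Suc_right o_def
      using diffeo_less_iff(3)[OF L.it_dif, of "\<phi> x" y "N - Suc m"] xy xy' diffeo_interval(1)[OF L.diffeo xy'(1)] by simp
  qed
  moreover have "(\<Sum>m\<le>N. \<bar>ln (D1 (f [^]\<^bsub>BG\<^esub> N) (q m)) - ln (D1 (f [^]\<^bsub>BG\<^esub> N) (p m))\<bar>)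
      = (\<Sum>m\<le>N. \<bar>defect (N - m) (N - (N - m)) x y\<bar>)"
    unfolding D[OF pI(1)] D[OF pI(2)] defect_def
    by (intro sum.cong refl) (simp add: p_def q_def ln_deriv_psi[OF xy'(1)] ln_deriv_psi[OF xy'(2)])
  moreover have "(\<Sum>m\<le>N. \<bar>defect (N - m) (N - (N - m)) x y\<bar>) = (\<Sum>m\<le>N. \<bar>defect m (N - m) x y\<bar>)"
    using sum.nat_diff_reindex[of "\<lambda>m. \<bar>defect m (N - m) x y\<bar>" "Suc N"]
    by (simp add: lessThan_Suc_atMost)
  ultimately show ?thesis by simp
next
  assume eq: "\<forall>x\<in>{a..b}. f x = \<phi> x \<and> D1 f x = \<phi>' x"
  have D: "D1 (f [^]\<^bsub>BG\<^esub> N) z = L.D N z" if "z \<in> {a..b}" for z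
  proof -
    have z: "z \<in> {0..1}" using that I by auto
    show ?thesis
      unfolding D1_pow[OF f z] iter_deriv_def
      using funpow_cong_on[of "{a..b}" f \<phi>, OF _ diffeo_interval(1)[OF L.diffeo] that] eq diffeo_interval(1)[OF L.it_dif that]
      by (intro prod.cong refl) (metis (no_types))
  qed
  have xy': "x \<in> {a..b}" "y \<in> {a..b}" using xy by auto
  define p q where "p m = (\<psi> ^^ m) y" and "q m = (\<psi> ^^ m) x" for m
  note psi_it = diffeo_funpow[OF diffeo_psi]
  have pI: "p m \<in> {a..b}" "q m \<in> {a..b}" for m
    unfolding p_def q_def using diffeo_interval(1)[OF psi_it] xy' by blast+
  have "x \<le> \<psi> y"
    using xy(3) inv(1)[OF xy'(1)] diffeo_less_iff(3)[OF diffeo_psi, of "\<phi> x" y] xy' diffeo_interval(1)[OF L.diffeo xy'(1)]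
    by simp
  have "(\<Sum>m\<le>N. \<bar>ln (D1 (f [^]\<^bsub>BG\<^esub> N) (q m)) - ln (D1 (f [^]\<^bsub>BG\<^esub> N) (p m))\<bar>)
      \<le> log_variation (f [^]\<^bsub>BG\<^esub> N)"
  proof (rule log_variation_intervals)
    show "f [^]\<^bsub>BG\<^esub> N \<in> Diff2" using f by simp
    show "p m \<in> {0..1}" "q m \<in> {0..1}" for m using pI[of m] I by auto
    show "p m \<le> q m" for m
      unfolding p_def q_def using diffeo_less_iff(3)[OF psi_it, of y x m] xy xy' by simp
    show "q m \<le> p (Suc m)" for m
      unfolding p_def q_def funpow_Suc_right o_def
      using diffeo_less_iff(3)[OF psi_it, of x "\<psi> y" m] \<open>x \<le> \<psi> y\<close> xy' diffeo_interval(1)[OF diffeo_psi xy'(2)] by simp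
  qed
  moreover have "(\<Sum>m\<le>N. \<bar>ln (D1 (f [^]\<^bsub>BG\<^esub> N) (q m)) - ln (D1 (f [^]\<^bsub>BG\<^esub> N) (p m))\<bar>)
      = (\<Sum>m\<le>N. \<bar>defect (N - m) (N - (N - m)) x y\<bar>)"
    unfolding D[OF pI(1)] D[OF pI(2)] defect_def
    by (intro sum.cong refl) (simp add: p_def q_def ln_deriv_phi[OF xy'(1)] ln_deriv_phi[OF xy'(2)])
  moreover have "(\<Sum>m\<le>N. \<bar>defect (N - m) (N - (N - m)) x y\<bar>) = (\<Sum>m\<le>N. \<bar>defect m (N - m) x y\<bar>)"
    using sum.nat_diff_reindex[of "\<lambda>m. \<bar>defect m (N - m) x y\<bar>" "Suc N"]
    by (simp add: lessThan_Suc_atMost)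
  ultimately show ?thesis by simp
qed

lemma defect_mvt:
  assumes "x \<in> {a<..<b}" "y \<in> {a<..<b}" "y < x"
  obtains z where "y < z" "z < x" "defect m j x y = (S\<psi> j z - L.S m z) * (x - y)"
proof -
  have d: "((\<lambda>z. ln (D\<psi> j z) - ln (L.D m z)) has_real_derivative S\<psi> j z - L.S m z) (at z within {a..b})"
    if z: "z \<in> {a..b}" for z
  proof -
    have "(D\<psi> j has_real_derivative S\<psi> j z * D\<psi> j z) (at z within {a..b})"
      "(L.D m has_real_derivative L.S m z * L.D m z) (at z within {a..b})"
      using c2D(2)[OF diffeo_c2[OF diffeo_funpow[OF diffeo_psi]] z] c2D(2)[OF diffeo_c2[OF L.it_dif] z] by auto
    then show ?thesis
      using psi_pos[OF z, of j] L.D_pos[OF z, of m] by (auto intro!: derivative_eq_intros)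
  qed
  obtain z where "y < z" "z < x"
    "ln (D\<psi> j x) - ln (L.D m x) - (ln (D\<psi> j y) - ln (L.D m y)) = (S\<psi> j z - L.S m z) * (x - y)"
    using mvt_within[OF d, of y x] assms by auto
  with that show thesis by (simp add: defect_def algebra_simps)
qed

text \<open>If the two limits differed at a point, every one of the \<open>N\<close> disjoint images of a small
  interval around it would contribute a fixed amount to the variation of \<open>log Df\<^sup>N\<close>.\<close>

lemma lim_nonlin_agree:
  assumes f: "f \<in> Diff2_V" and I: "0 \<le> a" "b \<le> 1"
    and f\<phi>: "(\<forall>x\<in>{a..b}. f x = \<phi> x \<and> D1 f x = \<phi>' x) \<or> (\<forall>x\<in>{a..b}. f x = \<psi> x \<and> D1 f x = \<psi>' x)"
    and x0: "x0 \<in> {a<..<b}"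
  shows "L.A x0 = Apsi x0"
proof (rule ccontr)
  assume ne: "L.A x0 \<noteq> Apsi x0"
  \<comment> \<open>A quarter of the gap: one part is lost to continuity around \<open>x0\<close>,
    one to each of the two uniform limits, and one remains.\<close>
  define \<tau> where "\<tau> = \<bar>Apsi x0 - L.A x0\<bar> / 4"
  have \<tau>: "0 < \<tau>" using ne by (simp add: \<tau>_def)
  have fD: "f \<in> Diff2" and V: "(\<lambda>n. log_variation (f [^]\<^bsub>BG\<^esub> n) / real n) \<longlonglongrightarrow> 0"
    using f asymptotic_variation_tendsto[of f] by (auto simp: Diff2_V_def)
  have "isCont (\<lambda>x. Apsi x - L.A x) x0"
    using Apsi_continuous L.A_continuous x0 by (intro continuous_on_interior[of "{a<..<b}"] continuous_intros) auto
  then obtain d1 where d1: "d1 > 0" "\<And>z. \<bar>z - x0\<bar> < d1 \<Longrightarrow> \<bar>(Apsi z - L.A z) - (Apsi x0 - L.A x0)\<bar> < \<tau>"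
    using \<tau> unfolding continuous_at_eps_delta dist_real_def by blast
  have "\<phi> x0 < x0" using L.less x0 by simp
  \<comment> \<open>Not below \<open>\<phi> x0\<close>, so that the iterated intervals do not
    overlap, and close enough to \<open>x0\<close> for the two limits to stay apart on the whole
    interval.\<close>
  define y where "y = Max {\<phi> x0, x0 - d1 / 2}"
  have y: "y < x0" "\<phi> x0 \<le> y" "x0 - d1 < y" using \<open>\<phi> x0 < x0\<close> d1(1) by (auto simp: y_def)
  have yI: "y \<in> {a<..<b}" using y x0 diffeo_interval(2)[OF L.diffeo x0] by auto
  have far: "\<bar>Apsi z - L.A z\<bar> > 3 * \<tau>" if "z \<in> {y..x0}" for z
  proof -
    have *: "\<bar>(Apsi z - L.A z) - (Apsi x0 - L.A x0)\<bar> < \<tau>" using d1(2)[of z] that y by auto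
    moreover have "4 * \<tau> = \<bar>Apsi x0 - L.A x0\<bar>" by (simp add: \<tau>_def)
    ultimately show "\<bar>Apsi z - L.A z\<bar> > 3 * \<tau>" by linarith
  qed
  have "\<forall>\<^sub>F n in sequentially. \<forall>z\<in>{y..x0}. dist (S\<psi> n z) (Apsi z) < \<tau>"
    "\<forall>\<^sub>F n in sequentially. \<forall>z\<in>{y..x0}. dist (L.S n z) (L.A z) < \<tau>"
    using uniform_limitD[OF Spsi_uniform_limit \<tau>, of y x0] uniform_limitD[OF L.S_uniform_limit \<tau>, of y x0]
      y yI x0 by auto
  then have "\<forall>\<^sub>F n in sequentially. \<forall>z\<in>{y..x0}. dist (S\<psi> n z) (Apsi z) < \<tau> \<and> dist (L.S n z) (L.A z) < \<tau>"
    by eventually_elim auto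
  then obtain M where M: "\<And>n z. n \<ge> M \<Longrightarrow> z \<in> {y..x0} \<Longrightarrow> dist (S\<psi> n z) (Apsi z) < \<tau> \<and> dist (L.S n z) (L.A z) < \<tau>"
    unfolding eventually_sequentially by blast
  define c where "c = \<tau> * (x0 - y)"
  have c: "0 < c" using \<tau> y by (simp add: c_def)
  have big: "c \<le> \<bar>defect m j x0 y\<bar>" if "m \<ge> M" "j \<ge> M" for m j
  proof -
    obtain z where z: "y < z" "z < x0" "defect m j x0 y = (S\<psi> j z - L.S m z) * (x0 - y)"
      using defect_mvt[OF x0 yI y(1)] by blast
    then have zI: "z \<in> {y..x0}" by simp
    have "\<tau> \<le> \<bar>S\<psi> j z - L.S m z\<bar>"
      using far[OF zI] M[OF that(1) zI] M[OF that(2) zI] unfolding dist_real_def by linarith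
    then show ?thesis using z y by (simp add: c_def abs_mult)
  qed
  have lower: "c * (real N - 2 * real M) \<le> log_variation (f [^]\<^bsub>BG\<^esub> N)" if "N \<ge> 2 * M" for N
  proof -
    \<comment> \<open>Only indices with both \<open>m\<close> and \<open>N - m\<close> at least
      \<open>M\<close> are kept; the number of lost ones does not depend on
      \<open>N\<close>.\<close>
    have "c * (real N - 2 * real M) \<le> c * real (card {M..N - M})"
      using c that by (intro mult_left_mono) (auto simp: of_nat_diff)
    also have "\<dots> = (\<Sum>m\<in>{M..N - M}. c)" by simp
    also have "\<dots> \<le> (\<Sum>m\<in>{M..N - M}. \<bar>defect m (N - m) x0 y\<bar>)"
      by (intro sum_mono big) (use that in auto)
    also have "\<dots> \<le> (\<Sum>m\<le>N. \<bar>defect m (N - m) x0 y\<bar>)" by (rule sum_mono2) auto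
    also have "\<dots> \<le> log_variation (f [^]\<^bsub>BG\<^esub> N)"
      using defect_sum[OF fD I f\<phi> x0 yI] y by simp
    finally show ?thesis .
  qed
  have "(\<lambda>N. c * (1 - 2 * real M / real N)) \<longlonglongrightarrow> c * (1 - 0)"
    by (intro tendsto_intros lim_const_over_n)
  moreover note V
  ultimately have "c * (1 - 0) \<le> 0"
  proof (rule LIMSEQ_le, intro exI allI impI)
    fix N assume N: "N \<ge> 2 * M + 1"
    then show "c * (1 - 2 * real M / real N) \<le> log_variation (f [^]\<^bsub>BG\<^esub> N) / real N"
      using divide_right_mono[OF lower[of N], of "real N"] by (simp add: right_diff_distrib diff_divide_distrib)
  qed
  with c show False by simp
qed

end

section \<open>Model germs\<close>

lemma DERIV_mult_abs: "((\<lambda>t::real. t * \<bar>t\<bar>) has_real_derivative 2 * \<bar>x\<bar>) (at x)"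
proof -
  consider "x > 0" | "x < 0" | "x = 0" by linarith
  then show ?thesis
  proof cases
    case 1
    have "((\<lambda>t::real. t * t) has_real_derivative 2 * \<bar>x\<bar>) (at x)"
      using 1 by (auto intro!: derivative_eq_intros)
    then show ?thesis
      by (rule has_field_derivative_transform_within_open[of _ _ _ "{0<..}"]) (use 1 in auto)
  next
    case 2
    have "((\<lambda>t::real. - (t * t)) has_real_derivative 2 * \<bar>x\<bar>) (at x)"
      using 2 by (auto intro!: derivative_eq_intros)
    then show ?thesis
      by (rule has_field_derivative_transform_within_open[of _ _ _ "{..<0}"]) (use 2 in auto)
  next
    case 3
    have "(\<lambda>t::real. \<bar>t\<bar>) \<midarrow>0\<rightarrow> 0" by (intro tendsto_rabs_zero tendsto_ident_at)
    then have "(\<lambda>t::real. (t * \<bar>t\<bar>) / t) \<midarrow>0\<rightarrow> 0"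
      by (rule Lim_transform_eventually) (auto simp: eventually_at_filter)
    with 3 show ?thesis by (simp add: has_field_derivative_iff)
  qed
qed

text \<open>The function is the cube of the absolute value. Splines built from it need no case
  distinction at their knots.\<close>

lemma c2_abs_cube: "c2 UNIV (\<lambda>t. t * (t * \<bar>t\<bar>)) (\<lambda>t. 3 * (t * \<bar>t\<bar>)) (\<lambda>t. 6 * \<bar>t\<bar>)"
proof -
  have "((\<lambda>t. t * (t * \<bar>t\<bar>)) has_real_derivative 3 * (x * \<bar>x\<bar>)) (at x)" for x :: real
    using DERIV_mult[OF DERIV_ident DERIV_mult_abs[of x]] by (simp add: algebra_simps)
  moreover have "((\<lambda>t. 3 * (t * \<bar>t\<bar>)) has_real_derivative 6 * \<bar>x\<bar>) (at x)" for x :: real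
    using DERIV_cmult[OF DERIV_mult_abs[of x], of 3] by simp
  ultimately show ?thesis by (auto simp: c2_def intro!: continuous_intros)
qed

text \<open>The integral of the quadratic B-spline with knots \<open>0, 1, 2, 3\<close>: a cubic spline which is
  \<open>0\<close> up to \<open>0\<close> and \<open>1\<close> from \<open>3\<close> on.\<close>

definition cutoff :: "real \<Rightarrow> real" where
  "cutoff t = 1/2 + (t * (t * \<bar>t\<bar>) - 3 * ((t - 1) * ((t - 1) * \<bar>t - 1\<bar>))
     + 3 * ((t - 2) * ((t - 2) * \<bar>t - 2\<bar>)) - (t - 3) * ((t - 3) * \<bar>t - 3\<bar>)) / 12"

definition cutoff' :: "real \<Rightarrow> real" where
  "cutoff' t = (t * \<bar>t\<bar> - 3 * ((t - 1) * \<bar>t - 1\<bar>) + 3 * ((t - 2) * \<bar>t - 2\<bar>) - (t - 3) * \<bar>t - 3\<bar>) / 4"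

definition cutoff'' :: "real \<Rightarrow> real" where
  "cutoff'' t = (\<bar>t\<bar> - 3 * \<bar>t - 1\<bar> + 3 * \<bar>t - 2\<bar> - \<bar>t - 3\<bar>) / 2"

lemma c2_cutoff: "c2 UNIV cutoff cutoff' cutoff''"
proof -
  have s: "c2 UNIV (\<lambda>t. (t - c) * ((t - c) * \<bar>t - c\<bar>)) (\<lambda>t. 3 * ((t - c) * \<bar>t - c\<bar>)) (\<lambda>t. 6 * \<bar>t - c\<bar>)"
    for c :: real
    using c2_compose[OF c2_diff[OF c2_id c2_const[of UNIV c]] c2_abs_cube] by simp
  show ?thesis
    by (rule c2_cong[OF c2_add[OF c2_const[of UNIV "1/2"] c2_cmult[where c="1/12", OF c2_diff[OF c2_add[OF c2_diff[OF
      s[of 0] c2_cmult[OF s[of 1], of 3]] c2_cmult[OF s[of 2], of 3]] s[of 3]]]]])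
      (simp_all add: cutoff_def cutoff'_def cutoff''_def field_simps)
qed

lemma cutoff_left: "t \<le> 0 \<Longrightarrow> cutoff t = 0" "t \<le> 0 \<Longrightarrow> cutoff' t = 0" "t \<le> 0 \<Longrightarrow> cutoff'' t = 0"
  and cutoff_right: "3 \<le> t \<Longrightarrow> cutoff t = 1" "3 \<le> t \<Longrightarrow> cutoff' t = 0" "3 \<le> t \<Longrightarrow> cutoff'' t = 0"
  by (simp_all add: cutoff_def cutoff'_def cutoff''_def algebra_simps)

lemma cutoff''_bound: "\<bar>cutoff'' t\<bar> \<le> 1"
proof -
  consider "t \<le> 0" | "0 \<le> t" "t \<le> 1" | "1 \<le> t" "t \<le> 2" | "2 \<le> t" "t \<le> 3" | "3 \<le> t" by linarith
  then show ?thesis by cases (auto simp: cutoff''_def abs_if)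
qed

text \<open>Checked piece by piece between the knots. The maximum is 3/4; the cruder bound 2 enters
  the constant 33 of \<open>modify_germ\<close>.\<close>

lemma cutoff'_bound: "0 \<le> cutoff' t" "cutoff' t \<le> 2"
proof -
  consider "t \<le> 0" | "0 \<le> t" "t \<le> 1" | "1 \<le> t" "t \<le> 2" | "2 \<le> t" "t \<le> 3" | "3 \<le> t" by linarith
  then have "0 \<le> cutoff' t \<and> cutoff' t \<le> 2"
  proof cases
    case 2
    then have "cutoff' t = t\<^sup>2 / 2" by (simp add: cutoff'_def algebra_simps power2_eq_square)
    moreover have "t\<^sup>2 \<le> 1" "0 \<le> t\<^sup>2" using 2 by (simp_all add: power_le_one)
    ultimately show ?thesis by linarith
  next
    case 3
    then have "\<bar>t\<bar> = t" "\<bar>t - 1\<bar> = t - 1" "\<bar>t - 2\<bar> = 2 - t" "\<bar>t - 3\<bar> = 3 - t" by auto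
    then have "cutoff' t = 1/2 + (t - 1) * (2 - t)" by (simp add: cutoff'_def field_simps)
    moreover have "0 \<le> (t - 1) * (2 - t)" "(t - 1) * (2 - t) \<le> 1" using 3 by (auto intro: mult_le_one)
    ultimately show ?thesis by simp
  next
    case 4
    then have "\<bar>t\<bar> = t" "\<bar>t - 1\<bar> = t - 1" "\<bar>t - 2\<bar> = t - 2" "\<bar>t - 3\<bar> = 3 - t" by auto
    then have "cutoff' t = (3 - t)\<^sup>2 / 2" by (simp add: cutoff'_def field_simps power2_eq_square)
    moreover have "(3 - t)\<^sup>2 \<le> 1" "0 \<le> (3 - t)\<^sup>2" using 4 by (simp_all add: power_le_one)
    ultimately show ?thesis by linarith
  qed (simp_all add: cutoff_left cutoff_right)
  then show "0 \<le> cutoff' t" "cutoff' t \<le> 2" by auto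
qed

lemma cutoff_bound: "0 \<le> cutoff t" "cutoff t \<le> 1"
proof -
  have mono: "cutoff s \<le> cutoff t" if "s \<le> t" for s t
    using that
  proof (rule DERIV_nonneg_imp_nondecreasing)
    show "\<exists>y. (cutoff has_real_derivative y) (at x) \<and> 0 \<le> y" for x
      using c2_D(1)[OF c2_cutoff] cutoff'_bound(1) by blast
  qed
  show "0 \<le> cutoff t" using mono[of "min t 0" t] cutoff_left(1)[of "min t 0"] by simp
  show "cutoff t \<le> 1" using mono[of t "max t 3"] cutoff_right(1)[of "max t 3"] by simp
qed

text \<open>In the coordinate \<open>1/X\<^sup>m\<close> the map \<open>germ m q e\<close> is the affine map \<open>t \<mapsto> q t + e\<close>.\<close>

definition germ :: "nat \<Rightarrow> real \<Rightarrow> real \<Rightarrow> real \<Rightarrow> real" where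
  "germ m q e X = X * (q + e * X ^ m) powr (- 1 / real m)"

definition germ' :: "nat \<Rightarrow> real \<Rightarrow> real \<Rightarrow> real \<Rightarrow> real" where
  "germ' m q e X = q * (q + e * X ^ m) powr (- 1 / real m - 1)"

definition germ'' :: "nat \<Rightarrow> real \<Rightarrow> real \<Rightarrow> real \<Rightarrow> real" where
  "germ'' m q e X = - q * e * (real m + 1) * X ^ (m - 1) * (q + e * X ^ m) powr (- 1 / real m - 2)"

lemma c2_germ:
  assumes m: "1 \<le> m" and pos: "\<And>X. X \<in> S \<Longrightarrow> 0 < q + e * X ^ m"
  shows "c2 S (germ m q e) (germ' m q e) (germ'' m q e)"
proof -
  define p where "p = - 1 / real m"
  have pm: "p * real m = - 1" using m by (simp add: p_def)
  have u: "((\<lambda>X. (q + e * X ^ m) powr r) has_real_derivative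
      r * (q + e * X ^ m) powr (r - 1) * (e * (real m * X ^ (m - 1)))) (at X within S)" if "X \<in> S" for X r
    using pos[OF that] by (auto intro!: derivative_eq_intros)
  have XX: "X * X ^ (m - 1) = X ^ m" for X :: real using m by (simp add: power_eq_if)
  have d1: "(germ m q e has_real_derivative germ' m q e X) (at X within S)" if X: "X \<in> S" for X
  proof -
    let ?u = "q + e * X ^ m"
    have "(germ m q e has_real_derivative
        1 * ?u powr p + (p * ?u powr (p - 1) * (e * (real m * X ^ (m - 1)))) * X) (at X within S)"
      unfolding germ_def p_def by (rule DERIV_mult[OF DERIV_ident u[OF X]])
    moreover have "1 * ?u powr p + (p * ?u powr (p - 1) * (e * (real m * X ^ (m - 1)))) * X = germ' m q e X"
    proof -
      \<comment> \<open>With the common exponent \<open>p - 1\<close> the terms in \<open>e\<close>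
        cancel, because \<open>p * real m = - 1\<close>.\<close>
      have "?u powr p = ?u * ?u powr (p - 1)"
        using pos[OF X] by (simp add: powr_mult_base)
      then have "1 * ?u powr p + (p * ?u powr (p - 1) * (e * (real m * X ^ (m - 1)))) * X
          = ?u powr (p - 1) * (?u + (p * real m) * e * (X * X ^ (m - 1)))"
        by (simp add: algebra_simps)
      also have "\<dots> = q * ?u powr (p - 1)" unfolding pm XX by simp
      finally show ?thesis by (simp add: germ'_def p_def)
    qed
    ultimately show ?thesis by simp
  qed
  have d2: "(germ' m q e has_real_derivative germ'' m q e X) (at X within S)" if X: "X \<in> S" for X
  proof -
    let ?u = "q + e * X ^ m"
    have "(germ' m q e has_real_derivative
        q * ((p - 1) * ?u powr (p - 1 - 1) * (e * (real m * X ^ (m - 1))))) (at X within S)"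
      unfolding germ'_def p_def by (rule DERIV_cmult[OF u[OF X]])
    moreover have "q * ((p - 1) * ?u powr (p - 1 - 1) * (e * (real m * X ^ (m - 1)))) =
        q * e * (p * real m - real m) * X ^ (m - 1) * ?u powr (p - 2)" by (simp add: algebra_simps)
    moreover have "q * e * (p * real m - real m) * X ^ (m - 1) * ?u powr (p - 2) = germ'' m q e X"
      unfolding pm by (simp add: germ''_def p_def algebra_simps)
    ultimately show ?thesis by (simp only:)
  qed
  have "continuous_on S (germ'' m q e)"
    unfolding germ''_def using pos by (intro continuous_intros) force
  with d1 d2 show ?thesis by (simp add: c2_def)
qed

text \<open>The factor \<open>0 ^ (m - 1)\<close> is 1 for \<open>m = 1\<close> and 0 for larger
  \<open>m\<close>: the second derivative at the fixed point can be adjusted through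
  \<open>e\<close> only for order 1.\<close>

lemma germ_0:
  assumes "1 \<le> m" "0 < q"
  shows "germ m q e 0 = 0" "germ' m q e 0 = q powr (- 1 / real m)"
    "germ'' m q e 0 = - q * e * (real m + 1) * 0 ^ (m - 1) * q powr (- 1 / real m - 2)"
proof -
  have "(0::real) ^ m = 0" using assms by simp
  then show "germ m q e 0 = 0" "germ'' m q e 0 = - q * e * (real m + 1) * 0 ^ (m - 1) * q powr (- 1 / real m - 2)"
    unfolding germ_def germ''_def by (simp_all add: zero_power add.commute)
  show "germ' m q e 0 = q powr (- 1 / real m)"
    using assms powr_mult_base[of q "- 1 / real m - 1"] by (simp add: germ'_def zero_power)
qed

lemma germ_coordinate:
  assumes m: "1 \<le> m" and X: "0 < X" and u: "0 < q + e * X ^ m"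
  shows "0 < germ m q e X" "1 / germ m q e X ^ m = q / X ^ m + e"
proof -
  show "0 < germ m q e X" using X u by (simp add: germ_def)
  have "((q + e * X ^ m) powr (- 1 / real m)) ^ m = (q + e * X ^ m) powr (- 1)"
    using u m by (simp add: powr_realpow[symmetric] powr_powr)
  also have "\<dots> = 1 / (q + e * X ^ m)" using u by (simp add: powr_minus field_simps)
  finally show "1 / germ m q e X ^ m = q / X ^ m + e"
    using X u by (simp add: germ_def power_mult_distrib field_simps)
qed

text \<open>The coordinate \<open>1 / X^m\<close> is injective on positive numbers, so an affine
  relation in it already determines the map.\<close>

lemma germ_unique:
  assumes m: "1 \<le> m" and X: "0 < X" "0 < Y" and eq: "1 / Y ^ m = q / X ^ m + e"
  shows "0 < q + e * X ^ m" "Y = germ m q e X"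
proof -
  have "q + e * X ^ m = (q / X ^ m + e) * X ^ m" using X by (simp add: field_simps)
  also have "\<dots> = X ^ m / Y ^ m" unfolding eq[symmetric] by simp
  also have "\<dots> > 0" using X by simp
  finally show u: "0 < q + e * X ^ m" .
  have "1 / Y ^ m = 1 / germ m q e X ^ m" using germ_coordinate(2)[OF m X(1) u] eq by simp
  then have "Y ^ m = germ m q e X ^ m" by simp
  then show "Y = germ m q e X"
    using power_eq_imp_eq_base[of Y m] m X germ_coordinate(1)[OF m X(1) u] by simp
qed

text \<open>For positive \<open>\<alpha>\<close> and \<open>m\<close> this is the time coordinate of
  the vector field \<open>X^(m+1) / (\<alpha> * m)\<close>. Its nonlinearity is
  \<open>-(m+1) / X\<close>, of the size that \<open>nonlin_eq_lim\<close> permits.\<close>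

lemma c2_pole:
  assumes "\<And>X. X \<in> S \<Longrightarrow> 0 < X"
  shows "c2 S (\<lambda>X. - \<alpha> / X ^ m) (\<lambda>X. \<alpha> * real m / X ^ (m + 1)) (\<lambda>X. - \<alpha> * real m * (real m + 1) / X ^ (m + 2))"
proof -
  have d: "((\<lambda>X. c / X ^ k) has_real_derivative - c * k / X ^ (k + 1)) (at X within S)" if "X \<in> S" for X c k
  proof -
    have "X > 0" using assms[OF that] .
    then have "((\<lambda>X. c / X ^ k) has_real_derivative
        (0 * X ^ k - c * (k * (1 * X ^ (k - Suc 0)))) / (X ^ k * X ^ k)) (at X within S)"
      by (intro DERIV_divide DERIV_const DERIV_power DERIV_ident) auto
    moreover have "(0 * X ^ k - c * (k * (1 * X ^ (k - Suc 0)))) / (X ^ k * X ^ k) = - c * k / X ^ (k + 1)"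
      using \<open>X > 0\<close> by (cases k) auto
    ultimately show ?thesis by simp
  qed
  have "continuous_on S (\<lambda>X. - \<alpha> * real m * (real m + 1) / X ^ (m + 2))"
    using assms by (intro continuous_intros) force
  then show ?thesis
    using d[where c="- \<alpha>" and k=m] d[where c="\<alpha> * real m" and k="m + 1"] unfolding c2_def
    by (simp add: algebra_simps)
qed

lemma c2_shift:
  assumes "c2 S f f' f''" "\<And>x. x \<in> T \<Longrightarrow> x - a \<in> S"
  shows "c2 T (\<lambda>x. f (x - a) + c) (\<lambda>x. f' (x - a)) (\<lambda>x. f'' (x - a))"
proof -
  have "c2 T (\<lambda>x. f (x - a)) (\<lambda>x. f' (x - a) * (1 - 0)) (\<lambda>x. f'' (x - a) * (1 - 0)\<^sup>2 + f' (x - a) * (0 - 0))"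
    by (rule c2_compose[OF c2_diff[OF c2_id c2_const] assms(1)]) (use assms(2) in auto)
  from c2_add[OF this c2_const] show ?thesis by simp
qed

section \<open>Replacing an end by a model germ\<close>

lemma continuous_on_Icc_bounded:
  fixes g :: "real \<Rightarrow> real"
  assumes "continuous_on {a..b} g"
  obtains M where "\<And>x. x \<in> {a..b} \<Longrightarrow> \<bar>g x\<bar> \<le> M"
  using compact_imp_bounded[OF compact_continuous_image[OF assms compact_Icc]]
  unfolding bounded_iff ball_simps real_norm_def by blast

lemma small_interval:
  fixes a b \<delta> :: real and g :: "real \<Rightarrow> real"
  assumes "continuous_on {a..b} g" "a < b" "\<bar>g a\<bar> < \<delta>"
  obtains r where "0 < r" "a + r \<le> b" "\<And>x. x \<in> {a..a+r} \<Longrightarrow> \<bar>g x\<bar> \<le> \<delta>"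
proof -
  obtain d where d: "d > 0" "\<And>x. x \<in> {a..b} \<Longrightarrow> dist x a < d \<Longrightarrow> dist (g x) (g a) < \<delta> - \<bar>g a\<bar>"
    using assms unfolding continuous_on_iff by (metis atLeastAtMost_iff diff_gt_0_iff_gt less_imp_le order_refl)
  show thesis
  proof (rule that[of "min (d / 2) (b - a)"])
    fix x assume x: "x \<in> {a..a + min (d / 2) (b - a)}"
    then have "x \<in> {a..b}" "dist x a < d" using d(1) by (auto simp: dist_real_def)
    from d(2)[OF this] show "\<bar>g x\<bar> \<le> \<delta>" by (simp add: dist_real_def)
  qed (use d assms in auto)
qed

text \<open>The model \<open>g\<close> agrees with \<open>f\<close> to first order at
  \<open>a\<close>, and the second derivatives are \<delta>-close there. Near \<open>a\<close> the
  difference \<open>h\<close> is thus at most \<delta> X^2 and its derivative at most \<delta> X,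
  with \<open>X = x - a\<close>. This compensates for the factors \<open>1/\<epsilon>^2\<close> and
  \<open>1/\<epsilon>\<close> from a cutoff at scale \<epsilon>, so the change is of size \<delta>
  in \<open>C^2\<close> however small \<epsilon> is. The bound \<open>B\<close> precedes
  \<open>c\<close> because \<open>lim_nonlin_stable\<close> needs one bound for all
  modifications.\<close>

lemma modify_germ:
  fixes a b \<sigma> \<alpha> \<delta> :: real and m :: nat
  assumes f: "diffeo a b f f' f''" and ab: "a < b" and par: "f' a = 1"
    and \<sigma>: "\<sigma> = 1 \<or> \<sigma> = -1" and sgn: "\<And>x. x \<in> {a<..<b} \<Longrightarrow> 0 < \<sigma> * (f x - x)"
    and m: "1 \<le> m" and \<alpha>: "0 < \<alpha>"
    and \<delta>: "\<bar>germ'' m 1 (- \<sigma> / \<alpha>) 0 - f'' a\<bar> < \<delta>"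
  obtains B where "\<And>c. a < c \<Longrightarrow> c < b \<Longrightarrow> \<exists>\<epsilon> F F' F''. 0 < \<epsilon> \<and> a + \<epsilon> < c \<and> diffeo a b F F' F'' \<and> F' a = 1
      \<and> (\<forall>x\<in>{c..b}. F x = f x \<and> F' x = f' x \<and> F'' x = f'' x)
      \<and> (\<forall>x\<in>{a..b}. \<bar>F'' x - f'' x\<bar> \<le> 33 * \<delta>)
      \<and> (\<forall>x\<in>{a<..<b}. 0 < \<sigma> * (F x - x))
      \<and> (\<forall>x\<in>{a<..<a+\<epsilon>}. - \<alpha> / (F x - a) ^ m = - \<alpha> / (x - a) ^ m + \<sigma>)
      \<and> (\<forall>x\<in>{a..b}. \<bar>F'' x / F' x\<bar> \<le> B \<and> \<bar>F'' x / (F' x)\<^sup>2\<bar> \<le> B)"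
proof -
  define e where "e = - \<sigma> / \<alpha>"
  have \<delta>0: "0 < \<delta>" using \<delta> by linarith
  have cf: "c2 {a..b} f f' f''" and f'_pos: "\<And>x. x \<in> {a..b} \<Longrightarrow> 0 < f' x" and fab: "f a = a" "f b = b"
    using f by (auto simp: diffeo_def)
  obtain y0 where y0: "y0 \<in> {a..b}" "\<And>x. x \<in> {a..b} \<Longrightarrow> f' y0 \<le> f' x"
    using continuous_attains_inf[OF compact_Icc _ c2D(4)[OF cf]] ab by force
  obtain M1 where M1: "\<And>x. x \<in> {a..b} \<Longrightarrow> \<bar>f'' x\<bar> \<le> M1"
    using continuous_on_Icc_bounded[OF c2D(3)[OF cf]] by blast
  \<comment> \<open>\<open>M\<close> will bound \<open>F''\<close> and \<open>\<mu>\<close> will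
    bound \<open>F'\<close> from below, both independently of \<open>c\<close>.\<close>
  define M where "M = M1 + 33 * \<delta>"
  define \<mu> where "\<mu> = min (1/2) (f' y0)"
  have \<mu>: "0 < \<mu>" using f'_pos[OF y0(1)] by (simp add: \<mu>_def)
  have M0: "0 < M" using M1[of a] ab \<delta>0 unfolding M_def by force
  show thesis
  proof (rule that[of "max (M / \<mu>) (M / \<mu>\<^sup>2)"])
    fix c assume c: "a < c" "c < b"
    obtain r1 where r1: "0 < r1" "a + r1 \<le> c" "\<And>x. x \<in> {a..a+r1} \<Longrightarrow> \<bar>e * (x - a) ^ m\<bar> \<le> 1/2"
    proof (rule small_interval[of a c "\<lambda>x. e * (x - a) ^ m" "1/2"])
      show "\<bar>e * (a - a) ^ m\<bar> < 1/2" using m by (simp add: zero_power)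
    qed (use c in \<open>auto intro!: continuous_intros\<close>)
    define g where "g x = germ m 1 e (x - a) + a" for x
    define g' where "g' x = germ' m 1 e (x - a)" for x
    define g'' where "g'' x = germ'' m 1 e (x - a)" for x
    have upos: "0 < 1 + e * (x - a) ^ m" if "x \<in> {a..a+r1}" for x using r1(3)[OF that] by linarith
    have cg: "c2 {a..a+r1} g g' g''"
    proof -
      have "c2 ((\<lambda>x. x - a) ` {a..a+r1}) (germ m 1 e) (germ' m 1 e) (germ'' m 1 e)"
        by (rule c2_germ[OF m]) (use upos in blast)
      from c2_shift[OF this, of "{a..a+r1}" a a] show ?thesis unfolding g_def g'_def g''_def by auto
    qed
    obtain r2 where r2: "0 < r2" "a + r2 \<le> a + r1" "\<And>x. x \<in> {a..a+r2} \<Longrightarrow> \<bar>g'' x - f'' x\<bar> \<le> \<delta>"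
    proof (rule small_interval[of a "a + r1" "\<lambda>x. g'' x - f'' x" \<delta>])
      show "continuous_on {a..a + r1} (\<lambda>x. g'' x - f'' x)"
        by (intro continuous_intros c2D(3)[OF cg] continuous_on_subset[OF c2D(3)[OF cf]]) (use r1 c in auto)
      show "\<bar>g'' a - f'' a\<bar> < \<delta>" using \<delta> by (simp add: g''_def e_def)
    qed (use r1 in auto)
    \<comment> \<open>Since \<open>F' a = 1\<close>, the condition \<open>M * r \<le> 1/2\<close>
      keeps \<open>F'\<close> at least 1/2 on the modified part.\<close>
    define r where "r = min r2 (1 / (2 * M))"
    have "M * r \<le> M * (1 / (2 * M))" using M0 unfolding r_def by (intro mult_left_mono) auto
    then have r: "0 < r" "r \<le> r2" "r \<le> r1" "M * r \<le> 1/2"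
      using r2 M0 by (auto simp: r_def)
    \<comment> \<open>The cutoff takes three units for its transition, here from
      \<open>a + \<epsilon>\<close> to \<open>a + 4 * \<epsilon>\<close>, which is strictly below
      \<open>a + r\<close>.\<close>
    define \<epsilon> where "\<epsilon> = r / 5"
    have \<epsilon>: "0 < \<epsilon>" "4 * \<epsilon> < r" using r by (auto simp: \<epsilon>_def)
    have arb: "a + r < b" "a + r \<le> c" using r r1 c by auto
    define h h' h'' where "h x = g x - f x" "h' x = g' x - f' x" "h'' x = g'' x - f'' x" for x
    note h_defs = this
    have ch: "c2 {a..a+r} h h' h''"
      unfolding h_defs by (intro c2_diff c2_subset[OF cg] c2_subset[OF cf]) (use r arb in auto)
    have ha: "h a = 0" "h' a = 0"
      using germ_0[OF m, of 1 e] fab par by (simp_all add: h_defs g_def g'_def)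
    have hb2: "\<bar>h'' x\<bar> \<le> \<delta>" if "x \<in> {a..a+r}" for x using r2(3)[of x] that r by (simp add: h_defs)
    have hb1: "\<bar>h' x\<bar> \<le> \<delta> * (x - a)" if x: "x \<in> {a..a+r}" for x
    proof (cases "x = a")
      case False
      then obtain z where "a < z" "z < x" "h' x - h' a = h'' z * (x - a)"
        using mvt_within[OF c2D(2)[OF ch], of a x] x by auto
      with hb2[of z] x show ?thesis by (simp add: ha abs_mult mult_right_mono)
    qed (simp add: ha)
    have hb0: "\<bar>h x\<bar> \<le> \<delta> * (x - a)\<^sup>2" if x: "x \<in> {a..a+r}" for x
    proof (cases "x = a")
      case False
      then obtain z where z: "a < z" "z < x" "h x - h a = h' z * (x - a)"
        using mvt_within[OF c2D(1)[OF ch], of a x] x by auto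
      then have "\<bar>h x\<bar> = \<bar>h' z\<bar> * (x - a)" using x by (simp add: ha abs_mult)
      also have "\<dots> \<le> \<delta> * (z - a) * (x - a)" using hb1[of z] z x by (intro mult_right_mono) auto
      also have "\<dots> \<le> \<delta> * (x - a) * (x - a)" using z \<delta>0 by (intro mult_right_mono mult_left_mono) auto
      finally show ?thesis by (simp add: power2_eq_square)
    qed (simp add: ha)
    define s where "s x = (x - a) / \<epsilon> - 1" for x
    define w w' w'' where "w x = 1 - cutoff (s x)" "w' x = - cutoff' (s x) / \<epsilon>" "w'' x = - cutoff'' (s x) / \<epsilon>\<^sup>2" for x
    note w_defs = this
    have cw: "c2 S w w' w''" for S
    proof -
      have cs: "c2 S s (\<lambda>x. 1 / \<epsilon>) (\<lambda>x. 0)"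
        using c2_diff[OF c2_cmult[where c="1/\<epsilon>", OF c2_diff[OF c2_id c2_const[of _ a]]] c2_const[of _ 1]]
        by (simp add: s_def[abs_def])
      show ?thesis
        by (rule c2_cong[OF c2_diff[OF c2_const[of _ 1] c2_compose[OF cs c2_cutoff]]])
          (auto simp: w_defs power2_eq_square)
    qed
    have w_right: "w x = 0" "w' x = 0" "w'' x = 0" if "a + 4 * \<epsilon> \<le> x" for x
    proof -
      have "3 \<le> s x" using that \<epsilon> by (simp add: s_def field_simps)
      then show "w x = 0" "w' x = 0" "w'' x = 0" by (simp_all add: w_defs cutoff_right)
    qed
    have w_left: "w x = 1" if "x \<le> a + \<epsilon>" for x
    proof -
      have "s x \<le> 0" using that \<epsilon> by (simp add: s_def field_simps)
      then show ?thesis by (simp add: w_defs cutoff_left)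
    qed
    have w01: "0 \<le> w x" "w x \<le> 1" for x using cutoff_bound[of "s x"] by (auto simp: w_defs)
    have w'b: "\<bar>w' x\<bar> \<le> 2 / \<epsilon>" for x
      using cutoff'_bound[of "s x"] \<epsilon> by (simp add: w_defs abs_div divide_right_mono)
    have w''b: "\<bar>w'' x\<bar> \<le> 1 / \<epsilon>\<^sup>2" for x
      using cutoff''_bound[of "s x"] \<epsilon> by (simp add: w_defs abs_div divide_right_mono)
    define F F' F'' where "F x = (if x \<le> a + r then f x + w x * h x else f x)"
      "F' x = (if x \<le> a + r then f' x + (w' x * h x + w x * h' x) else f' x)"
      "F'' x = (if x \<le> a + r then f'' x + (w'' x * h x + 2 * w' x * h' x + w x * h'' x) else f'' x)" for x
    note F_defs = this
    have Feq: "F x = f x" "F' x = f' x" "F'' x = f'' x" if "a + 4 * \<epsilon> \<le> x" for x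
      using w_right[OF that] by (simp_all add: F_defs)
    have cF: "c2 {a..b} F F' F''"
    proof (rule c2_local)
      fix x assume x: "x \<in> {a..b}"
      show "\<exists>U. open U \<and> x \<in> U \<and> c2 ({a..b} \<inter> U) F F' F''"
      proof (cases "x < a + r")
        case True
        have "c2 ({a..b} \<inter> {..<a+r}) F F' F''"
          by (rule c2_cong[OF c2_add[OF c2_subset[OF cf] c2_mult[OF cw c2_subset[OF ch]]]])
            (auto simp: F_defs)
        with True show ?thesis by (metis lessThan_iff open_lessThan)
      next
        case False
        have "c2 ({a..b} \<inter> {a + 4 * \<epsilon><..}) F F' F''"
          by (rule c2_cong[OF c2_subset[OF cf]]) (auto simp: Feq)
        with False \<epsilon> show ?thesis by (intro exI[of _ "{a + 4 * \<epsilon><..}"]) auto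
      qed
    qed
    \<comment> \<open>The three terms of the product rule contribute 16, twice 8, and 1 times
      \<delta>.\<close>
    have close: "\<bar>F'' x - f'' x\<bar> \<le> 33 * \<delta>" if x: "x \<in> {a..b}" for x
    proof (cases "a + 4 * \<epsilon> \<le> x")
      case True
      then show ?thesis using Feq(3)[OF True] \<delta>0 by simp
    next
      case False
      then have xr: "x \<in> {a..a+r}" and X: "x - a \<le> 4 * \<epsilon>" "0 \<le> x - a" using x \<epsilon> by auto
      have "\<bar>w'' x * h x\<bar> \<le> 1 / \<epsilon>\<^sup>2 * (\<delta> * (4 * \<epsilon>)\<^sup>2)"
        unfolding abs_mult
        using hb0[OF xr] power_mono[OF X, of 2] \<delta>0 by (intro mult_mono w''b) (auto intro: order_trans mult_left_mono)
      also have "\<dots> = 16 * \<delta>" using \<epsilon> by (simp add: power2_eq_square)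
      finally have 1: "\<bar>w'' x * h x\<bar> \<le> 16 * \<delta>" .
      have "\<bar>h' x\<bar> \<le> \<delta> * (4 * \<epsilon>)"
        using hb1[OF xr] mult_left_mono[OF X(1), of \<delta>] \<delta>0 by linarith
      then have "\<bar>w' x * h' x\<bar> \<le> 2 / \<epsilon> * (\<delta> * (4 * \<epsilon>))"
        unfolding abs_mult using \<delta>0 \<epsilon> by (intro mult_mono w'b) auto
      also have "\<dots> = 8 * \<delta>" using \<epsilon> by simp
      finally have 2: "\<bar>w' x * h' x\<bar> \<le> 8 * \<delta>" .
      have "\<bar>w x * h'' x\<bar> \<le> 1 * \<delta>"
        unfolding abs_mult using hb2[OF xr] w01[of x] by (intro mult_mono) auto
      then have 3: "\<bar>w x * h'' x\<bar> \<le> \<delta>" by simp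
      have "F'' x - f'' x = w'' x * h x + 2 * (w' x * h' x) + w x * h'' x" using xr by (simp add: F_defs)
      with 1 2 3 show ?thesis by linarith
    qed
    have F''M: "\<bar>F'' x\<bar> \<le> M" if "x \<in> {a..b}" for x
      using close[OF that] M1[OF that] unfolding M_def by linarith
    have F'a: "F' a = 1" using r by (simp add: F_defs ha par)
    have F'm: "\<mu> \<le> F' x" if x: "x \<in> {a..b}" for x
    proof (cases "a + r \<le> x")
      case True
      then show ?thesis using Feq(2)[of x] y0(2)[OF x] \<epsilon> by (simp add: \<mu>_def)
    next
      case False
      have "1 - 1/2 \<le> F' x"
      proof (cases "x = a")
        case False
        then obtain z where z: "a < z" "z < x" "F' x - F' a = F'' z * (x - a)"
          using mvt_within[OF c2D(2)[OF cF], of a x] x by auto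
        have "\<bar>F' x - F' a\<bar> \<le> M * (x - a)"
          unfolding z(3) abs_mult using F''M[of z] z x by (simp add: mult_right_mono)
        also have "\<dots> \<le> M * r" using \<open>\<not> a + r \<le> x\<close> M0 by (intro mult_left_mono) auto
        finally show ?thesis using F'a r(4) by linarith
      qed (simp add: F'a)
      then show ?thesis by (simp add: \<mu>_def)
    qed
    have Fab: "F a = a" "F b = b" using ha fab arb r by (simp_all add: F_defs)
    have dF: "diffeo a b F F' F''"
      unfolding diffeo_def using cF Fab F'm \<mu> by (auto intro: less_le_trans)
    have g_coord: "a < g x" "- \<alpha> / (g x - a) ^ m = - \<alpha> / (x - a) ^ m + \<sigma>" if x: "a < x" "x \<le> a + r1" for x
    proof -
      have "0 < x - a" "0 < 1 + e * (x - a) ^ m" using x upos by auto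
      from germ_coordinate[OF m this] show "a < g x" "- \<alpha> / (g x - a) ^ m = - \<alpha> / (x - a) ^ m + \<sigma>"
        using \<alpha> by (simp_all add: g_def e_def field_simps)
    qed
    have g_sgn: "0 < \<sigma> * (g x - x)" if x: "a < x" "x \<le> a + r1" for x
    proof -
      have *: "1 / (g x - a) ^ m = 1 / (x - a) ^ m - \<sigma> / \<alpha>"
        using g_coord[OF x] \<alpha> by (simp add: field_simps)
      have pw: "1 / v ^ m \<le> 1 / u ^ m" if "0 < u" "u \<le> v" for u v :: real
        using that power_mono[of u v m] by (intro divide_left_mono) auto
      show ?thesis
        using \<sigma>
      proof
        assume "\<sigma> = 1"
        then have "x < g x" using * pw[of "g x - a" "x - a"] g_coord(1)[OF x] \<alpha> by (cases "g x \<le> x") auto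
        with \<open>\<sigma> = 1\<close> show ?thesis by simp
      next
        assume "\<sigma> = -1"
        then have "g x < x" using * pw[of "x - a" "g x - a"] x \<alpha> by (cases "x \<le> g x") auto
        with \<open>\<sigma> = -1\<close> show ?thesis by simp
      qed
    qed
    have F_sgn: "0 < \<sigma> * (F x - x)" if x: "x \<in> {a<..<b}" for x
    proof (cases "x \<le> a + r")
      case True
      \<comment> \<open>A convex combination of the displacements of \<open>f\<close> and of the
        model, which have the same sign: no new fixed point appears.\<close>
      then have Fx: "F x - x = (1 - w x) * (f x - x) + w x * (g x - x)" by (simp add: F_defs h_defs algebra_simps)
      have "\<sigma> * (F x - x) = (1 - w x) * (\<sigma> * (f x - x)) + w x * (\<sigma> * (g x - x))"
        unfolding Fx by (simp add: algebra_simps)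
      moreover have "0 < \<sigma> * (f x - x)" "0 < \<sigma> * (g x - x)" using sgn[OF x] g_sgn[of x] x True r by auto
      ultimately show ?thesis
        using w01[of x] by (cases "w x = 0") (auto intro: add_nonneg_pos)
    qed (use sgn[OF x] in \<open>simp add: F_defs\<close>)
    have F_coord: "- \<alpha> / (F x - a) ^ m = - \<alpha> / (x - a) ^ m + \<sigma>" if x: "x \<in> {a<..<a+\<epsilon>}" for x
    proof -
      have "F x = g x" using w_left[of x] x \<epsilon> by (simp add: F_defs h_defs)
      then show ?thesis using g_coord(2)[of x] x \<epsilon> r by simp
    qed
    have FB: "\<bar>F'' x / F' x\<bar> \<le> max (M / \<mu>) (M / \<mu>\<^sup>2)" "\<bar>F'' x / (F' x)\<^sup>2\<bar> \<le> max (M / \<mu>) (M / \<mu>\<^sup>2)" if x: "x \<in> {a..b}" for x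
    proof -
      have "\<bar>F'' x / F' x\<bar> \<le> M / \<mu>" "\<bar>F'' x / (F' x)\<^sup>2\<bar> \<le> M / \<mu>\<^sup>2"
        using F''M[OF x] F'm[OF x] \<mu> M0 power_mono[OF F'm[OF x], of 2] by (auto simp: abs_div intro!: frac_le)
      then show "\<bar>F'' x / F' x\<bar> \<le> max (M / \<mu>) (M / \<mu>\<^sup>2)" "\<bar>F'' x / (F' x)\<^sup>2\<bar> \<le> max (M / \<mu>) (M / \<mu>\<^sup>2)" by auto
    qed
    show "\<exists>\<epsilon> F F' F''. 0 < \<epsilon> \<and> a + \<epsilon> < c \<and> diffeo a b F F' F'' \<and> F' a = 1
      \<and> (\<forall>x\<in>{c..b}. F x = f x \<and> F' x = f' x \<and> F'' x = f'' x)
      \<and> (\<forall>x\<in>{a..b}. \<bar>F'' x - f'' x\<bar> \<le> 33 * \<delta>)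
      \<and> (\<forall>x\<in>{a<..<b}. 0 < \<sigma> * (F x - x))
      \<and> (\<forall>x\<in>{a<..<a+\<epsilon>}. - \<alpha> / (F x - a) ^ m = - \<alpha> / (x - a) ^ m + \<sigma>)
      \<and> (\<forall>x\<in>{a..b}. \<bar>F'' x / F' x\<bar> \<le> max (M / \<mu>) (M / \<mu>\<^sup>2) \<and> \<bar>F'' x / (F' x)\<^sup>2\<bar> \<le> max (M / \<mu>) (M / \<mu>\<^sup>2))"
    proof (rule exI[of _ \<epsilon>], rule exI[of _ F], rule exI[of _ F'], rule exI[of _ F''], intro conjI ballI)
      show "a + \<epsilon> < c" using arb \<epsilon> by simp
      show "F x = f x" "F' x = f' x" "F'' x = f'' x" if "x \<in> {c..b}" for x
        using Feq[of x] that arb \<epsilon> by auto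
    qed (use \<epsilon> dF F'a close F_sgn F_coord FB in auto)
  qed
qed

text \<open>Whichever of \<open>f\<close> and its inverse moves interior points to \<open>a\<close>,
  where \<sigma> is the sign of \<open>f x - x\<close>. Both directions of motion thus fall under
  the contraction results.\<close>

definition towards where
  "towards a b \<sigma> f = (if \<sigma> < (0::real) then f else inv_into {a..b::real} f)"

definition towards' where
  "towards' a b \<sigma> f f' = (if \<sigma> < 0 then f' else (\<lambda>y. 1 / f' (towards a b \<sigma> f y) :: real))"

definition towards'' where
  "towards'' a b \<sigma> f f' f'' = (if \<sigma> < 0 then f''
     else (\<lambda>y. - f'' (towards a b \<sigma> f y) / f' (towards a b \<sigma> f y) ^ 3 :: real))"

lemma diffeo_towards:
  assumes "diffeo a b f f' f''" "a < b"
  shows "diffeo a b (towards a b \<sigma> f) (towards' a b \<sigma> f f') (towards'' a b \<sigma> f f' f'')"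
  using assms diffeo_inverse(1)[OF assms(1)] by (simp add: towards_def towards'_def towards''_def)

text \<open>The second bound serves the inverse, whose nonlinearity is \<open>- f'' / f'^2\<close>
  taken at the preimage.\<close>

lemma contraction_towards:
  assumes f: "diffeo a b f f' f''" and ab: "a < b" and par: "f' a = 1"
    and \<sigma>: "\<sigma> = 1 \<or> \<sigma> = -1" and sgn: "\<And>x. x \<in> {a<..<b} \<Longrightarrow> 0 < \<sigma> * (f x - x)"
    and B: "\<And>x. x \<in> {a..b} \<Longrightarrow> \<bar>f'' x / f' x\<bar> \<le> B" "\<And>x. x \<in> {a..b} \<Longrightarrow> \<bar>f'' x / (f' x)\<^sup>2\<bar> \<le> B"
  shows "contraction a b (towards a b \<sigma> f) (towards' a b \<sigma> f f') (towards'' a b \<sigma> f f' f'') B"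
  using \<sigma>
proof
  assume s: "\<sigma> = -1"
  show ?thesis
    by unfold_locales
      (use s diffeo_towards[OF f ab, of \<sigma>] ab par sgn B(1) in \<open>auto simp: towards_def towards'_def towards''_def\<close>)
next
  assume s: "\<sigma> = 1"
  define g where "g = inv_into {a..b} f"
  note g = diffeo_inverse[OF f less_imp_le[OF ab], folded g_def]
  note gI = diffeo_interval[OF g(1)]
  have ga: "g a = a" using g(1) by (simp add: diffeo_def)
  show ?thesis
  proof
    show "diffeo a b (towards a b \<sigma> f) (towards' a b \<sigma> f f') (towards'' a b \<sigma> f f' f'')"
      by (rule diffeo_towards[OF f ab])
    show "towards' a b \<sigma> f f' a = 1"
      using s par ga by (simp add: towards'_def towards_def g_def)
    show "towards a b \<sigma> f x < x" if "x \<in> {a<..<b}" for x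
      using sgn[OF gI(2)[OF that]] g(2)[of x] that s by (simp add: towards_def g_def)
    show "\<bar>towards'' a b \<sigma> f f' f'' x / towards' a b \<sigma> f f' x\<bar> \<le> B" if "x \<in> {a..b}" for x
    proof -
      have "f' (g x) > 0" using f gI(1)[OF that] by (simp add: diffeo_def)
      then have "towards'' a b \<sigma> f f' f'' x / towards' a b \<sigma> f f' x = - (f'' (g x) / (f' (g x))\<^sup>2)"
        using s by (simp add: towards_def towards'_def towards''_def g_def power2_eq_square power3_eq_cube)
      then show ?thesis using B(2)[OF gI(1)[OF that]] by simp
    qed
  qed (rule ab)
qed

text \<open>Germ replacement, extension of its time coordinate and stability of the limit are
  combined here. The tolerances are independent: \<delta> measures how well the model fits
  \<open>f''\<close> at the end, while the nonlinearity of \<open>L\<close> can be brought within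
  any \<eta> of the limit for the original \<open>f\<close> by modifying closer to the end.\<close>

lemma left_end:
  fixes a b \<sigma> \<alpha> \<delta> :: real and m :: nat
  assumes f: "diffeo a b f f' f''" and ab: "a < b" and par: "f' a = 1"
    and \<sigma>: "\<sigma> = 1 \<or> \<sigma> = -1" and sgn: "\<And>x. x \<in> {a<..<b} \<Longrightarrow> 0 < \<sigma> * (f x - x)"
    and m: "1 \<le> m" and \<alpha>: "0 < \<alpha>"
    and \<delta>: "\<bar>germ'' m 1 (- \<sigma> / \<alpha>) 0 - f'' a\<bar> < \<delta>"
    and z: "a < z1" "z1 \<le> z2" "z2 < b" and \<eta>: "0 < \<eta>" and c: "a < c" "c < b"
  obtains \<epsilon> F F' F'' L L' L'' where
    "0 < \<epsilon>" "a + \<epsilon> < c" "diffeo a b F F' F''" "F' a = 1"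
    "\<And>x. x \<in> {c..b} \<Longrightarrow> F x = f x \<and> F' x = f' x \<and> F'' x = f'' x"
    "\<And>x. x \<in> {a..b} \<Longrightarrow> \<bar>F'' x - f'' x\<bar> \<le> 33 * \<delta>"
    "c2 {a<..<b} L L' L''" "\<And>x. x \<in> {a<..<b} \<Longrightarrow> 0 < L' x" "\<And>x. x \<in> {a<..<b} \<Longrightarrow> L (F x) = L x + \<sigma>"
    "\<And>x. x \<in> {a<..<a+\<epsilon>} \<Longrightarrow> L x = - \<alpha> / (x - a) ^ m"
    "\<And>x. x \<in> {z1..z2} \<Longrightarrow>
      \<bar>L'' x / L' x - lim_nonlin (towards a b \<sigma> f) (towards' a b \<sigma> f f') (towards'' a b \<sigma> f f' f'') x\<bar> \<le> \<eta>"
proof -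
  obtain B where B: "\<And>c. a < c \<Longrightarrow> c < b \<Longrightarrow> \<exists>\<epsilon> F F' F''. 0 < \<epsilon> \<and> a + \<epsilon> < c \<and> diffeo a b F F' F'' \<and> F' a = 1
      \<and> (\<forall>x\<in>{c..b}. F x = f x \<and> F' x = f' x \<and> F'' x = f'' x)
      \<and> (\<forall>x\<in>{a..b}. \<bar>F'' x - f'' x\<bar> \<le> 33 * \<delta>)
      \<and> (\<forall>x\<in>{a<..<b}. 0 < \<sigma> * (F x - x))
      \<and> (\<forall>x\<in>{a<..<a+\<epsilon>}. - \<alpha> / (F x - a) ^ m = - \<alpha> / (x - a) ^ m + \<sigma>)
      \<and> (\<forall>x\<in>{a..b}. \<bar>F'' x / F' x\<bar> \<le> B \<and> \<bar>F'' x / (F' x)\<^sup>2\<bar> \<le> B)"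
    by (rule modify_germ[OF f ab par \<sigma> sgn m \<alpha> \<delta>]) (assumption, rule that, blast)
  have cf: "c2 {a..b} f f' f''" and f'_pos: "\<And>x. x \<in> {a..b} \<Longrightarrow> 0 < f' x" using f by (auto simp: diffeo_def)
  have nz: "f' x \<noteq> 0" if "x \<in> {a..b}" for x using f'_pos[OF that] by simp
  have "continuous_on {a..b} (\<lambda>x. f'' x / f' x)"
    using nz by (intro continuous_on_divide c2D(3,4)[OF cf]) blast
  then obtain M1 where M1: "\<And>x. x \<in> {a..b} \<Longrightarrow> \<bar>f'' x / f' x\<bar> \<le> M1"
    using continuous_on_Icc_bounded by blast
  have "continuous_on {a..b} (\<lambda>x. f'' x / (f' x)\<^sup>2)"
    using nz by (intro continuous_on_divide continuous_on_power c2D(3,4)[OF cf]) simp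
  then obtain M2 where M2: "\<And>x. x \<in> {a..b} \<Longrightarrow> \<bar>f'' x / (f' x)\<^sup>2\<bar> \<le> M2"
    using continuous_on_Icc_bounded by blast
  note M12 = M1 M2
  \<comment> \<open>One bound for \<open>f\<close> and for all its modifications, as the stability
    lemma requires.\<close>
  define BB where "BB = max B (max M1 M2)"
  let ?\<phi> = "towards a b \<sigma>" and ?\<phi>' = "towards' a b \<sigma>" and ?\<phi>'' = "towards'' a b \<sigma>"
  have con_f: "contraction a b (?\<phi> f) (?\<phi>' f f') (?\<phi>'' f f' f'') BB"
    by (rule contraction_towards[OF f ab par \<sigma> sgn]) (use M12 in \<open>fastforce simp: BB_def\<close>)+
  obtain c1 where c1: "a < c1" "\<And>\<psi> \<psi>' \<psi>'' x. contraction a b \<psi> \<psi>' \<psi>'' BB \<Longrightarrow>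
    (\<And>x. c1 \<le> x \<Longrightarrow> x \<le> b \<Longrightarrow> \<psi> x = ?\<phi> f x \<and> \<psi>' x = ?\<phi>' f f' x \<and> \<psi>'' x = ?\<phi>'' f f' f'' x) \<Longrightarrow>
    x \<in> {z1..z2} \<Longrightarrow> \<bar>lim_nonlin \<psi> \<psi>' \<psi>'' x - lim_nonlin (?\<phi> f) (?\<phi>' f f') (?\<phi>'' f f' f'') x\<bar> \<le> \<eta>"
    using lim_nonlin_stable[OF con_f z \<eta>] by metis
  define d2 where "d2 = min c1 ((a + b) / 2)"
  have d2: "a < d2" "d2 < b" "d2 \<le> c1" using c1(1) ab by (auto simp: d2_def min_def)
  define g where "g = inv_into {a..b} f"
  note g = diffeo_inverse[OF f less_imp_le[OF ab], folded g_def]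
  have gc: "g d2 \<in> {a<..<b}" using diffeo_interval(2)[OF g(1), of d2] d2 by simp
  \<comment> \<open>The inverse at \<open>x\<close> involves \<open>f\<close> at \<open>g x\<close>,
    so \<open>f\<close> must be left unchanged above \<open>g d2\<close> as well as above
    \<open>d2\<close>.\<close>
  define c0 where "c0 = min c (min d2 (g d2))"
  have c0: "a < c0" "c0 < b" "c0 \<le> c" "c0 \<le> d2" "c0 \<le> g d2" using c d2 gc by (auto simp: c0_def)
  obtain \<epsilon> F F' F'' where F: "0 < \<epsilon>" "a + \<epsilon> < c0" "diffeo a b F F' F''" "F' a = 1"
      "\<And>x. x \<in> {c0..b} \<Longrightarrow> F x = f x \<and> F' x = f' x \<and> F'' x = f'' x"
      "\<And>x. x \<in> {a..b} \<Longrightarrow> \<bar>F'' x - f'' x\<bar> \<le> 33 * \<delta>"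
      "\<And>x. x \<in> {a<..<b} \<Longrightarrow> 0 < \<sigma> * (F x - x)"
      "\<And>x. x \<in> {a<..<a+\<epsilon>} \<Longrightarrow> - \<alpha> / (F x - a) ^ m = - \<alpha> / (x - a) ^ m + \<sigma>"
      "\<And>x. x \<in> {a..b} \<Longrightarrow> \<bar>F'' x / F' x\<bar> \<le> B \<and> \<bar>F'' x / (F' x)\<^sup>2\<bar> \<le> B"
    using B[OF c0(1,2)] by blast
  define G where "G = inv_into {a..b} F"
  note G = diffeo_inverse[OF F(3) less_imp_le[OF ab], folded G_def]
  have con_F: "contraction a b (?\<phi> F) (?\<phi>' F F') (?\<phi>'' F F' F'') BB"
    by (rule contraction_towards[OF F(3) ab F(4) \<sigma> F(7)]) (use F(9) in \<open>fastforce simp: BB_def\<close>)+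
  interpret C: contraction a b "?\<phi> F" "?\<phi>' F F'" "?\<phi>'' F F' F''" BB by (rule con_F)
  have agree: "?\<phi> F x = ?\<phi> f x \<and> ?\<phi>' F F' x = ?\<phi>' f f' x \<and> ?\<phi>'' F F' F'' x = ?\<phi>'' f f' f'' x"
    if x: "c1 \<le> x" "x \<le> b" for x
  proof -
    have xI: "x \<in> {a..b}" "x \<in> {c0..b}" using x c0 d2 by auto
    show ?thesis
      using \<sigma>
    proof
      assume "\<sigma> = -1"
      then show ?thesis using F(5)[OF xI(2)] by (simp add: towards_def towards'_def towards''_def)
    next
      assume s: "\<sigma> = 1"
      have gx: "g x \<in> {a..b}" using diffeo_interval(1)[OF g(1) xI(1)] .
      have "g d2 \<le> g x" using diffeo_less_iff(3)[OF g(1), of d2 x] d2 x xI by simp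
      then have gx0: "g x \<in> {c0..b}" using gx c0 by simp
      have "G x = g x"
        using G(3)[OF gx] F(5)[OF gx0] g(2)[OF xI(1)] by simp
      with s F(5)[OF gx0] show ?thesis by (simp add: towards_def towards'_def towards''_def g_def G_def)
    qed
  qed
  let ?m = "\<lambda>x. - \<alpha> / (x - a) ^ m"
  have cm: "c2 {a<..<a+\<epsilon>} ?m (\<lambda>x. \<alpha> * real m / (x - a) ^ (m + 1)) (\<lambda>x. - \<alpha> * real m * (real m + 1) / (x - a) ^ (m + 2))"
    using c2_shift[OF c2_pole[of "{0<..}" \<alpha> m], of "{a<..<a+\<epsilon>}" a 0] by simp
  have phi_m: "?m (?\<phi> F x) = ?m x - 1" if x: "x \<in> {a<..<a+\<epsilon>}" for x
  proof -
    have xI: "x \<in> {a<..<b}" using x F(2) c0 by auto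
    show ?thesis
      using \<sigma>
    proof
      assume "\<sigma> = -1"
      then show ?thesis using F(8)[OF x] by (simp add: towards_def)
    next
      assume s: "\<sigma> = 1"
      have "G x \<in> {a<..<b}" using diffeo_interval(2)[OF G(1) xI] .
      moreover have "G x < x" using C.less[OF xI] s by (simp add: towards_def G_def)
      ultimately have "G x \<in> {a<..<a+\<epsilon>}" using x by auto
      from F(8)[OF this] G(2)[of x] xI s show ?thesis by (simp add: towards_def G_def)
    qed
  qed
  obtain L L' L'' where L: "c2 {a<..<b} L L' L''" "\<And>x. x \<in> {a<..<a+\<epsilon>} \<Longrightarrow> L x = ?m x"
    "\<And>x. x \<in> {a<..<b} \<Longrightarrow> 0 < L' x" "\<And>x. x \<in> {a<..<b} \<Longrightarrow> L (?\<phi> F x) = L x - 1"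
    "\<And>x. x \<in> {a<..<b} \<Longrightarrow> L'' x / L' x = C.A x"
  proof (rule C.coordinate_exists[OF cm F(1) _ _ phi_m])
    show "a + \<epsilon> \<le> b" using F(2) c0 by simp
    show "0 < \<alpha> * real m / (x - a) ^ (m + 1)" if "x \<in> {a<..<a+\<epsilon>}" for x using that \<alpha> m by simp
    show "\<bar>- \<alpha> * real m * (real m + 1) / (x - a) ^ (m + 2) / (\<alpha> * real m / (x - a) ^ (m + 1))\<bar> * (x - a) \<le> real m + 1"
      if "x \<in> {a<..<a+\<epsilon>}" for x
    proof -
      have "- \<alpha> * real m * (real m + 1) / X ^ (m + 2) / (\<alpha> * real m / X ^ (m + 1)) = - (real m + 1) / X"
        if "0 < X" for X using that \<alpha> m by (simp add: field_simps)
      from this[of "x - a"] that show ?thesis by (simp add: abs_div)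
    qed
  qed auto
  have LF: "L (F x) = L x + \<sigma>" if x: "x \<in> {a<..<b}" for x
    using \<sigma>
  proof
    assume "\<sigma> = -1"
    then show ?thesis using L(4)[OF x] by (simp add: towards_def)
  next
    assume s: "\<sigma> = 1"
    have "L (G (F x)) = L (F x) - 1"
      using L(4)[OF diffeo_interval(2)[OF F(3) x]] s by (simp add: towards_def G_def)
    with G(3)[of x] x s show ?thesis by simp
  qed
  show thesis
  proof (rule that[OF F(1) _ F(3,4) _ F(6) L(1,3) LF L(2)])
    show "a + \<epsilon> < c" using F(2) c0 by simp
    show "F x = f x \<and> F' x = f' x \<and> F'' x = f'' x" if "x \<in> {c..b}" for x using F(5)[of x] that c0 by auto
    show "\<bar>L'' x / L' x - lim_nonlin (?\<phi> f) (?\<phi>' f f') (?\<phi>'' f f' f'') x\<bar> \<le> \<eta>" if "x \<in> {z1..z2}" for x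
      using c1(2)[OF con_F agree that] L(5)[of x] that z by auto
  qed
qed

section \<open>Affine maps in a time coordinate\<close>

lemma pole_large:
  fixes \<beta> \<epsilon> t :: real
  assumes "0 < \<beta>" "1 \<le> n" "0 < \<epsilon>"
  obtains r where "0 < r" "r < \<epsilon>" "\<And>X. 0 < X \<Longrightarrow> X \<le> r \<Longrightarrow> t < \<beta> / X ^ n"
proof (rule that[of "min (min (\<epsilon> / 2) 1) (\<beta> / (1 + \<bar>t\<bar>))"])
  have pos: "0 < \<beta> / (1 + \<bar>t\<bar>)" using assms by (intro divide_pos_pos) auto
  then show "0 < min (min (\<epsilon> / 2) 1) (\<beta> / (1 + \<bar>t\<bar>))" using assms by simp
  show "min (min (\<epsilon> / 2) 1) (\<beta> / (1 + \<bar>t\<bar>)) < \<epsilon>" using assms by linarith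
  fix X assume X: "0 < X" "X \<le> min (min (\<epsilon> / 2) 1) (\<beta> / (1 + \<bar>t\<bar>))"
  then have "X ^ n \<le> X" using power_decreasing[of 1 n X] assms(2) by simp
  also have "X \<le> \<beta> / (1 + \<bar>t\<bar>)" using X by simp
  finally have "X ^ n * (1 + \<bar>t\<bar>) \<le> \<beta>" by (simp add: pos_le_divide_eq)
  then have "1 + \<bar>t\<bar> \<le> \<beta> / X ^ n" using X(1) by (simp add: pos_le_divide_eq mult.commute)
  then show "t < \<beta> / X ^ n" by linarith
qed

text \<open>Near the end \<open>K\<close> is a pole plus \<open>d\<close>, so
  \<open>K (G x) = q * K x + s\<close> is an affine relation between values of \<open>1/X^m\<close>
  with slope \<open>q\<close> and intercept \<open>- ((q - 1) * d + s) / \<alpha>\<close>. It may be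
  used once \<open>G x\<close> lies in the zone of the pole too, which holds near \<open>a\<close>
  because \<open>K (G x)\<close> tends to minus infinity there.\<close>

lemma germ_at_end:
  fixes K G :: "real \<Rightarrow> real"
  assumes ab: "a < b" and mono: "\<And>x y. x \<in> {a<..<b} \<Longrightarrow> y \<in> {a<..<b} \<Longrightarrow> x < y \<Longrightarrow> K x < K y"
    and G: "\<And>x. x \<in> {a<..<b} \<Longrightarrow> G x \<in> {a<..<b} \<and> K (G x) = q * K x + s" and q: "0 < q"
    and \<epsilon>: "0 < \<epsilon>" "a + \<epsilon> < b" and m: "1 \<le> m" and \<alpha>: "0 < \<alpha>"
    and K: "\<And>x. x \<in> {a<..<a+\<epsilon>} \<Longrightarrow> K x = - \<alpha> / (x - a) ^ m + d"
  obtains r where "0 < r" "r < \<epsilon>" "\<And>x. x \<in> {a<..<a+r} \<Longrightarrow>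
      0 < q + (- ((q - 1) * d + s) / \<alpha>) * (x - a) ^ m \<and> G x = germ m q (- ((q - 1) * d + s) / \<alpha>) (x - a) + a"
proof -
  define e where "e = - ((q - 1) * d + s) / \<alpha>"
  define y where "y = a + \<epsilon> / 2"
  have y: "y \<in> {a<..<a+\<epsilon>}" "y \<in> {a<..<b}" using \<epsilon> by (auto simp: y_def)
  obtain r where r: "0 < r" "r < \<epsilon>" "\<And>X. 0 < X \<Longrightarrow> X \<le> r \<Longrightarrow> s + q * d - K y < q * \<alpha> / X ^ m"
    using pole_large[of "q * \<alpha>" m \<epsilon> "s + q * d - K y"] q \<alpha> m \<epsilon> by auto
  show thesis
  proof (rule that[OF r(1,2)], fold e_def)
    fix x assume x: "x \<in> {a<..<a+r}"
    then have xI: "x \<in> {a<..<a+\<epsilon>}" "x \<in> {a<..<b}" using r \<epsilon> by auto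
    have X: "0 < x - a" "x - a < r" using x by auto
    have "s + q * d - K y < q * \<alpha> / (x - a) ^ m" using r(3)[of "x - a"] X by simp
    have "K (G x) < K y"
    proof -
      have "q * K x = - (q * \<alpha> / (x - a) ^ m) + q * d" unfolding K[OF xI(1)] by (simp add: algebra_simps)
      with G[OF xI(2)] \<open>s + q * d - K y < _\<close> show ?thesis by linarith
    qed
    then have "G x \<le> y" using mono[of y "G x"] G[OF xI(2)] y by force
    then have GI: "G x \<in> {a<..<a+\<epsilon>}" using G[OF xI(2)] y by auto
    have "- \<alpha> / (G x - a) ^ m + d = q * (- \<alpha> / (x - a) ^ m + d) + s"
      using G[OF xI(2)] K[OF GI] K[OF xI(1)] by simp
    moreover have "\<alpha> * e = - ((q - 1) * d + s)" using \<alpha> by (simp add: e_def)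
    ultimately have "\<alpha> * (1 / (G x - a) ^ m) = \<alpha> * (q / (x - a) ^ m + e)"
      by (simp add: algebra_simps)
    then have "1 / (G x - a) ^ m = q / (x - a) ^ m + e"
      using \<alpha> unfolding mult_cancel_left by simp
    from germ_unique[OF m X(1) _ this] GI
    show "0 < q + e * (x - a) ^ m \<and> G x = germ m q e (x - a) + a" by auto
  qed
qed

text \<open>A chart of the open component onto the real line that is a model pole near both ends.
  The offsets \<open>d\<close> and \<open>d'\<close> are kept separate, since adding a constant to
  \<open>K\<close> shifts both of them and can normalise only one.\<close>

locale time_coordinate =
  fixes a b :: real and K K' K'' :: "real \<Rightarrow> real" and \<epsilon> \<alpha> \<alpha>' d d' :: real and m m' :: nat
  assumes ab: "a < b" and cK: "c2 {a<..<b} K K' K''" and K'_pos: "x \<in> {a<..<b} \<Longrightarrow> 0 < K' x"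
    and \<epsilon>: "0 < \<epsilon>" "a + \<epsilon> < b" and m: "1 \<le> m" "1 \<le> m'" and \<alpha>: "0 < \<alpha>" "0 < \<alpha>'"
    and left: "x \<in> {a<..<a+\<epsilon>} \<Longrightarrow> K x = - \<alpha> / (x - a) ^ m + d"
    and right: "x \<in> {b-\<epsilon><..<b} \<Longrightarrow> K x = \<alpha>' / (b - x) ^ m' + d'"
begin

lemma K_less:
  assumes "x \<in> {a<..<b}" "y \<in> {a<..<b}" "x < y"
  shows "K x < K y"
proof (rule DERIV_pos_imp_increasing[OF assms(3)])
  fix z assume "x \<le> z" "z \<le> y"
  then have "z \<in> {a<..<b}" using assms by auto
  then show "\<exists>D. DERIV K z :> D \<and> 0 < D"
    using c2_D(1)[OF cK open_greaterThanLessThan] K'_pos by blast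
qed

lemma K_inj: "x \<in> {a<..<b} \<Longrightarrow> y \<in> {a<..<b} \<Longrightarrow> K x = K y \<Longrightarrow> x = y"
  using K_less[of x y] K_less[of y x] by (cases x y rule: linorder_cases) auto

lemma K_le_iff: "x \<in> {a<..<b} \<Longrightarrow> y \<in> {a<..<b} \<Longrightarrow> K x \<le> K y \<longleftrightarrow> x \<le> y"
  using K_less[of x y] K_less[of y x] by (cases x y rule: linorder_cases) auto

lemma K_surj: "\<exists>x\<in>{a<..<b}. K x = t"
proof -
  obtain X where X: "X \<in> {0<..<\<epsilon>}" "d - t < \<alpha> / X ^ m"
    using pole_large[OF \<alpha>(1) m(1) \<epsilon>(1)] by (metis greaterThanLessThan_iff order_refl)
  obtain Y where Y: "Y \<in> {0<..<\<epsilon>}" "t - d' < \<alpha>' / Y ^ m'"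
    using pole_large[OF \<alpha>(2) m(2) \<epsilon>(1)] by (metis greaterThanLessThan_iff order_refl)
  have 1: "K (a + X) < t" using left[of "a + X"] X by auto
  have 2: "t < K (b - Y)" using right[of "b - Y"] Y by auto
  have I: "a + X \<in> {a<..<b}" "b - Y \<in> {a<..<b}" using X Y \<epsilon> by auto
  have le: "a + X \<le> b - Y" using 1 2 K_le_iff[OF I] by linarith
  have "continuous_on {a + X..b - Y} K"
    using c2D(5)[OF cK] by (rule continuous_on_subset) (use I in auto)
  then obtain x where "a + X \<le> x" "x \<le> b - Y" "K x = t"
    using IVT'[of K "a + X" t "b - Y"] 1 2 le by auto
  with I show ?thesis by (intro bexI[of _ x]) auto
qed

definition "Kinv t = (THE x. x \<in> {a<..<b} \<and> K x = t)"

lemma Kinv: "Kinv t \<in> {a<..<b}" "K (Kinv t) = t"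
proof -
  have "\<exists>!x. x \<in> {a<..<b} \<and> K x = t" using K_surj[of t] K_inj by blast
  from theI'[OF this] show "Kinv t \<in> {a<..<b}" "K (Kinv t) = t" by (simp_all add: Kinv_def)
qed

lemma Kinv_K: "x \<in> {a<..<b} \<Longrightarrow> Kinv (K x) = x"
  using K_inj[OF Kinv(1) _ Kinv(2)] by blast

lemma Kinv_continuous: "continuous_on UNIV Kinv"
proof (intro continuous_at_imp_continuous_on ballI)
  fix t
  obtain x1 x2 where x: "a < x1" "x1 < Kinv t" "Kinv t < x2" "x2 < b"
    using Kinv(1)[of t] dense[of a "Kinv t"] dense[of "Kinv t" b] by auto
  have "isCont Kinv (K (Kinv t))"
  proof (rule isCont_inverse_function2[where a=x1 and b=x2 and x="Kinv t" and f=K and g=Kinv])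
    show "Kinv (K z) = z" "isCont K z" if "x1 \<le> z" "z \<le> x2" for z
      using Kinv_K[of z] DERIV_isCont[OF c2_D(1)[OF cK, of z]] that x by auto
  qed (use x in auto)
  then show "isCont Kinv t" by (simp add: Kinv(2))
qed

lemma c2_Kinv: "c2 UNIV Kinv (\<lambda>t. 1 / K' (Kinv t)) (\<lambda>t. - K'' (Kinv t) / K' (Kinv t) ^ 3)"
proof (rule c2_inverse[OF cK _ Kinv_continuous])
  show "K' x \<noteq> 0" if "x \<in> {a<..<b}" for x using K'_pos[OF that] by simp
qed (use Kinv in auto)

text \<open>Near each end \<open>G\<close> is a model germ, and the derivatives of the germ extend
  those of \<open>G\<close>. At the ends \<open>q\<close> alone fixes the first derivatives, while
  \<open>s\<close> enters the second ones through \<open>e\<close> and \<open>e'\<close>.\<close>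

lemma affine_map:
  fixes q s :: real
  assumes q: "0 < q"
  defines "e \<equiv> - ((q - 1) * d + s) / \<alpha>" and "e' \<equiv> ((q - 1) * d' + s) / \<alpha>'"
  obtains G G' G'' where "diffeo a b G G' G''"
    "\<And>x. x \<in> {a<..<b} \<Longrightarrow> G x \<in> {a<..<b} \<and> K (G x) = q * K x + s"
    "\<And>x. x \<in> {a<..<b} \<Longrightarrow> G' x = q * K' x / K' (G x)"
    "\<And>x. x \<in> {a<..<b} \<Longrightarrow> G'' x = G' x * (K'' x / K' x - K'' (G x) / K' (G x) * G' x)"
    "G' a = q powr (- 1 / real m)" "G' b = q powr (- 1 / real m')"
    "G'' a = germ'' m q e 0" "G'' b = - germ'' m' q e' 0"
proof -
  define G where "G x = (if x \<in> {a<..<b} then Kinv (q * K x + s) else x)" for x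
  define G' where "G' x = (if x \<in> {a<..<b} then q * K' x / K' (G x)
      else if x = a then germ' m q e 0 else germ' m' q e' 0)" for x
  define G'' where "G'' x = (if x \<in> {a<..<b} then G' x * (K'' x / K' x - K'' (G x) / K' (G x) * G' x)
      else if x = a then germ'' m q e 0 else - germ'' m' q e' 0)" for x
  have GI: "G x \<in> {a<..<b} \<and> K (G x) = q * K x + s" if "x \<in> {a<..<b}" for x
    using that Kinv by (simp add: G_def)
  have Gab: "G a = a" "G b = b" by (simp_all add: G_def)
  have cG: "c2 {a<..<b} G G' G''"
  proof (rule c2_cong)
    show "c2 {a<..<b} (\<lambda>x. Kinv (q * K x + s)) (\<lambda>x. 1 / K' (Kinv (q * K x + s)) * (q * K' x + 0))
      (\<lambda>x. - K'' (Kinv (q * K x + s)) / K' (Kinv (q * K x + s)) ^ 3 * (q * K' x + 0)\<^sup>2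
        + 1 / K' (Kinv (q * K x + s)) * (q * K'' x + 0))"
      by (rule c2_compose[OF c2_add[OF c2_cmult[OF cK] c2_const] c2_Kinv]) auto
  next
    fix x assume x: "x \<in> {a<..<b}"
    have Gx: "Kinv (q * K x + s) = G x" using x by (simp add: G_def)
    show "G x = Kinv (q * K x + s)" using Gx ..
    show "G' x = 1 / K' (Kinv (q * K x + s)) * (q * K' x + 0)" using x by (simp add: G'_def Gx)
    have "K' x > 0" "K' (G x) > 0" using K'_pos GI[OF x] x by auto
    then show "G'' x = - K'' (Kinv (q * K x + s)) / K' (Kinv (q * K x + s)) ^ 3 * (q * K' x + 0)\<^sup>2
        + 1 / K' (Kinv (q * K x + s)) * (q * K'' x + 0)"
      using x unfolding Gx by (simp add: G''_def G'_def field_simps power2_eq_square power3_eq_cube)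
  qed
  obtain r where r: "0 < r" "r < \<epsilon>" "\<And>x. x \<in> {a<..<a+r} \<Longrightarrow>
      0 < q + e * (x - a) ^ m \<and> G x = germ m q e (x - a) + a"
    using germ_at_end[OF ab K_less GI q \<epsilon> m(1) \<alpha>(1) left] unfolding e_def by blast
  have refl: "a + b - x \<in> {a<..<b}" if "x \<in> {a<..<b}" for x using that by auto
  \<comment> \<open>The reflected coordinate \<open>- K (a + b - x)\<close> has a pole of the left
    type at \<open>a\<close>; the offset and the translation part change sign.\<close>
  obtain r' where r': "0 < r'" "r' < \<epsilon>" "\<And>x. x \<in> {a<..<a+r'} \<Longrightarrow>
      0 < q + e' * (x - a) ^ m' \<and> a + b - G (a + b - x) = germ m' q e' (x - a) + a"
  proof (rule germ_at_end[of a b "\<lambda>x. - K (a + b - x)" "\<lambda>x. a + b - G (a + b - x)" q "- s" \<epsilon> m' \<alpha>' "- d'"])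
    show "a + b - G (a + b - x) \<in> {a<..<b} \<and> - K (a + b - (a + b - G (a + b - x))) = q * - K (a + b - x) + - s"
      if "x \<in> {a<..<b}" for x using GI[OF refl[OF that]] by auto
    show "- K (a + b - x) = - \<alpha>' / (x - a) ^ m' + - d'" if "x \<in> {a<..<a+\<epsilon>}" for x
      using right[of "a + b - x"] that by auto
  next
    fix r assume A: "0 < r" "r < \<epsilon>" and B: "\<And>x. x \<in> {a<..<a + r} \<Longrightarrow>
      0 < q + - ((q - 1) * - d' + - s) / \<alpha>' * (x - a) ^ m' \<and>
      a + b - G (a + b - x) = germ m' q (- ((q - 1) * - d' + - s) / \<alpha>') (x - a) + a"
    have "- ((q - 1) * - d' + - s) / \<alpha>' = e'" by (simp add: e'_def)
    from that[OF A B[unfolded this]] show thesis by blast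
  qed (use ab K_less[OF refl refl] q \<epsilon> m \<alpha> in auto)
  have cL: "c2 {a..<a+r} G G' G''"
  proof -
    have pos: "0 < q + e * X ^ m" if "X \<in> {0..<r}" for X
      using r(3)[of "a + X"] that q m by (cases "X = 0") (auto simp: zero_power)
    have *: "c2 {a..<a+r} (\<lambda>x. germ m q e (x - a) + a) (\<lambda>x. germ' m q e (x - a)) (\<lambda>x. germ'' m q e (x - a))"
      using c2_shift[OF c2_germ[OF m(1) pos, of "{0..<r}"], of "{a..<a+r}" a a] by auto
    have eq: "G x = germ m q e (x - a) + a" if "x \<in> {a..<a+r}" for x
      using r(3)[of x] that Gab germ_0(1)[OF m(1) q, of e] by (cases "x = a") auto
    have sub: "{a<..<a+r} \<subseteq> {a<..<b}" "{a<..<a+r} \<subseteq> {a..<a+r}" using r \<epsilon> by auto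
    note u = c2_unique_open[OF c2_subset[OF cG sub(1)] c2_subset[OF * sub(2)]]
    have "G' x = germ' m q e (x - a) \<and> G'' x = germ'' m q e (x - a)" if "x \<in> {a..<a+r}" for x
    proof (cases "x = a")
      case False
      with that u[of x] eq show ?thesis by simp
    qed (simp add: G'_def G''_def)
    with eq show ?thesis by (intro c2_cong[OF *]) auto
  qed
  have cR: "c2 {b-r'<..b} G G' G''"
  proof -
    have pos: "0 < q + e' * X ^ m'" if "X \<in> {0..<r'}" for X
      using r'(3)[of "a + X"] that q m by (cases "X = 0") (auto simp: zero_power)
    have "(\<lambda>x. b - x) ` {0..<r'} = {b-r'<..b}"
      by (auto simp: image_iff intro!: bexI[of _ "b - _"])
    then have *: "c2 {b-r'<..b} (\<lambda>x. b - germ m' q e' (b - x)) (\<lambda>x. germ' m' q e' (b - x)) (\<lambda>x. - germ'' m' q e' (b - x))"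
      using c2_shift_reflect[OF c2_germ[OF m(2) pos, of "{0..<r'}"], of b b] by auto
    have eq: "G x = b - germ m' q e' (b - x)" if "x \<in> {b-r'<..b}" for x
      using r'(3)[of "a + b - x"] that Gab germ_0(1)[OF m(2) q, of e'] by (cases "x = b") auto
    have sub: "{b-r'<..<b} \<subseteq> {a<..<b}" "{b-r'<..<b} \<subseteq> {b-r'<..b}" using r' \<epsilon> by auto
    note u = c2_unique_open[OF c2_subset[OF cG sub(1)] c2_subset[OF * sub(2)]]
    have "G' x = germ' m' q e' (b - x) \<and> G'' x = - germ'' m' q e' (b - x)" if "x \<in> {b-r'<..b}" for x
    proof (cases "x = b")
      case False
      with that u[of x] eq show ?thesis by simp
    qed (use ab in \<open>simp add: G'_def G''_def\<close>)
    with eq show ?thesis by (intro c2_cong[OF *]) auto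
  qed
  have "c2 {a..b} G G' G''"
  proof (rule c2_local)
    fix x assume x: "x \<in> {a..b}"
    then consider "x = a" | "x = b" | "x \<in> {a<..<b}" by force
    then show "\<exists>U. open U \<and> x \<in> U \<and> c2 ({a..b} \<inter> U) G G' G''"
    proof cases
      case 1
      then show ?thesis
        using r(1) by (intro exI[of _ "{..<a+r}"] conjI c2_subset[OF cL]) auto
    next
      case 2
      then show ?thesis
        using r'(1) by (intro exI[of _ "{b-r'<..}"] conjI c2_subset[OF cR]) auto
    next
      case 3
      then show ?thesis by (intro exI[of _ "{a<..<b}"] conjI c2_subset[OF cG]) auto
    qed
  qed
  moreover have ends: "G' a = q powr (- 1 / real m)" "G' b = q powr (- 1 / real m')"
    "G'' a = germ'' m q e 0" "G'' b = - germ'' m' q e' 0"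
    using germ_0(2)[OF m(1) q] germ_0(2)[OF m(2) q] ab by (simp_all add: G'_def G''_def)
  moreover have "0 < G' x" if "x \<in> {a..b}" for x
  proof (cases "x \<in> {a<..<b}")
    case True
    then show ?thesis using K'_pos[OF True] K'_pos[of "G x"] GI[OF True] q by (simp add: G'_def)
  next
    case False
    then show ?thesis using that ends q by (cases "x = a") auto
  qed
  ultimately have "diffeo a b G G' G''" using Gab by (simp add: diffeo_def)
  then show thesis
    by (rule that[OF _ GI _ _ ends]) (simp_all add: G'_def G''_def)
qed

end

lemma diffeo_cong:
  assumes "diffeo a b f f' f''" "\<And>x. x \<in> {a..b} \<Longrightarrow> g x = f x \<and> g' x = f' x \<and> g'' x = f'' x" "a \<le> b"
  shows "diffeo a b g g' g''"
  using assms c2_cong[of "{a..b}" f f' f'' g g' g''] unfolding diffeo_def by auto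

lemma contraction_cong:
  assumes "contraction a b f f' f'' B"
    and eq: "\<And>x. x \<in> {a..b} \<Longrightarrow> g x = f x \<and> g' x = f' x \<and> g'' x = f'' x"
  shows "contraction a b g g' g'' B"
    and "x \<in> {a<..<b} \<Longrightarrow> lim_nonlin g g' g'' x = lim_nonlin f f' f'' x"
proof -
  interpret contraction a b f f' f'' B by fact
  show "contraction a b g g' g'' B"
    using ab diffeo_cong[OF diffeo eq] eq par less bound by unfold_locales auto
  assume x: "x \<in> {a<..<b}"
  have "(f ^^ n) x \<in> {a..b}" for n using it_in[OF x, of n] by auto
  note eq' = eq[OF this]
  have it: "(g ^^ n) x = (f ^^ n) x" for n
    by (induction n) (use eq' in auto)
  have "iter_deriv g g' n x = D n x" for n
    unfolding iter_deriv_def it by (simp add: eq')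
  then have "iter_nonlin g g' g'' n x = S n x" for n
    unfolding iter_nonlin_def it by (simp add: eq')
  then show "lim_nonlin g g' g'' x = A x" by (simp add: lim_nonlin_def)
qed

text \<open>This is \<open>left_end\<close> for the reflected map. Reflection reverses the direction
  of motion, hence \<open>- \<sigma>\<close>, and negates nonlinearities, hence the plus sign in
  front of the limit.\<close>

lemma right_end:
  fixes a b \<sigma> \<alpha> \<delta> :: real and m :: nat
  assumes f: "diffeo a b f f' f''" and ab: "a < b" and par: "f' b = 1"
    and \<sigma>: "\<sigma> = 1 \<or> \<sigma> = -1" and sgn: "\<And>x. x \<in> {a<..<b} \<Longrightarrow> 0 < \<sigma> * (f x - x)"
    and m: "1 \<le> m" and \<alpha>: "0 < \<alpha>"
    and \<delta>: "\<bar>germ'' m 1 (\<sigma> / \<alpha>) 0 + f'' b\<bar> < \<delta>"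
    and z: "a < z1" "z1 \<le> z2" "z2 < b" and \<eta>: "0 < \<eta>" and c: "a < c" "c < b"
  defines "fr \<equiv> \<lambda>x. a + b - f (a + b - x)" and "fr' \<equiv> \<lambda>x. f' (a + b - x)" and "fr'' \<equiv> \<lambda>x. - f'' (a + b - x)"
  obtains \<epsilon> F F' F'' R R' R'' where
    "0 < \<epsilon>" "c < b - \<epsilon>" "diffeo a b F F' F''" "F' b = 1"
    "\<And>x. x \<in> {a..c} \<Longrightarrow> F x = f x \<and> F' x = f' x \<and> F'' x = f'' x"
    "\<And>x. x \<in> {a..b} \<Longrightarrow> \<bar>F'' x - f'' x\<bar> \<le> 33 * \<delta>"
    "c2 {a<..<b} R R' R''" "\<And>x. x \<in> {a<..<b} \<Longrightarrow> 0 < R' x" "\<And>x. x \<in> {a<..<b} \<Longrightarrow> R (F x) = R x + \<sigma>"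
    "\<And>x. x \<in> {b-\<epsilon><..<b} \<Longrightarrow> R x = \<alpha> / (b - x) ^ m"
    "\<And>x. x \<in> {z1..z2} \<Longrightarrow> \<bar>R'' x / R' x +
      lim_nonlin (towards a b (- \<sigma>) fr) (towards' a b (- \<sigma>) fr fr') (towards'' a b (- \<sigma>) fr fr' fr'') (a + b - x)\<bar> \<le> \<eta>"
proof -
  have fr: "diffeo a b fr fr' fr''" unfolding fr_def fr'_def fr''_def by (rule diffeo_reflect[OF f])
  have rI: "a + b - x \<in> {a<..<b} \<longleftrightarrow> x \<in> {a<..<b}" "a + b - x \<in> {a..b} \<longleftrightarrow> x \<in> {a..b}"
    "a + b - (a + b - x) = x" for x :: real by auto
  obtain \<epsilon> F F' F'' L L' L'' where L:
    "0 < \<epsilon>" "a + \<epsilon> < a + b - c" "diffeo a b F F' F''" "F' a = 1"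
    "\<And>x. x \<in> {a + b - c..b} \<Longrightarrow> F x = fr x \<and> F' x = fr' x \<and> F'' x = fr'' x"
    "\<And>x. x \<in> {a..b} \<Longrightarrow> \<bar>F'' x - fr'' x\<bar> \<le> 33 * \<delta>"
    "c2 {a<..<b} L L' L''" "\<And>x. x \<in> {a<..<b} \<Longrightarrow> 0 < L' x" "\<And>x. x \<in> {a<..<b} \<Longrightarrow> L (F x) = L x + (- \<sigma>)"
    "\<And>x. x \<in> {a<..<a+\<epsilon>} \<Longrightarrow> L x = - \<alpha> / (x - a) ^ m"
    "\<And>x. x \<in> {a + b - z2..a + b - z1} \<Longrightarrow> \<bar>L'' x / L' x -
      lim_nonlin (towards a b (- \<sigma>) fr) (towards' a b (- \<sigma>) fr fr') (towards'' a b (- \<sigma>) fr fr' fr'') x\<bar> \<le> \<eta>"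
  proof (rule left_end[OF fr ab, of "- \<sigma>" m \<alpha> \<delta> "a + b - z2" "a + b - z1" \<eta> "a + b - c"])
    show "0 < - \<sigma> * (fr x - x)" if "x \<in> {a<..<b}" for x
      using sgn[of "a + b - x"] that by (simp add: fr_def algebra_simps)
    show "fr' a = 1" using par by (simp add: fr'_def)
    show "\<bar>germ'' m 1 (- (- \<sigma>) / \<alpha>) 0 - fr'' a\<bar> < \<delta>" using \<delta> by (simp add: fr''_def)
  qed (use \<sigma> m \<alpha> z \<eta> c in auto)
  let ?r = "\<lambda>x. a + b - x"
  show thesis
  proof (rule that[of \<epsilon> "\<lambda>x. a + b - F (?r x)" "\<lambda>x. F' (?r x)" "\<lambda>x. - F'' (?r x)"
        "\<lambda>x. 0 - L (?r x)" "\<lambda>x. L' (?r x)" "\<lambda>x. - L'' (?r x)"])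
    show "diffeo a b (\<lambda>x. a + b - F (?r x)) (\<lambda>x. F' (?r x)) (\<lambda>x. - F'' (?r x))"
      by (rule diffeo_reflect[OF L(3)])
    show "c2 {a<..<b} (\<lambda>x. 0 - L (?r x)) (\<lambda>x. L' (?r x)) (\<lambda>x. - L'' (?r x))"
      using c2_shift_reflect[OF L(7), of "a + b" 0] unfolding image_reflect_Ioo .
    show "a + b - F (?r x) = f x \<and> F' (?r x) = f' x \<and> - F'' (?r x) = f'' x" if "x \<in> {a..c}" for x
      using L(5)[of "?r x"] that by (simp add: fr_def fr'_def fr''_def)
    show "\<bar>- F'' (?r x) - f'' x\<bar> \<le> 33 * \<delta>" if "x \<in> {a..b}" for x
      using L(6)[of "?r x"] that by (simp add: fr''_def)
    show "0 < L' (?r x)" if "x \<in> {a<..<b}" for x using L(8)[of "?r x"] that by simp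
    show "0 - L (?r (a + b - F (?r x))) = 0 - L (?r x) + \<sigma>" if "x \<in> {a<..<b}" for x
      using L(9)[of "?r x"] that by simp
    show "0 - L (?r x) = \<alpha> / (b - x) ^ m" if "x \<in> {b-\<epsilon><..<b}" for x
      using L(10)[of "?r x"] that by simp
    show "\<bar>- L'' (?r x) / L' (?r x) +
      lim_nonlin (towards a b (- \<sigma>) fr) (towards' a b (- \<sigma>) fr fr') (towards'' a b (- \<sigma>) fr fr' fr'') (?r x)\<bar> \<le> \<eta>"
      if "x \<in> {z1..z2}" for x
      using L(11)[of "?r x"] that by (simp add: abs_minus_commute)
  qed (use L(1,2,4) in auto)
qed

section \<open>Convergence of time coordinates\<close>

lemma abs_exp_minus_1_le: "\<bar>exp r - 1\<bar> \<le> exp \<bar>r\<bar> - (1::real)"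
proof (cases "0 \<le> r")
  case False
  have "2 \<le> exp r + exp (- r)"
    using exp_ge_add_one_self[of r] exp_ge_add_one_self[of "- r"] by linarith
  then show ?thesis using False by (simp add: abs_if)
qed simp

text \<open>A time coordinate is determined by its nonlinearity \<open>L''/L'\<close> and two values; this makes it
  depend continuously, in the \<open>C\<^sup>1\<close> sense, on the nonlinearity.\<close>

lemma coordinate_limit:
  fixes z1 z2 p p' \<sigma> :: real
  assumes A: "continuous_on {z1..z2} A" and p: "p \<in> {z1..z2}" "p' \<in> {z1..z2}" "0 < \<sigma> * (p' - p)"
  obtains H H' M where
    "\<And>x. x \<in> {z1..z2} \<Longrightarrow> (H has_real_derivative H' x) (at x within {z1..z2})"
    "continuous_on {z1..z2} H'" "\<And>x. x \<in> {z1..z2} \<Longrightarrow> 0 < H' x"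
    "\<And>L L' L'' \<eta>. c2 {z1..z2} L L' L'' \<Longrightarrow> (\<And>x. x \<in> {z1..z2} \<Longrightarrow> 0 < L' x) \<Longrightarrow> L p = 0 \<Longrightarrow> L p' = \<sigma> \<Longrightarrow>
       (\<And>x. x \<in> {z1..z2} \<Longrightarrow> \<bar>L'' x / L' x - A x\<bar> \<le> \<eta>) \<Longrightarrow>
       (\<And>x. x \<in> {z1..z2} \<Longrightarrow> \<bar>L' x - H' x\<bar> \<le> M * (exp (\<eta> * (z2 - z1)) - 1)
          \<and> \<bar>L x - H x\<bar> \<le> (z2 - z1) * (M * (exp (\<eta> * (z2 - z1)) - 1)))"
proof -
  let ?Z = "{z1..z2}"
  have pp: "p \<noteq> p'" using p(3) by auto
  obtain G where G: "\<And>x. x \<in> ?Z \<Longrightarrow> (G has_real_derivative A x) (at x within ?Z)"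
    using antiderivative_continuous[OF A] by (metis has_real_derivative_iff_has_vector_derivative)
  have cG: "continuous_on ?Z G" using G by (rule DERIV_continuous_on)
  obtain H0 where H0: "\<And>x. x \<in> ?Z \<Longrightarrow> (H0 has_real_derivative exp (G x)) (at x within ?Z)"
    using antiderivative_continuous[OF continuous_on_exp[OF cG]]
    by (metis has_real_derivative_iff_has_vector_derivative)
  have pos: "0 < \<sigma> * (H0 p' - H0 p)"
  proof -
    have inc: "H0 x < H0 y" if "x \<in> ?Z" "y \<in> ?Z" "x < y" for x y
      using mvt_within[OF H0, of x y] that by (metis atLeastAtMost_iff atLeastatMost_subset_iff diff_gt_0_iff_gt exp_gt_zero mult_pos_pos order.strict_implies_order)
    show ?thesis
      using p(3) inc[OF p(1,2)] inc[OF p(2,1)] by (cases "p < p'") (auto simp: zero_less_mult_iff)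
  qed
  \<comment> \<open>Fixed by the normalisation \<open>H p' = \<sigma>\<close>; it is positive
    because \<open>p' - p\<close> has the sign of \<sigma>.\<close>
  define c where "c = \<sigma> / (H0 p' - H0 p)"
  have ne: "H0 p' - H0 p \<noteq> 0" using pos by auto
  have c: "0 < c"
    using pos by (auto simp: c_def zero_less_divide_iff zero_less_mult_iff)
  define H where "H x = c * (H0 x - H0 p)" for x
  define H' where "H' x = c * exp (G x)" for x
  have dH: "(H has_real_derivative H' x) (at x within ?Z)" if "x \<in> ?Z" for x
    unfolding H_def[abs_def] H'_def using H0[OF that] by (auto intro!: derivative_eq_intros)
  have H'pos: "0 < H' x" for x using c by (simp add: H'_def)
  have cH': "continuous_on ?Z H'" unfolding H'_def by (intro continuous_intros cG)
  obtain M where M: "\<And>x. x \<in> ?Z \<Longrightarrow> \<bar>H' x\<bar> \<le> M" using continuous_on_Icc_bounded[OF cH'] by blast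
  have Hp: "H p = 0" "H p' = \<sigma>" using ne by (simp_all add: H_def c_def)
  have lnH: "ln (H' x) = ln c + G x" for x using c by (simp add: H'_def ln_mult)
  show thesis
  proof (rule that[OF dH cH' H'pos])
    fix L L' L'' \<eta> x
    assume L: "c2 ?Z L L' L''" and L': "\<And>x. x \<in> ?Z \<Longrightarrow> 0 < L' x" and Lp: "L p = 0" "L p' = \<sigma>"
      and \<eta>: "\<And>x. x \<in> ?Z \<Longrightarrow> \<bar>L'' x / L' x - A x\<bar> \<le> \<eta>" and x: "x \<in> ?Z"
    have \<eta>0: "0 \<le> \<eta>" using \<eta>[OF x] by linarith
    have dLH: "((\<lambda>x. L x - H x) has_real_derivative L' x - H' x) (at x within ?Z)" if "x \<in> ?Z" for x
      using DERIV_diff[OF c2D(1)[OF L that] dH[OF that]] .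
    \<comment> \<open>\<open>L\<close> and \<open>H\<close> have the same values at \<open>p\<close>
      and \<open>p'\<close>, so their derivatives agree somewhere in between. From there the
      logarithm of \<open>L' / H'\<close> moves only by the integrated difference of the
      nonlinearities.\<close>
    have "\<exists>z\<in>?Z. L' z = H' z"
    proof -
      have "\<exists>z\<in>?Z. L' z = H' z" if "u \<in> ?Z" "v \<in> ?Z" "u < v" "L u = H u" "L v = H v" for u v
      proof -
        obtain z where z: "u < z" "z < v" "L v - H v - (L u - H u) = (L' z - H' z) * (v - u)"
          using mvt_within[OF dLH, of u v] \<open>u \<in> ?Z\<close> \<open>v \<in> ?Z\<close> \<open>u < v\<close> by auto
        then show ?thesis using that by (intro bexI[of _ z]) auto
      qed
      from this[of p p'] this[of p' p] p Lp Hp pp show ?thesis by (metis linorder_neq_iff)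
    qed
    then obtain z where z: "z \<in> ?Z" "L' z = H' z" by blast
    define r where "r y = ln (L' y) - ln (H' y)" for y
    have dr: "(r has_real_derivative L'' y / L' y - A y) (at y within ?Z)" if "y \<in> ?Z" for y
      unfolding r_def[abs_def] lnH using c2D(2)[OF L that] L'[OF that] G[OF that]
      by (auto intro!: derivative_eq_intros)
    have rb: "\<bar>r y\<bar> \<le> \<eta> * (z2 - z1)" if y: "y \<in> ?Z" for y
    proof -
      have 1: "\<bar>r v - r u\<bar> \<le> \<eta> * (z2 - z1)" if uv: "u \<in> ?Z" "v \<in> ?Z" "u < v" for u v
      proof -
        obtain w where w: "u < w" "w < v" "r v - r u = (L'' w / L' w - A w) * (v - u)"
          using mvt_within[OF dr, of u v] uv by auto
        then show ?thesis
          unfolding w(3) abs_mult using \<eta>[of w] \<eta>0 uv by (intro mult_mono) auto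
      qed
      have "r z = 0" using z by (simp add: r_def)
      with 1[OF y z(1)] 1[OF z(1) y] \<eta>0 y show ?thesis
        by (cases y z rule: linorder_cases) auto
    qed
    have L'b: "\<bar>L' y - H' y\<bar> \<le> M * (exp (\<eta> * (z2 - z1)) - 1)" if y: "y \<in> ?Z" for y
    proof -
      have "L' y = H' y * exp (r y)" using L'[OF y] H'pos[of y] by (simp add: r_def exp_diff)
      then have "\<bar>L' y - H' y\<bar> = \<bar>H' y\<bar> * \<bar>exp (r y) - 1\<bar>"
        by (simp add: abs_mult[symmetric] algebra_simps)
      also have "\<dots> \<le> M * (exp (\<eta> * (z2 - z1)) - 1)"
        using abs_exp_minus_1_le[of "r y"] rb[OF y] M[OF y] by (intro mult_mono) (auto intro: order_trans)
      finally show ?thesis .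
    qed
    have "\<bar>L x - H x\<bar> \<le> (z2 - z1) * (M * (exp (\<eta> * (z2 - z1)) - 1))"
    proof -
      have 1: "\<bar>(L v - H v) - (L u - H u)\<bar> \<le> (z2 - z1) * (M * (exp (\<eta> * (z2 - z1)) - 1))"
        if uv: "u \<in> ?Z" "v \<in> ?Z" "u < v" for u v
      proof -
        obtain w where w: "u < w" "w < v" "L v - H v - (L u - H u) = (L' w - H' w) * (v - u)"
          using mvt_within[OF dLH, of u v] uv by auto
        have "\<bar>L' w - H' w\<bar> * \<bar>v - u\<bar> \<le> (M * (exp (\<eta> * (z2 - z1)) - 1)) * (z2 - z1)"
          using L'b[of w] uv w by (intro mult_mono) (auto intro: order_trans[OF abs_ge_zero])
        then show ?thesis unfolding w(3) abs_mult by (simp add: mult.commute)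
      qed
      have nn: "0 \<le> (z2 - z1) * (M * (exp (\<eta> * (z2 - z1)) - 1))"
        using x by (intro mult_nonneg_nonneg[OF _ order_trans[OF abs_ge_zero L'b[OF x]]]) auto
      show ?thesis
        using 1[OF x p(1)] 1[OF p(1) x] Lp Hp nn by (cases x p rule: linorder_cases) auto
    qed
    with L'b[OF x] show "\<bar>L' x - H' x\<bar> \<le> M * (exp (\<eta> * (z2 - z1)) - 1)
          \<and> \<bar>L x - H x\<bar> \<le> (z2 - z1) * (M * (exp (\<eta> * (z2 - z1)) - 1))" by simp
  qed
qed

text \<open>The functional equation differentiated twice. It expresses \<open>F''\<close> through
  the values of \<open>L'\<close> and \<open>L'' / L'\<close> at \<open>x\<close> and
  \<open>F x\<close>, so control of these quantities gives \<open>C^2\<close> control of the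
  map.\<close>

lemma coordinate_deriv:
  assumes L: "c2 {a<..<b} L L' L''" and L': "\<And>x. x \<in> {a<..<b} \<Longrightarrow> 0 < L' x"
    and F: "diffeo a b F F' F''" and LF: "\<And>x. x \<in> {a<..<b} \<Longrightarrow> L (F x) = L x + \<sigma>" and x: "x \<in> {a<..<b}"
  shows "F' x = L' x / L' (F x)" "F'' x = F' x * (L'' x / L' x - L'' (F x) / L' (F x) * F' x)"
proof -
  have FI: "F ` {a<..<b} \<subseteq> {a<..<b}" using diffeo_interval(2)[OF F] by blast
  have cF: "c2 {a<..<b} F F' F''" by (rule c2_subset[OF diffeo_c2[OF F]]) auto
  have c1: "c2 {a<..<b} (\<lambda>x. L x + \<sigma>) L' L''" using c2_add[OF L c2_const] by simp
  note eq = c2_unique_open[OF c2_compose[OF cF L FI] c1 open_greaterThanLessThan LF x]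
  have ne: "L' (F x) \<noteq> 0" "L' x \<noteq> 0" using L'[OF subsetD[OF FI imageI[OF x]]] L'[OF x] by auto
  then show 1: "F' x = L' x / L' (F x)" using eq(1) by (simp add: field_simps)
  have "F'' x = (L'' x - L'' (F x) * (F' x)\<^sup>2) / L' (F x)" using eq(2) ne by (simp add: field_simps)
  also have "\<dots> = F' x * (L'' x / L' x - L'' (F x) / L' (F x) * F' x)"
    unfolding 1 using ne by (simp add: field_simps power2_eq_square)
  finally show "F'' x = F' x * (L'' x / L' x - L'' (F x) / L' (F x) * F' x)" .
qed

lemma uniform_limit_compose_both:
  fixes u :: "nat \<Rightarrow> real \<Rightarrow> real" and g :: "nat \<Rightarrow> real \<Rightarrow> real"
  assumes u: "uniform_limit Z u v sequentially" and g: "uniform_limit W g f sequentially"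
    and v: "uniformly_continuous_on Z v"
    and Z: "\<And>n x. x \<in> W \<Longrightarrow> g n x \<in> Z" "\<And>x. x \<in> W \<Longrightarrow> f x \<in> Z"
  shows "uniform_limit W (\<lambda>n x. u n (g n x)) (\<lambda>x. v (f x)) sequentially"
proof (rule uniform_limitI)
  fix e :: real assume e: "0 < e"
  obtain d where d: "0 < d" "\<And>x y. x \<in> Z \<Longrightarrow> y \<in> Z \<Longrightarrow> dist x y < d \<Longrightarrow> dist (v x) (v y) < e / 2"
    using v e unfolding uniformly_continuous_on_def by (metis half_gt_zero dist_commute)
  show "\<forall>\<^sub>F n in sequentially. \<forall>x\<in>W. dist (u n (g n x)) (v (f x)) < e"
    using uniform_limitD[OF u half_gt_zero[OF e]] uniform_limitD[OF g d(1)]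
  proof eventually_elim
    case (elim n)
    show ?case
    proof
      fix x assume x: "x \<in> W"
      have "dist (u n (g n x)) (v (g n x)) < e / 2" using elim(1) Z(1)[OF x] by blast
      moreover have "dist (v (g n x)) (v (f x)) < e / 2" using d(2) Z x elim(2) by blast
      ultimately show "dist (u n (g n x)) (v (f x)) < e"
        using dist_triangle[of "u n (g n x)" "v (f x)" "v (g n x)"] by linarith
    qed
  qed
qed

section \<open>Blending the two ends\<close>

lemma uniform_limit_boundI:
  fixes u :: "nat \<Rightarrow> real \<Rightarrow> real"
  assumes "\<And>n x. x \<in> Z \<Longrightarrow> \<bar>u n x - v x\<bar> \<le> c n" "c \<longlonglongrightarrow> 0"
  shows "uniform_limit Z u v sequentially"
proof (rule uniform_limitI)
  fix e :: real assume "0 < e"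
  with assms(2) have "\<forall>\<^sub>F n in sequentially. c n < e" by (intro order_tendstoD(2)) auto
  then show "\<forall>\<^sub>F n in sequentially. \<forall>x\<in>Z. dist (u n x) (v x) < e"
  proof eventually_elim
    case (elim n)
    then show ?case using assms(1)[of _ n] by (fastforce simp: dist_real_def intro: le_less_trans)
  qed
qed

lemma bounded_image_Icc:
  fixes v :: "real \<Rightarrow> real"
  shows "continuous_on {a..b} v \<Longrightarrow> bounded (v ` {a..b})"
  by (intro compact_imp_bounded compact_continuous_image) auto

definition "blend c p L R x = L x + cutoff (c * (x - p)) * (R x - L x)"

definition "blend' c p L L' R R' x = L' x + (cutoff' (c * (x - p)) * c * (R x - L x)
  + cutoff (c * (x - p)) * (R' x - L' x))"

definition "blend'' c p L L' L'' R R' R'' x = L'' x + (cutoff'' (c * (x - p)) * c\<^sup>2 * (R x - L x)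
  + 2 * (cutoff' (c * (x - p)) * c) * (R' x - L' x) + cutoff (c * (x - p)) * (R'' x - L'' x))"

lemma c2_scaled_cutoff:
  "c2 S (\<lambda>x. cutoff (c * (x - p))) (\<lambda>x. cutoff' (c * (x - p)) * c) (\<lambda>x. cutoff'' (c * (x - p)) * c\<^sup>2)"
proof -
  have "c2 S (\<lambda>x. c * (x - p)) (\<lambda>x. c * (1 - 0)) (\<lambda>x. c * (0 - 0))"
    by (intro c2_cmult c2_diff c2_id c2_const)
  from c2_compose[OF this c2_cutoff] show ?thesis by simp
qed

lemma c2_blend:
  assumes "c2 S L L' L''" "c2 S R R' R''"
  shows "c2 S (blend c p L R) (blend' c p L L' R R') (blend'' c p L L' L'' R R' R'')"
  unfolding blend_def[abs_def] blend'_def[abs_def] blend''_def[abs_def]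
  by (intro c2_add[OF assms(1)] c2_mult[OF c2_scaled_cutoff] c2_diff assms)

lemma blend_left:
  assumes "0 < c" "x \<le> p"
  shows "blend c p L R x = L x" "blend' c p L L' R R' x = L' x" "blend'' c p L L' L'' R R' R'' x = L'' x"
proof -
  have "c * (x - p) \<le> 0" using assms by (simp add: mult_nonneg_nonpos)
  then show "blend c p L R x = L x" "blend' c p L L' R R' x = L' x" "blend'' c p L L' L'' R R' R'' x = L'' x"
    by (simp_all add: blend_def blend'_def blend''_def cutoff_left)
qed

lemma blend_right:
  assumes "0 < c" "p + 3 / c \<le> x"
  shows "blend c p L R x = R x" "blend' c p L L' R R' x = R' x" "blend'' c p L L' L'' R R' R'' x = R'' x"
proof -
  have "3 \<le> c * (x - p)" using assms by (simp add: field_simps)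
  then show "blend c p L R x = R x" "blend' c p L L' R R' x = R' x" "blend'' c p L L' L'' R R' R'' x = R'' x"
    by (simp_all add: blend_def blend'_def blend''_def cutoff_right)
qed

lemma uniform_limit_mult_zero:
  fixes u :: "nat \<Rightarrow> real \<Rightarrow> real"
  assumes "uniform_limit {a..b} u (\<lambda>_. 0) sequentially" "continuous_on {a..b} v"
  shows "uniform_limit {a..b} (\<lambda>n x. v x * u n x) (\<lambda>_. 0) sequentially"
  using uniform_lim_mult[OF uniform_limit_const assms(1) bounded_image_Icc[OF assms(2)]
    bounded_image_Icc[OF continuous_on_const]] by simp

text \<open>Every correction term is a fixed function, from the cutoff or its derivatives, times a
  difference that tends to 0 uniformly because the left and right sequences have a common
  limit.\<close>

lemma blend_limit:
  fixes L L' L'' R R' R'' :: "nat \<Rightarrow> real \<Rightarrow> real"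
  assumes "uniform_limit {a..b} L H sequentially" "uniform_limit {a..b} R H sequentially"
    and "uniform_limit {a..b} L' H' sequentially" "uniform_limit {a..b} R' H' sequentially"
    and "uniform_limit {a..b} L'' H'' sequentially" "uniform_limit {a..b} R'' H'' sequentially"
  shows "uniform_limit {a..b} (\<lambda>n. blend c p (L n) (R n)) H sequentially"
    and "uniform_limit {a..b} (\<lambda>n. blend' c p (L n) (L' n) (R n) (R' n)) H' sequentially"
    and "uniform_limit {a..b} (\<lambda>n. blend'' c p (L n) (L' n) (L'' n) (R n) (R' n) (R'' n)) H'' sequentially"
proof -
  have diff: "uniform_limit {a..b} (\<lambda>n x. v n x - u n x) (\<lambda>x. 0) sequentially"
    if "uniform_limit {a..b} u h sequentially" "uniform_limit {a..b} v h sequentially" for u v :: "nat \<Rightarrow> real \<Rightarrow> real" and h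
    using uniform_limit_minus[OF that(2,1)] by simp
  have cont: "continuous_on {a..b} (\<lambda>x. cutoff (c * (x - p)))"
    "continuous_on {a..b} (\<lambda>x. cutoff' (c * (x - p)) * c)"
    "continuous_on {a..b} (\<lambda>x. cutoff'' (c * (x - p)) * c\<^sup>2)"
    using c2D(3-5)[OF c2_scaled_cutoff[of "{a..b}" c p]] by blast+
  note m = uniform_limit_mult_zero[OF diff]
  show "uniform_limit {a..b} (\<lambda>n. blend c p (L n) (R n)) H sequentially"
    unfolding blend_def[abs_def]
    using uniform_limit_add[OF assms(1) m[OF assms(1,2) cont(1)]] by simp
  show "uniform_limit {a..b} (\<lambda>n. blend' c p (L n) (L' n) (R n) (R' n)) H' sequentially"
    unfolding blend'_def[abs_def]
    using uniform_limit_add[OF assms(3) uniform_limit_add[OF m[OF assms(1,2) cont(2)] m[OF assms(3,4) cont(1)]]] by simp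
  show "uniform_limit {a..b} (\<lambda>n. blend'' c p (L n) (L' n) (L'' n) (R n) (R' n) (R'' n)) H'' sequentially"
    unfolding blend''_def[abs_def]
    using uniform_limit_add[OF assms(5) uniform_limit_add[OF uniform_limit_add[OF m[OF assms(1,2) cont(3)]
      m[OF assms(3,4) continuous_on_mult[OF continuous_on_const[of _ 2] cont(2)]]] m[OF assms(5,6) cont(1)]]] by simp
qed

text \<open>Blending a coordinate \<open>L\<close> adapted to the left end with a coordinate \<open>R\<close> adapted to the right end
  perturbs \<open>f\<close> little on the compact window \<open>{w1..w2}\<close>, since \<open>L\<close> and \<open>R\<close> converge to the same limit.\<close>

lemma blend_close:
  fixes L L' L'' R R' R'' :: "nat \<Rightarrow> real \<Rightarrow> real" and c q :: real
  assumes A: "continuous_on {z1..z2} A" and w: "w1 \<le> w2" "z1 < w1" "w2 < z2" and p: "p \<in> {w1..w2}"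
    and f: "\<And>x. x \<in> {w1..w2} \<Longrightarrow> f x \<in> {fl..fu}" "z1 < fl" "fu < z2" "continuous_on {w1..w2} f"
    and f': "continuous_on {w1..w2} f'"
    and \<sigma>: "0 < \<sigma> * (f p - p)"
    and L: "\<And>n. c2 {z1..z2} (L n) (L' n) (L'' n)" "\<And>n x. x \<in> {z1..z2} \<Longrightarrow> 0 < L' n x" "\<And>n. L n p = 0"
      "\<And>n x. x \<in> {w1..w2} \<Longrightarrow> L n (f x) = L n x + \<sigma>"
      "\<And>n x. x \<in> {z1..z2} \<Longrightarrow> \<bar>L'' n x / L' n x - A x\<bar> \<le> 1 / real (Suc n)"
    and R: "\<And>n. c2 {z1..z2} (R n) (R' n) (R'' n)" "\<And>n x. x \<in> {z1..z2} \<Longrightarrow> 0 < R' n x" "\<And>n. R n p = 0"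
      "\<And>n x. x \<in> {w1..w2} \<Longrightarrow> R n (f x) = R n x + \<sigma>"
      "\<And>n x. x \<in> {z1..z2} \<Longrightarrow> \<bar>R'' n x / R' n x - A x\<bar> \<le> 1 / real (Suc n)"
    and fL: "\<And>n x. x \<in> {w1..w2} \<Longrightarrow> f' x = L' n x / L' n (f x)
      \<and> f'' x = f' x * (L'' n x / L' n x - L'' n (f x) / L' n (f x) * f' x)"
    and \<delta>: "0 < \<delta>"
  defines "K \<equiv> \<lambda>n. blend c q (L n) (R n)" and "K' \<equiv> \<lambda>n. blend' c q (L n) (L' n) (R n) (R' n)"
    and "K'' \<equiv> \<lambda>n. blend'' c q (L n) (L' n) (L'' n) (R n) (R' n) (R'' n)"
  obtains n where "\<And>x. x \<in> {z1..z2} \<Longrightarrow> 0 < K' n x"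
    "\<And>x. x \<in> {w1..w2} \<Longrightarrow> K n z1 < K n x + \<sigma> \<and> K n x + \<sigma> < K n z2"
    "\<And>x y. x \<in> {w1..w2} \<Longrightarrow> y \<in> {z1..z2} \<Longrightarrow> K n y = K n x + \<sigma> \<Longrightarrow>
       \<bar>(K' n x / K' n y) * (K'' n x / K' n x - K'' n y / K' n y * (K' n x / K' n y)) - f'' x\<bar> \<le> \<delta>"
proof -
  let ?Z = "{z1..z2}" and ?W = "{w1..w2}"
  have WZ: "?W \<subseteq> ?Z" using w by auto
  have fZ: "f x \<in> ?Z" if "x \<in> ?W" for x using f(1)[OF that] f(2,3) by auto
  have zz: "z1 < z2" using w by linarith
  obtain H H' M where H: "\<And>x. x \<in> ?Z \<Longrightarrow> (H has_real_derivative H' x) (at x within ?Z)"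
    "continuous_on ?Z H'" "\<And>x. x \<in> ?Z \<Longrightarrow> 0 < H' x"
    and Hlim: "\<And>L L' L'' \<eta> x. c2 ?Z L L' L'' \<Longrightarrow> (\<And>x. x \<in> ?Z \<Longrightarrow> 0 < L' x) \<Longrightarrow> L p = 0 \<Longrightarrow> L (f p) = \<sigma> \<Longrightarrow>
       (\<And>x. x \<in> ?Z \<Longrightarrow> \<bar>L'' x / L' x - A x\<bar> \<le> \<eta>) \<Longrightarrow> x \<in> ?Z \<Longrightarrow>
       \<bar>L' x - H' x\<bar> \<le> M * (exp (\<eta> * (z2 - z1)) - 1) \<and> \<bar>L x - H x\<bar> \<le> (z2 - z1) * (M * (exp (\<eta> * (z2 - z1)) - 1))"
  proof (rule coordinate_limit[OF A subsetD[OF WZ p] fZ[OF p] \<sigma>], goal_cases)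
    case (1 H H' M)
    show ?case by (rule 1(1)[of H H' M, OF 1(2-4)], assumption+, rule 1(5), assumption+)
  qed
  define \<eta> where "\<eta> n = 1 / real (Suc n)" for n
  have \<eta>0: "\<eta> \<longlonglongrightarrow> 0" unfolding \<eta>_def by (rule LIMSEQ_Suc[OF lim_1_over_n])
  have b0: "(\<lambda>n. M * (exp (\<eta> n * (z2 - z1)) - 1)) \<longlonglongrightarrow> 0"
    using tendsto_mult[OF tendsto_const[of M] tendsto_diff[OF tendsto_exp[OF tendsto_mult[OF \<eta>0 tendsto_const[of "z2 - z1"]]] tendsto_const[of 1]]]
    by simp
  have b1: "(\<lambda>n. (z2 - z1) * (M * (exp (\<eta> n * (z2 - z1)) - 1))) \<longlonglongrightarrow> 0"
    using tendsto_mult[OF tendsto_const[of "z2 - z1"] b0] by simp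
  have lims: "uniform_limit ?Z l H sequentially" "uniform_limit ?Z l' H' sequentially"
    "uniform_limit ?Z l'' (\<lambda>x. A x * H' x) sequentially"
    if l: "\<And>n. c2 ?Z (l n) (l' n) (l'' n)" "\<And>n x. x \<in> ?Z \<Longrightarrow> 0 < l' n x" "\<And>n. l n p = 0"
      "\<And>n x. x \<in> ?W \<Longrightarrow> l n (f x) = l n x + \<sigma>" "\<And>n x. x \<in> ?Z \<Longrightarrow> \<bar>l'' n x / l' n x - A x\<bar> \<le> \<eta> n"
    for l l' l''
  proof -
    have lf: "l n (f p) = \<sigma>" for n using l(3,4) p by simp
    have b: "\<bar>l' n x - H' x\<bar> \<le> M * (exp (\<eta> n * (z2 - z1)) - 1) \<and>
        \<bar>l n x - H x\<bar> \<le> (z2 - z1) * (M * (exp (\<eta> n * (z2 - z1)) - 1))" if "x \<in> ?Z" for n x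
      using Hlim[OF l(1,2,3) lf l(5) that] by blast
    show "uniform_limit ?Z l H sequentially" by (rule uniform_limit_boundI[OF _ b1]) (use b in blast)
    show l': "uniform_limit ?Z l' H' sequentially" by (rule uniform_limit_boundI[OF _ b0]) (use b in blast)
    have "uniform_limit ?Z (\<lambda>n x. l'' n x / l' n x) A sequentially"
      by (rule uniform_limit_boundI[OF l(5) \<eta>0])
    from uniform_lim_mult[OF this l' bounded_image_Icc[OF A] bounded_image_Icc[OF H(2)]]
    show "uniform_limit ?Z l'' (\<lambda>x. A x * H' x) sequentially"
      by (rule uniform_limit_cong'[THEN iffD1, rotated -1]) (simp_all add: less_imp_neq[OF l(2), symmetric])
  qed
  note Llim = lims[OF L(1-4) L(5)[folded \<eta>_def]] and Rlim = lims[OF R(1-4) R(5)[folded \<eta>_def]]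
  have Klim: "uniform_limit ?Z K H sequentially" "uniform_limit ?Z K' H' sequentially"
    "uniform_limit ?Z K'' (\<lambda>x. A x * H' x) sequentially"
    unfolding K_def K'_def K''_def
    using blend_limit[OF Llim(1) Rlim(1) Llim(2) Rlim(2) Llim(3) Rlim(3)] by blast+
  obtain y0 where y0: "y0 \<in> ?Z" "\<And>x. x \<in> ?Z \<Longrightarrow> H' y0 \<le> H' x"
    using continuous_attains_inf[OF compact_Icc _ H(2)] zz by force
  define h where "h = H' y0"
  have h: "0 < h" "\<And>x. x \<in> ?Z \<Longrightarrow> h \<le> H' x" using y0 H(3) by (auto simp: h_def)
  have Hinc: "h * (y - x) \<le> H y - H x" if xy: "x \<in> ?Z" "y \<in> ?Z" "x \<le> y" for x y
  proof (cases "x = y")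
    case False
    then obtain z where "x < z" "z < y" "H y - H x = H' z * (y - x)"
      using mvt_within[OF H(1), of x y] xy False by auto
    then show ?thesis using h(2)[of z] xy by (auto intro: mult_right_mono)
  qed simp
  \<comment> \<open>Each relation between \<open>f\<close> and \<open>L n\<close> passes to the
    limit, so \<open>f\<close>, \<open>f'\<close> and \<open>f''\<close> are expressed by
    \<open>H\<close>, \<open>H'\<close> and \<open>A\<close>. The same expressions in
    \<open>K n\<close> will converge to them.\<close>
  have Hf: "H (f x) = H x + \<sigma>" if x: "x \<in> ?W" for x
  proof (rule LIMSEQ_unique)
    show "(\<lambda>n. L n (f x)) \<longlonglongrightarrow> H (f x)" using tendsto_uniform_limitI[OF Llim(1) fZ[OF x]] .
    have "(\<lambda>n. L n x + \<sigma>) \<longlonglongrightarrow> H x + \<sigma>"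
      using tendsto_uniform_limitI[OF Llim(1)] x WZ by (intro tendsto_intros) auto
    then show "(\<lambda>n. L n (f x)) \<longlonglongrightarrow> H x + \<sigma>" using L(4)[OF x] by simp
  qed
  have Ldivlim: "(\<lambda>n. L'' n x / L' n x) \<longlonglongrightarrow> A x" if "x \<in> ?Z" for x
    by (rule tendsto_uniform_limitI[OF uniform_limit_boundI[OF L(5)[folded \<eta>_def] \<eta>0] that])
  have f'H: "f' x = H' x / H' (f x)" if x: "x \<in> ?W" for x
  proof (rule LIMSEQ_unique)
    show "(\<lambda>n. L' n x / L' n (f x)) \<longlonglongrightarrow> H' x / H' (f x)"
      using less_imp_neq[OF H(3)[OF fZ[OF x]], symmetric]
      by (intro tendsto_divide tendsto_uniform_limitI[OF Llim(2)] subsetD[OF WZ x] fZ[OF x])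
    show "(\<lambda>n. L' n x / L' n (f x)) \<longlonglongrightarrow> f' x" using fL[OF x] by simp
  qed
  have f''H: "f'' x = f' x * (A x - A (f x) * f' x)" if x: "x \<in> ?W" for x
  proof (rule LIMSEQ_unique)
    show "(\<lambda>n. f' x * (L'' n x / L' n x - L'' n (f x) / L' n (f x) * f' x)) \<longlonglongrightarrow> f' x * (A x - A (f x) * f' x)"
      by (intro tendsto_mult tendsto_diff tendsto_const Ldivlim subsetD[OF WZ x] fZ[OF x])
    show "(\<lambda>n. f' x * (L'' n x / L' n x - L'' n (f x) / L' n (f x) * f' x)) \<longlonglongrightarrow> f'' x"
      using fL[OF x] by simp
  qed
  \<comment> \<open>An error below \<open>h / 2\<close> keeps \<open>K' n\<close> positive. A third
    of the margins leaves room for the errors of \<open>K n\<close> at \<open>x\<close> and at an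
    end of \<open>?Z\<close>.\<close>
  define \<rho> where "\<rho> = min (h / 2) (min (h * (fl - z1)) (h * (z2 - fu)) / 3)"
  have \<rho>: "0 < \<rho>" "\<rho> \<le> h / 2" "3 * \<rho> \<le> h * (fl - z1)" "3 * \<rho> \<le> h * (z2 - fu)"
    using h f(2,3) by (auto simp: \<rho>_def)
  have "\<forall>\<^sub>F n in sequentially. (\<forall>x\<in>?Z. dist (K n x) (H x) < \<rho>) \<and> (\<forall>x\<in>?Z. dist (K' n x) (H' x) < \<rho>)"
    using uniform_limitD[OF Klim(1) \<rho>(1)] uniform_limitD[OF Klim(2) \<rho>(1)] by eventually_elim simp
  then obtain N where N: "\<And>n x. N \<le> n \<Longrightarrow> x \<in> ?Z \<Longrightarrow> \<bar>K n x - H x\<bar> < \<rho> \<and> \<bar>K' n x - H' x\<bar> < \<rho>"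
    unfolding eventually_sequentially dist_real_def by blast
  have K'pos: "h / 2 \<le> K' n x" if "N \<le> n" "x \<in> ?Z" for n x
    using N[OF that] h(2)[OF that(2)] \<rho> by linarith
  have z12: "z1 \<in> ?Z" "z2 \<in> ?Z" using zz by auto
  have Kbds: "K n z1 < K n x + \<sigma> \<and> K n x + \<sigma> < K n z2" if n: "N \<le> n" and x: "x \<in> ?W" for n x
  proof -
    have xZ: "x \<in> ?Z" using x WZ by blast
    have "h * (fl - z1) \<le> h * (f x - z1)" "h * (z2 - fu) \<le> h * (z2 - f x)"
      using f(1)[OF x] h by (auto intro!: mult_left_mono)
    moreover have "h * (f x - z1) \<le> H (f x) - H z1" "h * (z2 - f x) \<le> H z2 - H (f x)"
      using Hinc[OF z12(1) fZ[OF x]] Hinc[OF fZ[OF x] z12(2)] fZ[OF x] by auto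
    ultimately show ?thesis
      using N[OF n xZ] N[OF n z12(1)] N[OF n z12(2)] Hf[OF x] \<rho> by linarith
  qed
  have cK: "c2 ?Z (K n) (K' n) (K'' n)" for n
    unfolding K_def K'_def K''_def by (rule c2_blend[OF L(1) R(1)])
  have ex: "\<exists>y\<in>?Z. K n y = K n x + \<sigma>" if "N \<le> n" "x \<in> ?W" for n x
    using IVT'[of "K n" z1 "K n x + \<sigma>" z2] Kbds[OF that] c2D(5)[OF cK[of n]] zz by fastforce
  \<comment> \<open>The point to which translation by \<sigma> in the coordinate \<open>K n\<close>
    sends \<open>x\<close>. For small \<open>n\<close> it is set to \<open>f x\<close>, so that it
    lies in \<open>?Z\<close> for every \<open>n\<close>.\<close>
  define g where "g n x = (if N \<le> n then SOME y. y \<in> ?Z \<and> K n y = K n x + \<sigma> else f x)" for n x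
  have g: "g n x \<in> ?Z \<and> K n (g n x) = K n x + \<sigma>" if "N \<le> n" "x \<in> ?W" for n x
    using someI_ex[OF ex[OF that, unfolded Bex_def]] that(1) by (simp only: g_def if_True)
  have gZ: "g n x \<in> ?Z" if "x \<in> ?W" for n x
    using g[OF _ that] fZ[OF that] by (cases "N \<le> n") (auto simp: g_def)
  have glim: "uniform_limit ?W g f sequentially"
  proof (rule uniform_limitI)
    fix e :: real assume e: "0 < e"
    have "0 < h * e / 2" using mult_pos_pos[OF h(1) e] by simp
    from uniform_limitD[OF Klim(1) this] eventually_ge_at_top[of N]
    show "\<forall>\<^sub>F n in sequentially. \<forall>x\<in>?W. dist (g n x) (f x) < e"
    proof eventually_elim
      case (elim n)
      show ?case
      proof
        fix x assume x: "x \<in> ?W"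
        have xZ: "x \<in> ?Z" using x WZ by blast
        have gx: "g n x \<in> ?Z" "K n (g n x) = K n x + \<sigma>" using g[OF elim(2) x] by auto
        have "\<bar>H (g n x) - H (f x)\<bar> < h * e"
          using elim(1)[rule_format, OF xZ] elim(1)[rule_format, OF gx(1)] gx(2) Hf[OF x]
          unfolding dist_real_def by linarith
        moreover have "h * \<bar>g n x - f x\<bar> \<le> \<bar>H (g n x) - H (f x)\<bar>"
          using Hinc[OF gx(1) fZ[OF x]] Hinc[OF fZ[OF x] gx(1)] h(1)
          by (cases "g n x \<le> f x") auto
        ultimately have "h * \<bar>g n x - f x\<bar> < h * e" by linarith
        then show "dist (g n x) (f x) < e" using h(1) by (simp add: dist_real_def)
      qed
    qed
  qed
  have hn: "h \<le> norm (H' x)" if "x \<in> ?Z" for x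
    using order_trans[OF h(2)[OF that] abs_ge_self] by simp
  have klim: "uniform_limit ?Z (\<lambda>n x. K'' n x / K' n x) A sequentially"
  proof -
    have "uniform_limit ?Z (\<lambda>n x. K'' n x / K' n x) (\<lambda>x. A x * H' x / H' x) sequentially"
      by (rule uniform_lim_divide[OF Klim(3,2) bounded_image_Icc[OF continuous_on_mult[OF A H(2)]] hn h(1)])
    then show ?thesis
      by (rule uniform_limit_cong'[THEN iffD1, rotated -1]) (simp_all add: less_imp_neq[OF H(3), symmetric])
  qed
  have uc: "uniformly_continuous_on ?Z v" if "continuous_on ?Z v" for v :: "real \<Rightarrow> real"
    using that by (simp add: compact_uniformly_continuous)
  have sub: "uniform_limit ?W u v sequentially" if "uniform_limit ?Z u v sequentially" for u and v :: "real \<Rightarrow> real"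
    using that WZ by (rule uniform_limit_on_subset)
  have cfA: "continuous_on ?W (\<lambda>x. A (f x))" "continuous_on ?W A"
    using continuous_on_compose2[OF A f(4)] fZ continuous_on_subset[OF A WZ] by blast+
  have g'lim: "uniform_limit ?W (\<lambda>n x. K' n x / K' n (g n x)) f' sequentially"
  proof -
    have "uniform_limit ?W (\<lambda>n x. K' n x / K' n (g n x)) (\<lambda>x. H' x / H' (f x)) sequentially"
      by (rule uniform_lim_divide[OF sub[OF Klim(2)] uniform_limit_compose_both[OF Klim(2) glim uc[OF H(2)] gZ fZ]
        bounded_image_Icc[OF continuous_on_subset[OF H(2) WZ]] hn[OF fZ] h(1)])
    then show ?thesis
      by (rule uniform_limit_cong'[THEN iffD1, rotated -1]) (use f'H in auto)
  qed
  have kg: "uniform_limit ?W (\<lambda>n x. K'' n (g n x) / K' n (g n x)) (\<lambda>x. A (f x)) sequentially"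
    by (rule uniform_limit_compose_both[OF klim glim uc[OF A] gZ fZ])
  have "uniform_limit ?W (\<lambda>n x. (K' n x / K' n (g n x)) *
      (K'' n x / K' n x - K'' n (g n x) / K' n (g n x) * (K' n x / K' n (g n x))))
      (\<lambda>x. f' x * (A x - A (f x) * f' x)) sequentially"
    by (intro uniform_lim_mult uniform_limit_minus g'lim kg sub[OF klim] bounded_image_Icc f' cfA continuous_intros)
  from uniform_limitD[OF this \<delta>] have "\<forall>\<^sub>F n in sequentially. \<forall>x\<in>?W. dist ((K' n x / K' n (g n x)) *
      (K'' n x / K' n x - K'' n (g n x) / K' n (g n x) * (K' n x / K' n (g n x)))) (f' x * (A x - A (f x) * f' x)) < \<delta>" .
  then have "\<forall>\<^sub>F n in sequentially. N \<le> n \<and> (\<forall>x\<in>?W. dist ((K' n x / K' n (g n x)) *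
      (K'' n x / K' n x - K'' n (g n x) / K' n (g n x) * (K' n x / K' n (g n x)))) (f' x * (A x - A (f x) * f' x)) < \<delta>)"
    using eventually_ge_at_top[of N] by eventually_elim simp
  then obtain n where n: "N \<le> n" and close: "\<And>x. x \<in> ?W \<Longrightarrow> dist ((K' n x / K' n (g n x)) *
      (K'' n x / K' n x - K'' n (g n x) / K' n (g n x) * (K' n x / K' n (g n x)))) (f' x * (A x - A (f x) * f' x)) < \<delta>"
    unfolding eventually_sequentially by blast
  show thesis
  proof (rule that[of n])
    show "0 < K' n x" if "x \<in> ?Z" for x using K'pos[OF n that] h by simp
    show "K n z1 < K n x + \<sigma> \<and> K n x + \<sigma> < K n z2" if "x \<in> ?W" for x using Kbds[OF n that] .
    fix x y assume x: "x \<in> ?W" and y: "y \<in> ?Z" "K n y = K n x + \<sigma>"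
    have inj: "K n u < K n v" if uv: "u \<in> ?Z" "v \<in> ?Z" "u < v" for u v
    proof -
      obtain z where z: "u < z" "z < v" "K n v - K n u = K' n z * (v - u)"
        using mvt_within[OF c2D(1)[OF cK], of u v n] uv by auto
      have "0 < K' n z" using K'pos[OF n, of z] h z uv by auto
      with z(3) uv have "0 < K n v - K n u" by simp
      then show ?thesis by simp
    qed
    have "y = g n x"
      using inj[OF y(1) gZ[OF x, of n]] inj[OF gZ[OF x, of n] y(1)] y(2) g[OF n x]
      by (cases y "g n x" rule: linorder_cases) auto
    with close[OF x] show "\<bar>(K' n x / K' n y) * (K'' n x / K' n x - K'' n y / K' n y * (K' n x / K' n y)) - f'' x\<bar> \<le> \<delta>"
      unfolding f''H[OF x] dist_real_def by simp
  qed
qed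

section \<open>Perturbation on a single component\<close>

lemma inv_into_reflect:
  assumes f: "diffeo a b f f' f''" and ab: "a \<le> b" and x: "x \<in> {a..b}"
  shows "inv_into {a..b} (\<lambda>x. a + b - f (a + b - x)) x = a + b - inv_into {a..b} f (a + b - x)"
proof -
  let ?g = "inv_into {a..b} f" and ?fr = "\<lambda>x. a + b - f (a + b - x)"
  have rx: "a + b - x \<in> {a..b}" using x by auto
  have "?g (a + b - x) \<in> {a..b}" using diffeo_interval(1)[OF diffeo_inverse(1)[OF f ab] rx] .
  then have yI: "a + b - ?g (a + b - x) \<in> {a..b}" by auto
  have "?fr (a + b - ?g (a + b - x)) = x" using diffeo_inverse(2)[OF f ab rx] by simp
  with diffeo_inverse(3)[OF diffeo_reflect[OF f] ab yI] show ?thesis by simp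
qed

text \<open>Brings the equality of the two limits into the form in which \<open>right_end\<close>
  refers to its limit. The map attracting to \<open>a\<close> that belongs to the reflection of
  \<open>f\<close> and \<open>- \<sigma>\<close> is itself the reflection of the map that attracts
  to \<open>b\<close>, so \<open>two_sided\<close> applies.\<close>

lemma ends_agree:
  assumes V: "f \<in> Diff2_V" and I: "0 \<le> a" "b \<le> 1" and ab: "a < b" and fab: "f a = a" "f b = b"
    and \<sigma>: "\<sigma> = 1 \<or> \<sigma> = -1" and sgn: "\<And>x. x \<in> {a<..<b} \<Longrightarrow> 0 < \<sigma> * (f x - x)"
  defines "f' \<equiv> D1 f" and "f'' \<equiv> D2 f"
  defines "fr \<equiv> \<lambda>x. a + b - f (a + b - x)" and "fr' \<equiv> \<lambda>x. f' (a + b - x)" and "fr'' \<equiv> \<lambda>x. - f'' (a + b - x)"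
  shows "diffeo a b f f' f''" and "f' a = 1" "f' b = 1"
    and "x \<in> {a<..<b} \<Longrightarrow>
      lim_nonlin (towards a b (- \<sigma>) fr) (towards' a b (- \<sigma>) fr fr') (towards'' a b (- \<sigma>) fr fr' fr'') (a + b - x)
      = - lim_nonlin (towards a b \<sigma> f) (towards' a b \<sigma> f f') (towards'' a b \<sigma> f f' f'') x"
    and "continuous_on {a<..<b} (lim_nonlin (towards a b \<sigma> f) (towards' a b \<sigma> f f') (towards'' a b \<sigma> f f' f''))"
proof -
  have fD: "f \<in> Diff2" using V by (simp add: Diff2_V_def)
  have sub: "{a..b} \<subseteq> {0..1}" using I by auto
  show f: "diffeo a b f f' f''"
    using Diff2_dif[OF fD] sub fab c2_subset[OF _ sub] unfolding diffeo_def f'_def f''_def by auto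
  show par: "f' a = 1" "f' b = 1"
    using Diff2_V_parabolic[OF V _ fab(1)] Diff2_V_parabolic[OF V _ fab(2)] ab I by (auto simp: f'_def)
  have cf: "c2 {a..b} f f' f''" and f'_pos: "\<And>x. x \<in> {a..b} \<Longrightarrow> 0 < f' x" using f by (auto simp: diffeo_def)
  have nz: "f' x \<noteq> 0" if "x \<in> {a..b}" for x using f'_pos[OF that] by simp
  have "continuous_on {a..b} (\<lambda>x. f'' x / f' x)"
    using nz by (intro continuous_on_divide c2D(3,4)[OF cf]) blast
  then obtain M1 where M1: "\<And>x. x \<in> {a..b} \<Longrightarrow> \<bar>f'' x / f' x\<bar> \<le> M1"
    using continuous_on_Icc_bounded by blast
  have "continuous_on {a..b} (\<lambda>x. f'' x / (f' x)\<^sup>2)"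
    using nz by (intro continuous_on_divide continuous_on_power c2D(3,4)[OF cf]) simp
  then obtain M2 where M2: "\<And>x. x \<in> {a..b} \<Longrightarrow> \<bar>f'' x / (f' x)\<^sup>2\<bar> \<le> M2"
    using continuous_on_Icc_bounded by blast
  define B where "B = max M1 M2"
  have B: "\<bar>f'' x / f' x\<bar> \<le> B" "\<bar>f'' x / (f' x)\<^sup>2\<bar> \<le> B" if "x \<in> {a..b}" for x
    using M1[OF that] M2[OF that] by (simp_all add: B_def)
  let ?\<phi> = "towards a b \<sigma> f" and ?\<phi>' = "towards' a b \<sigma> f f'" and ?\<phi>'' = "towards'' a b \<sigma> f f' f''"
  let ?\<psi> = "towards a b (- \<sigma>) f" and ?\<psi>' = "towards' a b (- \<sigma>) f f'" and ?\<psi>'' = "towards'' a b (- \<sigma>) f f' f''"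
  have conL: "contraction a b ?\<phi> ?\<phi>' ?\<phi>'' B"
    by (rule contraction_towards[OF f ab par(1) \<sigma> sgn B])
  have rI: "a + b - x \<in> {a<..<b} \<longleftrightarrow> x \<in> {a<..<b}" "a + b - x \<in> {a..b} \<longleftrightarrow> x \<in> {a..b}" for x :: real by auto
  have fr: "diffeo a b fr fr' fr''" unfolding fr_def fr'_def fr''_def by (rule diffeo_reflect[OF f])
  have conR: "contraction a b (towards a b (- \<sigma>) fr) (towards' a b (- \<sigma>) fr fr') (towards'' a b (- \<sigma>) fr fr' fr'') B"
  proof (rule contraction_towards[OF fr ab])
    show "0 < - \<sigma> * (fr x - x)" if "x \<in> {a<..<b}" for x
      using sgn[of "a + b - x"] that by (simp add: fr_def algebra_simps)
    show "\<bar>fr'' x / fr' x\<bar> \<le> B" "\<bar>fr'' x / (fr' x)\<^sup>2\<bar> \<le> B" if "x \<in> {a..b}" for x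
      using B[of "a + b - x"] that by (auto simp: fr'_def fr''_def)
  qed (use par \<sigma> in \<open>auto simp: fr'_def\<close>)
  have eqR: "a + b - ?\<psi> (a + b - x) = towards a b (- \<sigma>) fr x \<and> ?\<psi>' (a + b - x) = towards' a b (- \<sigma>) fr fr' x
      \<and> - ?\<psi>'' (a + b - x) = towards'' a b (- \<sigma>) fr fr' fr'' x" if "x \<in> {a..b}" for x
    using \<sigma>
  proof
    assume "\<sigma> = 1"
    then show ?thesis by (simp add: towards_def towards'_def towards''_def fr_def fr'_def fr''_def)
  next
    assume "\<sigma> = -1"
    with inv_into_reflect[OF f less_imp_le[OF ab] that] show ?thesis
      by (simp add: towards_def towards'_def towards''_def fr_def fr'_def fr''_def)
  qed
  note conR' = contraction_cong[OF conR eqR]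
  have fr_inv: "f (inv_into {a..b} f y) = y" "inv_into {a..b} f (f y) = y" "inv_into {a..b} f y \<in> {a..b}"
    if "y \<in> {a..b}" for y
    using diffeo_inverse(2,3)[OF f less_imp_le[OF ab] that]
      diffeo_interval(1)[OF diffeo_inverse(1)[OF f less_imp_le[OF ab]] that] by auto
  interpret two_sided a b ?\<phi> ?\<phi>' ?\<phi>'' ?\<psi> ?\<psi>' ?\<psi>'' B
  proof (rule two_sided.intro)
    show "contraction a b ?\<phi> ?\<phi>' ?\<phi>'' B" by (rule conL)
    show "contraction a b (\<lambda>x. a + b - ?\<psi> (a + b - x)) (\<lambda>x. ?\<psi>' (a + b - x)) (\<lambda>x. - ?\<psi>'' (a + b - x)) B"
      by (rule conR'(1))
    show "diffeo a b ?\<psi> ?\<psi>' ?\<psi>''" by (rule diffeo_towards[OF f ab])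
    fix x assume x: "x \<in> {a..b}"
    show "?\<psi> (?\<phi> x) = x" "?\<phi> (?\<psi> x) = x"
      using \<sigma> fr_inv[OF x] by (auto simp: towards_def)
    show "?\<psi>' (?\<phi> x) * ?\<phi>' x = 1"
      using \<sigma> fr_inv[OF x] nz[OF x] nz[OF fr_inv(3)[OF x]] by (auto simp: towards_def towards'_def)
  qed
  show "continuous_on {a<..<b} L.A" by (rule L.A_continuous)
  assume x: "x \<in> {a<..<b}"
  have "L.A x = Apsi x"
    by (rule lim_nonlin_agree[OF V I _ x]) (use \<sigma> in \<open>auto simp: towards_def towards'_def f'_def\<close>)
  also have "Apsi x = - lim_nonlin (towards a b (- \<sigma>) fr) (towards' a b (- \<sigma>) fr fr') (towards'' a b (- \<sigma>) fr fr' fr'') (a + b - x)"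
    unfolding Apsi_def using conR'(2)[of "a + b - x"] x by simp
  finally show "lim_nonlin (towards a b (- \<sigma>) fr) (towards' a b (- \<sigma>) fr fr') (towards'' a b (- \<sigma>) fr fr' fr'') (a + b - x)
      = - L.A x" by simp
qed

text \<open>\<open>g\<close> is the translation in the blended coordinate. Left of a compact window
  it coincides with the map modified at the left end, right of it with the one modified at the right
  end, and both are close to \<open>f\<close> already. Only on the window is the limit argument
  needed.\<close>

lemma component_perturbation:
  assumes V: "f \<in> Diff2_V" and I: "0 \<le> a" "b \<le> 1" and ab: "a < b" and fab: "f a = a" "f b = b"
    and \<sigma>: "\<sigma> = 1 \<or> \<sigma> = -1" and sgn: "\<And>x. x \<in> {a<..<b} \<Longrightarrow> 0 < \<sigma> * (f x - x)"
    and m: "1 \<le> m" "1 \<le> m'" and \<alpha>: "0 < \<alpha>" "0 < \<alpha>'"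
    and \<delta>: "\<bar>germ'' m 1 (- \<sigma> / \<alpha>) 0 - D2 f a\<bar> < \<delta>" "\<bar>germ'' m' 1 (\<sigma> / \<alpha>') 0 + D2 f b\<bar> < \<delta>"
  obtains K K' K'' \<epsilon> d d' g g' g'' where "time_coordinate a b K K' K'' \<epsilon> \<alpha> \<alpha>' d d' m m'"
    "diffeo a b g g' g''" "\<And>x. x \<in> {a<..<b} \<Longrightarrow> K (g x) = K x + \<sigma>" "g' a = 1" "g' b = 1"
    "g'' a = germ'' m 1 (- \<sigma> / \<alpha>) 0" "g'' b = - germ'' m' 1 (\<sigma> / \<alpha>') 0"
    "\<And>x. x \<in> {a..b} \<Longrightarrow> \<bar>g'' x - D2 f x\<bar> \<le> 33 * \<delta>"
proof -
  let ?f' = "D1 f" and ?f'' = "D2 f"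
  have f: "diffeo a b f ?f' ?f''" by (rule ends_agree(1)[OF V I ab fab \<sigma> sgn])
  have par: "?f' a = 1" "?f' b = 1"
    by (rule ends_agree(2)[OF V I ab fab \<sigma> sgn], assumption)
      (rule ends_agree(3)[OF V I ab fab \<sigma> sgn])
  define A where "A = lim_nonlin (towards a b \<sigma> f) (towards' a b \<sigma> f ?f') (towards'' a b \<sigma> f ?f' ?f'')"
  have cA: "continuous_on {a<..<b} A"
    unfolding A_def by (rule ends_agree(5)[OF V I ab fab \<sigma> sgn])
  have \<delta>0: "0 < \<delta>" using \<delta>(1) by linarith
  define h where "h = inv_into {a..b} f"
  note h = diffeo_inverse[OF f less_imp_le[OF ab], folded h_def]
  define p where "p = (a + b) / 2"
  define p2 where "p2 = (p + b) / 2"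
  define c where "c = 3 / (p2 - p)"
  have p: "a < p" "p < p2" "p2 < b" using ab by (auto simp: p_def p2_def field_simps)
  have c: "0 < c" "p + 3 / c = p2" using p by (simp_all add: c_def del: divide_divide_eq_right) (simp add: field_simps)
  have hp: "h p \<in> {a<..<b}" "h p2 \<in> {a<..<b}" using diffeo_interval(2)[OF h(1)] p by auto
  \<comment> \<open>Left of \<open>w1\<close> both \<open>x\<close> and \<open>f x\<close> are at
    most \<open>p\<close>, where the blend is the left coordinate; right of \<open>w2\<close> both
    are at least \<open>p2\<close>, where it is the right one.\<close>
  define w1 w2 where "w1 = min p (h p)" and "w2 = max p2 (h p2)"
  have w: "a < w1" "w1 \<le> p" "p2 \<le> w2" "w2 < b" "w1 < w2" using p hp by (auto simp: w1_def w2_def)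
  have wI: "w1 \<in> {a<..<b}" "w2 \<in> {a<..<b}" using w p by auto
  have fw: "f w1 \<in> {a<..<b}" "f w2 \<in> {a<..<b}" using diffeo_interval(2)[OF f] wI by auto
  \<comment> \<open>The interval contains the window and its image under \<open>f\<close> in its
    interior. Modifications take place outside it only.\<close>
  define z1 z2 where "z1 = (a + min w1 (f w1)) / 2" and "z2 = (b + max w2 (f w2)) / 2"
  have z: "a < z1" "z1 < w1" "z1 < f w1" "w2 < z2" "f w2 < z2" "z2 < b" using w fw by (auto simp: z1_def z2_def)
  have z12: "z1 \<le> z2" using z w by linarith
  have zI: "z1 \<in> {a<..<b}" "z2 \<in> {a<..<b}" using z w wI by auto
  have ZI: "{z1..z2} \<subseteq> {a<..<b}" using zI by auto
  have fw1: "f w1 \<le> p"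
    using diffeo_less_iff(3)[OF f, of w1 "h p"] h(2)[of p] wI hp p by (auto simp: w1_def)
  have fw2: "p2 \<le> f w2"
    using diffeo_less_iff(3)[OF f, of "h p2" w2] h(2)[of p2] wI hp p by (auto simp: w2_def)
  define PL where "PL n \<epsilon> F F' F'' L L' L'' \<longleftrightarrow> 0 < \<epsilon> \<and> a + \<epsilon> < z1 \<and> diffeo a b F F' F'' \<and>
    (\<forall>x\<in>{z1..b}. F x = f x \<and> F' x = ?f' x \<and> F'' x = ?f'' x) \<and> (\<forall>x\<in>{a..b}. \<bar>F'' x - ?f'' x\<bar> \<le> 33 * \<delta>) \<and>
    c2 {a<..<b} L L' L'' \<and> (\<forall>x\<in>{a<..<b}. 0 < L' x) \<and> (\<forall>x\<in>{a<..<b}. L (F x) = L x + \<sigma>) \<and>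
    (\<forall>x\<in>{a<..<a+\<epsilon>}. L x = - \<alpha> / (x - a) ^ m) \<and> (\<forall>x\<in>{z1..z2}. \<bar>L'' x / L' x - A x\<bar> \<le> 1 / real (Suc n))"
    for n \<epsilon> F F' F'' L L' L''
  have "\<exists>\<epsilon> F F' F'' L L' L''. PL n \<epsilon> F F' F'' L L' L''" for n
  proof (rule left_end[OF f ab par(1) \<sigma> sgn m(1) \<alpha>(1) \<delta>(1) z(1) z12 z(6), of "1 / real (Suc n)" z1])
    fix \<epsilon> F F' F'' L L' L''
    assume "0 < \<epsilon>" "a + \<epsilon> < z1" "diffeo a b F F' F''" "F' a = 1"
      "\<And>x. x \<in> {z1..b} \<Longrightarrow> F x = f x \<and> F' x = ?f' x \<and> F'' x = ?f'' x"
      "\<And>x. x \<in> {a..b} \<Longrightarrow> \<bar>F'' x - ?f'' x\<bar> \<le> 33 * \<delta>"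
      "c2 {a<..<b} L L' L''" "\<And>x. x \<in> {a<..<b} \<Longrightarrow> 0 < L' x" "\<And>x. x \<in> {a<..<b} \<Longrightarrow> L (F x) = L x + \<sigma>"
      "\<And>x. x \<in> {a<..<a+\<epsilon>} \<Longrightarrow> L x = - \<alpha> / (x - a) ^ m"
      "\<And>x. x \<in> {z1..z2} \<Longrightarrow> \<bar>L'' x / L' x -
        lim_nonlin (towards a b \<sigma> f) (towards' a b \<sigma> f ?f') (towards'' a b \<sigma> f ?f' ?f'') x\<bar> \<le> 1 / real (Suc n)"
    then have "PL n \<epsilon> F F' F'' L L' L''" unfolding PL_def A_def by (intro conjI ballI; blast)
    then show "\<exists>\<epsilon> F F' F'' L L' L''. PL n \<epsilon> F F' F'' L L' L''" by blast
  qed (use zI in auto)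
  then obtain \<epsilon>L FL FL' FL'' L L' L'' where
    "\<And>n. PL n (\<epsilon>L n) (FL n) (FL' n) (FL'' n) (L n) (L' n) (L'' n)" by metis
  note PL = this[unfolded PL_def]
  define PR where "PR n \<epsilon> F F' F'' R R' R'' \<longleftrightarrow> 0 < \<epsilon> \<and> z2 < b - \<epsilon> \<and> diffeo a b F F' F'' \<and>
    (\<forall>x\<in>{a..z2}. F x = f x \<and> F' x = ?f' x \<and> F'' x = ?f'' x) \<and> (\<forall>x\<in>{a..b}. \<bar>F'' x - ?f'' x\<bar> \<le> 33 * \<delta>) \<and>
    c2 {a<..<b} R R' R'' \<and> (\<forall>x\<in>{a<..<b}. 0 < R' x) \<and> (\<forall>x\<in>{a<..<b}. R (F x) = R x + \<sigma>) \<and>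
    (\<forall>x\<in>{b-\<epsilon><..<b}. R x = \<alpha>' / (b - x) ^ m') \<and> (\<forall>x\<in>{z1..z2}. \<bar>R'' x / R' x - A x\<bar> \<le> 1 / real (Suc n))"
    for n \<epsilon> F F' F'' R R' R''
  have "\<exists>\<epsilon> F F' F'' R R' R''. PR n \<epsilon> F F' F'' R R' R''" for n
  proof (rule right_end[OF f ab par(2) \<sigma> sgn m(2) \<alpha>(2) \<delta>(2) z(1) z12 z(6), of "1 / real (Suc n)" z2])
    fix \<epsilon> F F' F'' R R' R''
    let ?fr = "\<lambda>x. a + b - f (a + b - x)" and ?fr' = "\<lambda>x. ?f' (a + b - x)" and ?fr'' = "\<lambda>x. - ?f'' (a + b - x)"
    assume R: "0 < \<epsilon>" "z2 < b - \<epsilon>" "diffeo a b F F' F''" "F' b = 1"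
      "\<And>x. x \<in> {a..z2} \<Longrightarrow> F x = f x \<and> F' x = ?f' x \<and> F'' x = ?f'' x"
      "\<And>x. x \<in> {a..b} \<Longrightarrow> \<bar>F'' x - ?f'' x\<bar> \<le> 33 * \<delta>"
      "c2 {a<..<b} R R' R''" "\<And>x. x \<in> {a<..<b} \<Longrightarrow> 0 < R' x" "\<And>x. x \<in> {a<..<b} \<Longrightarrow> R (F x) = R x + \<sigma>"
      "\<And>x. x \<in> {b-\<epsilon><..<b} \<Longrightarrow> R x = \<alpha>' / (b - x) ^ m'"
      "\<And>x. x \<in> {z1..z2} \<Longrightarrow> \<bar>R'' x / R' x + lim_nonlin (towards a b (- \<sigma>) ?fr)
        (towards' a b (- \<sigma>) ?fr ?fr') (towards'' a b (- \<sigma>) ?fr ?fr' ?fr'') (a + b - x)\<bar> \<le> 1 / real (Suc n)"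
    have "\<bar>R'' x / R' x - A x\<bar> \<le> 1 / real (Suc n)" if "x \<in> {z1..z2}" for x
    proof -
      have "lim_nonlin (towards a b (- \<sigma>) ?fr) (towards' a b (- \<sigma>) ?fr ?fr')
          (towards'' a b (- \<sigma>) ?fr ?fr' ?fr'') (a + b - x) = - A x"
        unfolding A_def by (rule ends_agree(4)[OF V I ab fab \<sigma> sgn subsetD[OF ZI that]])
      with R(11)[OF that] show ?thesis by simp
    qed
    with R have "PR n \<epsilon> F F' F'' R R' R''" unfolding PR_def by (intro conjI ballI; blast)
    then show "\<exists>\<epsilon> F F' F'' R R' R''. PR n \<epsilon> F F' F'' R R' R''" by blast
  qed (use zI in auto)
  then obtain \<epsilon>R FR FR' FR'' R R' R'' where
    "\<And>n. PR n (\<epsilon>R n) (FR n) (FR' n) (FR'' n) (R n) (R' n) (R'' n)" by metis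
  note PR = this[unfolded PR_def]
  \<comment> \<open>Both coordinates are normalised to vanish at \<open>p\<close>; they then take
    the value \<sigma> at \<open>f p\<close>, and these two values together with the nonlinearity
    determine the common limit. The subtracted constants become the offsets of the blended
    coordinate.\<close>
  define L0 R0 where "L0 n x = L n x - L n p" and "R0 n x = R n x - R n p" for n x
  have PLc: "c2 {a<..<b} (L n) (L' n) (L'' n)" and PRc: "c2 {a<..<b} (R n) (R' n) (R'' n)" for n
    using PL[of n] PR[of n] by blast+
  have c2L0: "c2 {a<..<b} (L0 n) (L' n) (L'' n)" and c2R0: "c2 {a<..<b} (R0 n) (R' n) (R'' n)" for n
    unfolding L0_def[abs_def] R0_def[abs_def]
    using c2_diff[OF PLc c2_const[of _ "L n p"]] c2_diff[OF PRc c2_const[of _ "R n p"]]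
    by (simp_all only: diff_0_right)
  have WI: "x \<in> {a<..<b}" "x \<in> {z1..b}" "x \<in> {a..z2}" if "x \<in> {w1..w2}" for x
    using that wI z by auto
  have L0f: "L0 n (f x) = L0 n x + \<sigma>" and R0f: "R0 n (f x) = R0 n x + \<sigma>" if x: "x \<in> {w1..w2}" for n x
  proof -
    have "FL n x = f x" "L n (FL n x) = L n x + \<sigma>" using PL[of n] WI[OF x] by blast+
    then show "L0 n (f x) = L0 n x + \<sigma>" by (simp add: L0_def)
    have "FR n x = f x" "R n (FR n x) = R n x + \<sigma>" using PR[of n] WI[OF x] by blast+
    then show "R0 n (f x) = R0 n x + \<sigma>" by (simp add: R0_def)
  qed
  obtain n where n: "\<And>x. x \<in> {z1..z2} \<Longrightarrow> 0 < blend' c p (L0 n) (L' n) (R0 n) (R' n) x"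
    "\<And>x. x \<in> {w1..w2} \<Longrightarrow> blend c p (L0 n) (R0 n) z1 < blend c p (L0 n) (R0 n) x + \<sigma> \<and>
       blend c p (L0 n) (R0 n) x + \<sigma> < blend c p (L0 n) (R0 n) z2"
    "\<And>x y. x \<in> {w1..w2} \<Longrightarrow> y \<in> {z1..z2} \<Longrightarrow> blend c p (L0 n) (R0 n) y = blend c p (L0 n) (R0 n) x + \<sigma> \<Longrightarrow>
       \<bar>(blend' c p (L0 n) (L' n) (R0 n) (R' n) x / blend' c p (L0 n) (L' n) (R0 n) (R' n) y) *
        (blend'' c p (L0 n) (L' n) (L'' n) (R0 n) (R' n) (R'' n) x / blend' c p (L0 n) (L' n) (R0 n) (R' n) x
         - blend'' c p (L0 n) (L' n) (L'' n) (R0 n) (R' n) (R'' n) y / blend' c p (L0 n) (L' n) (R0 n) (R' n) y *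
          (blend' c p (L0 n) (L' n) (R0 n) (R' n) x / blend' c p (L0 n) (L' n) (R0 n) (R' n) y)) - ?f'' x\<bar> \<le> 33 * \<delta>"
  proof (rule blend_close[of z1 z2 A w1 w2 p f "f w1" "f w2" ?f' \<sigma> L0 L' L'' R0 R' R'' ?f'' "33 * \<delta>" c p])
    show "continuous_on {z1..z2} A" using cA ZI by (rule continuous_on_subset)
    show "p \<in> {w1..w2}" using w p by auto
    show "f x \<in> {f w1..f w2}" if "x \<in> {w1..w2}" for x
      using that diffeo_less_iff(3)[OF f, of w1 x] diffeo_less_iff(3)[OF f, of x w2] wI by auto
    show "continuous_on {w1..w2} f" "continuous_on {w1..w2} ?f'"
      using c2D(4,5)[OF diffeo_c2[OF f]] wI by (auto elim!: continuous_on_subset)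
    show "0 < \<sigma> * (f p - p)" using sgn[of p] p by simp
    show "c2 {z1..z2} (L0 k) (L' k) (L'' k)" "c2 {z1..z2} (R0 k) (R' k) (R'' k)" for k
      using c2_subset[OF c2L0 ZI] c2_subset[OF c2R0 ZI] by auto
    show "0 < L' k x" "0 < R' k x" if "x \<in> {z1..z2}" for k x
      using PL[of k] PR[of k] subsetD[OF ZI that] by blast+
    show "L0 k p = 0" "R0 k p = 0" for k by (simp_all add: L0_def R0_def)
    show "\<bar>L'' k x / L' k x - A x\<bar> \<le> 1 / real (Suc k)" "\<bar>R'' k x / R' k x - A x\<bar> \<le> 1 / real (Suc k)"
      if "x \<in> {z1..z2}" for k x using PL[of k] PR[of k] that by blast+
    show "?f' x = L' k x / L' k (f x) \<and> ?f'' x = ?f' x * (L'' k x / L' k x - L'' k (f x) / L' k (f x) * ?f' x)"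
      if x: "x \<in> {w1..w2}" for k x
    proof -
      have P: "c2 {a<..<b} (L k) (L' k) (L'' k)" "\<And>x. x \<in> {a<..<b} \<Longrightarrow> 0 < L' k x"
        "diffeo a b (FL k) (FL' k) (FL'' k)" "\<And>x. x \<in> {a<..<b} \<Longrightarrow> L k (FL k x) = L k x + \<sigma>"
        and eq: "FL k x = f x" "FL' k x = ?f' x" "FL'' k x = ?f'' x"
        using PL[of k] WI(2)[OF x] by blast+
      from coordinate_deriv[OF P WI(1)[OF x]] show ?thesis unfolding eq by blast
    qed
  qed (use w z L0f R0f \<delta>0 in auto)
  define K K' K'' where "K = blend c p (L0 n) (R0 n)" and "K' = blend' c p (L0 n) (L' n) (R0 n) (R' n)"
    and "K'' = blend'' c p (L0 n) (L' n) (L'' n) (R0 n) (R' n) (R'' n)"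
  note n = n[folded K_def K'_def K''_def]
  have KL: "K x = L0 n x" "K' x = L' n x" if "x \<le> p" for x
    unfolding K_def K'_def by (rule blend_left[OF c(1) that])+
  have KR: "K x = R0 n x" "K' x = R' n x" if "p2 \<le> x" for x
    unfolding K_def K'_def by (rule blend_right; use c that in simp)+
  define \<epsilon> where "\<epsilon> = min (\<epsilon>L n) (\<epsilon>R n)"
  have \<epsilon>: "0 < \<epsilon>" "a + \<epsilon> < z1" "z2 < b - \<epsilon>" "\<epsilon> \<le> \<epsilon>L n" "\<epsilon> \<le> \<epsilon>R n"
    using PL[of n] PR[of n] by (auto simp: \<epsilon>_def)
  have tc: "time_coordinate a b K K' K'' \<epsilon> \<alpha> \<alpha>' (- L n p) (- R n p) m m'"
  proof
    show "c2 {a<..<b} K K' K''" unfolding K_def K'_def K''_def by (rule c2_blend[OF c2L0 c2R0])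
    show "0 < K' x" if x: "x \<in> {a<..<b}" for x
    proof (cases "x \<in> {z1..z2}")
      case False
      then consider "x \<le> p" | "p2 \<le> x" using z w by fastforce
      then show ?thesis by cases (use KL KR PL[of n] PR[of n] x in auto)
    qed (rule n(1))
    show "K x = - \<alpha> / (x - a) ^ m + - L n p" if "x \<in> {a<..<a+\<epsilon>}" for x
    proof -
      have "x \<in> {a<..<a + \<epsilon>L n}" "x \<le> p" using that \<epsilon> z w by auto
      moreover have "L n x = - \<alpha> / (x - a) ^ m" using PL[of n] calculation(1) by blast
      ultimately show ?thesis using KL(1)[of x] by (simp add: L0_def)
    qed
    show "K x = \<alpha>' / (b - x) ^ m' + - R n p" if "x \<in> {b-\<epsilon><..<b}" for x
    proof -
      have "x \<in> {b - \<epsilon>R n<..<b}" "p2 \<le> x" using that \<epsilon> z w by auto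
      moreover have "R n x = \<alpha>' / (b - x) ^ m'" using PR[of n] calculation(1) by blast
      ultimately show ?thesis using KR(1)[of x] by (simp add: R0_def)
    qed
    show "a + \<epsilon> < b" using \<epsilon>(2) zI by simp
  qed (use ab \<epsilon> m \<alpha> in auto)
  interpret T: time_coordinate a b K K' K'' \<epsilon> \<alpha> \<alpha>' "- L n p" "- R n p" m m' by (rule tc)
  obtain g g' g'' where g: "diffeo a b g g' g''"
    "\<And>x. x \<in> {a<..<b} \<Longrightarrow> g x \<in> {a<..<b} \<and> K (g x) = 1 * K x + \<sigma>"
    "\<And>x. x \<in> {a<..<b} \<Longrightarrow> g' x = 1 * K' x / K' (g x)"
    "\<And>x. x \<in> {a<..<b} \<Longrightarrow> g'' x = g' x * (K'' x / K' x - K'' (g x) / K' (g x) * g' x)"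
    "g' a = 1 powr (- 1 / real m)" "g' b = 1 powr (- 1 / real m')"
    "g'' a = germ'' m 1 (- ((1 - 1) * (- L n p) + \<sigma>) / \<alpha>) 0"
    "g'' b = - germ'' m' 1 (((1 - 1) * (- R n p) + \<sigma>) / \<alpha>') 0"
    using T.affine_map[of 1 \<sigma>] by (metis zero_less_one)
  have g_ends: "g' a = 1" "g' b = 1" "g'' a = germ'' m 1 (- \<sigma> / \<alpha>) 0" "g'' b = - germ'' m' 1 (\<sigma> / \<alpha>') 0"
    using g(5-8) by simp_all
  have cg: "c2 {a<..<b} g g' g''" by (rule c2_subset[OF diffeo_c2[OF g(1)]]) auto
  have close: "\<bar>g'' x - ?f'' x\<bar> \<le> 33 * \<delta>" if x: "x \<in> {a..b}" for x
  proof -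
    consider "x = a" | "x = b" | "x \<in> {a<..<w1}" | "x \<in> {w2<..<b}" | "x \<in> {w1..w2}"
      using x by fastforce
    then show ?thesis
    proof cases
      case 1
      then show ?thesis using g_ends(3) \<delta>(1) \<delta>0 by simp
    next
      case 2
      then show ?thesis using g_ends(4) \<delta>(2) \<delta>0 by simp
    next
      case 3
      have P: "diffeo a b (FL n) (FL' n) (FL'' n)" "\<And>x. x \<in> {a<..<b} \<Longrightarrow> L n (FL n x) = L n x + \<sigma>"
        "FL n w1 = f w1" "\<And>x. x \<in> {a..b} \<Longrightarrow> \<bar>FL'' n x - ?f'' x\<bar> \<le> 33 * \<delta>"
        using PL[of n] z w by auto
      have sub: "{a<..<w1} \<subseteq> {a<..<b}" "{a<..<w1} \<subseteq> {a..b}" using wI by auto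
      have eq: "g y = FL n y" if y: "y \<in> {a<..<w1}" for y
      proof -
        have yI: "y \<in> {a<..<b}" using y sub by blast
        have "FL n y < f w1" using diffeo_less[OF P(1), of y w1] P(3) y yI wI by auto
        then have "FL n y \<le> p" "y \<le> p" using fw1 w y by auto
        then have "K (FL n y) = K y + \<sigma>" using P(2)[OF yI] by (simp add: KL L0_def)
        then show ?thesis using T.K_inj[of "g y" "FL n y"] g(2)[OF yI] diffeo_interval(2)[OF P(1) yI] by simp
      qed
      have "g'' x = FL'' n x"
        using c2_unique_open(2)[OF c2_subset[OF cg sub(1)] c2_subset[OF diffeo_c2[OF P(1)] sub(2)] _ eq 3] by simp
      then show ?thesis using P(4)[OF x] by simp
    next
      case 4
      have P: "diffeo a b (FR n) (FR' n) (FR'' n)" "\<And>x. x \<in> {a<..<b} \<Longrightarrow> R n (FR n x) = R n x + \<sigma>"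
        "FR n w2 = f w2" "\<And>x. x \<in> {a..b} \<Longrightarrow> \<bar>FR'' n x - ?f'' x\<bar> \<le> 33 * \<delta>"
        using PR[of n] z w wI by auto
      have sub: "{w2<..<b} \<subseteq> {a<..<b}" "{w2<..<b} \<subseteq> {a..b}" using wI by auto
      have eq: "g y = FR n y" if y: "y \<in> {w2<..<b}" for y
      proof -
        have yI: "y \<in> {a<..<b}" using y sub by blast
        have "f w2 < FR n y" using diffeo_less[OF P(1), of w2 y] P(3) y yI wI by auto
        then have "p2 \<le> FR n y" "p2 \<le> y" using fw2 w y by auto
        then have "K (FR n y) = K y + \<sigma>" using P(2)[OF yI] by (simp add: KR R0_def)
        then show ?thesis using T.K_inj[of "g y" "FR n y"] g(2)[OF yI] diffeo_interval(2)[OF P(1) yI] by simp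
      qed
      have "g'' x = FR'' n x"
        using c2_unique_open(2)[OF c2_subset[OF cg sub(1)] c2_subset[OF diffeo_c2[OF P(1)] sub(2)] _ eq 4] by simp
      then show ?thesis using P(4)[OF x] by simp
    next
      case 5
      note xI = WI(1)[OF 5]
      have gx: "g x \<in> {a<..<b}" "K (g x) = K x + \<sigma>" using g(2)[OF xI] by auto
      have "z1 \<le> g x" "g x \<le> z2"
        using n(2)[OF 5] gx T.K_le_iff[OF zI(1) gx(1)] T.K_le_iff[OF gx(1) zI(2)] by auto
      then have gZ: "g x \<in> {z1..z2}" by simp
      show ?thesis using n(3)[OF 5 gZ gx(2)] unfolding g(4)[OF xI] g(3)[OF xI] by simp
    qed
  qed
  show thesis
    by (rule that[OF tc g(1) _ g_ends close]) (use g(2) in auto)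
qed

section \<open>Gluing and density\<close>

text \<open>Depends only on \<open>f''\<close> at the point, so the pieces on both sides of a common
  end point choose the same order, and with it the same first derivative of the conjugacies.\<close>

definition end_order :: "(real \<Rightarrow> real) \<Rightarrow> real \<Rightarrow> real \<Rightarrow> nat" where
  "end_order f'' \<delta> x = (if \<bar>f'' x\<bar> < \<delta> then 2 else 1)"

text \<open>The second derivative given to the approximation at a fixed point. For positive \<delta>
  it vanishes exactly when the order is 2, where the conjugacies have second derivative 0
  too.\<close>

definition end_curvature :: "(real \<Rightarrow> real) \<Rightarrow> real \<Rightarrow> real \<Rightarrow> real" where
  "end_curvature f'' \<delta> x = (if \<bar>f'' x\<bar> < \<delta> then 0 else f'' x)"

text \<open>The second derivative of the conjugacies at the left end is a free parameter \<open>\<beta>\<close>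
  (unless it is forced to vanish), so that pieces can be glued from left to right.\<close>

definition approximable :: "(real \<Rightarrow> real) \<Rightarrow> real \<Rightarrow> real \<Rightarrow> real \<Rightarrow> bool" where
  "approximable f'' \<delta> u v \<longleftrightarrow> (\<exists>g g' g''. diffeo u v g g' g'' \<and> g' u = 1 \<and> g' v = 1
     \<and> g'' u = end_curvature f'' \<delta> u \<and> g'' v = end_curvature f'' \<delta> v
     \<and> (\<forall>x\<in>{u..v}. \<bar>g'' x - f'' x\<bar> \<le> 33 * \<delta>)
     \<and> (\<forall>k::nat. k \<ge> 2 \<longrightarrow> (\<forall>\<beta>. (end_curvature f'' \<delta> u = 0 \<longrightarrow> \<beta> = 0) \<longrightarrow>
         (\<exists>h h' h''. diffeo u v h h' h'' \<and> (\<forall>x\<in>{u..v}. h (g x) = (g ^^ k) (h x))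
            \<and> h' u = real k powr (- 1 / real (end_order f'' \<delta> u))
            \<and> h' v = real k powr (- 1 / real (end_order f'' \<delta> v))
            \<and> h'' u = \<beta> \<and> (end_curvature f'' \<delta> v = 0 \<longrightarrow> h'' v = 0)))))"

lemma diffeo_glue:
  assumes f: "diffeo u v f f' f''" and g: "diffeo v w g g' g''" and uvw: "u \<le> v" "v < w"
    and eq: "f' v = g' v" "f'' v = g'' v"
  shows "diffeo u w (\<lambda>x. if x \<le> v then f x else g x) (\<lambda>x. if x \<le> v then f' x else g' x)
      (\<lambda>x. if x \<le> v then f'' x else g'' x)"
  using c2_glue[OF diffeo_c2[OF f] diffeo_c2[OF g]] f g uvw eq unfolding diffeo_def by auto

text \<open>The conjugacy on the left piece arrives at \<open>v\<close> with some second derivative,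
  which becomes the parameter \<beta> of the right piece. It is admissible there because it vanishes
  whenever \<open>end_curvature\<close> does. The first derivatives at \<open>v\<close> match since
  both are determined by \<open>k\<close> and the order at \<open>v\<close>.\<close>

lemma approximable_glue:
  assumes "approximable f'' \<delta> u v" "approximable f'' \<delta> v w" and uvw: "u < v" "v < w"
  shows "approximable f'' \<delta> u w"
proof -
  let ?T = "end_curvature f'' \<delta>" and ?r = "\<lambda>k x. real k powr (- 1 / real (end_order f'' \<delta> x))"
  obtain g1 g1' g1'' where g1: "diffeo u v g1 g1' g1''" "g1' u = 1" "g1' v = 1" "g1'' u = ?T u" "g1'' v = ?T v"
    "\<forall>x\<in>{u..v}. \<bar>g1'' x - f'' x\<bar> \<le> 33 * \<delta>"
    and h1: "\<And>k::nat. \<And>\<beta>. k \<ge> 2 \<Longrightarrow> (?T u = 0 \<longrightarrow> \<beta> = 0) \<Longrightarrow> \<exists>h h' h''. diffeo u v h h' h''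
      \<and> (\<forall>x\<in>{u..v}. h (g1 x) = (g1 ^^ k) (h x)) \<and> h' u = ?r k u \<and> h' v = ?r k v \<and> h'' u = \<beta> \<and> (?T v = 0 \<longrightarrow> h'' v = 0)"
    using assms(1) unfolding approximable_def by metis
  obtain g2 g2' g2'' where g2: "diffeo v w g2 g2' g2''" "g2' v = 1" "g2' w = 1" "g2'' v = ?T v" "g2'' w = ?T w"
    "\<forall>x\<in>{v..w}. \<bar>g2'' x - f'' x\<bar> \<le> 33 * \<delta>"
    and h2: "\<And>k::nat. \<And>\<beta>. k \<ge> 2 \<Longrightarrow> (?T v = 0 \<longrightarrow> \<beta> = 0) \<Longrightarrow> \<exists>h h' h''. diffeo v w h h' h''
      \<and> (\<forall>x\<in>{v..w}. h (g2 x) = (g2 ^^ k) (h x)) \<and> h' v = ?r k v \<and> h' w = ?r k w \<and> h'' v = \<beta> \<and> (?T w = 0 \<longrightarrow> h'' w = 0)"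
    using assms(2) unfolding approximable_def by metis
  let ?j = "\<lambda>p q x. if x \<le> v then p x else (q x :: real)"
  define g where "g = ?j g1 g2"
  have gL: "g x = g1 x" if "x \<in> {u..v}" for x using that by (simp add: g_def)
  have gR: "g x = g2 x" if "x \<in> {v..w}" for x
    using that g1(1) g2(1) by (cases "x = v") (auto simp: g_def diffeo_def)
  have conj: "\<exists>h h' h''. diffeo u w h h' h'' \<and> (\<forall>x\<in>{u..w}. h (g x) = (g ^^ k) (h x))
      \<and> h' u = ?r k u \<and> h' w = ?r k w \<and> h'' u = \<beta> \<and> (?T w = 0 \<longrightarrow> h'' w = 0)"
    if k: "k \<ge> 2" and \<beta>: "?T u = 0 \<longrightarrow> \<beta> = 0" for k :: nat and \<beta>
  proof -
    obtain p p' p'' where p: "diffeo u v p p' p''" "\<forall>x\<in>{u..v}. p (g1 x) = (g1 ^^ k) (p x)"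
      "p' u = ?r k u" "p' v = ?r k v" "p'' u = \<beta>" "?T v = 0 \<longrightarrow> p'' v = 0"
      using h1[OF k \<beta>] by blast
    obtain q q' q'' where q: "diffeo v w q q' q''" "\<forall>x\<in>{v..w}. q (g2 x) = (g2 ^^ k) (q x)"
      "q' v = ?r k v" "q' w = ?r k w" "q'' v = p'' v" "?T w = 0 \<longrightarrow> q'' w = 0"
      using h2[OF k p(6)] by blast
    have hR: "?j p q x = q x" if "x \<in> {v..w}" for x
      using that p(1) q(1) by (cases "x = v") (auto simp: diffeo_def)
    have "?j p q (g x) = (g ^^ k) (?j p q x)" if x: "x \<in> {u..w}" for x
    proof (cases "x \<le> v")
      case True
      then have xI: "x \<in> {u..v}" using x by simp
      have "(g ^^ k) (p x) = (g1 ^^ k) (p x)"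
        by (rule funpow_cong_on[OF gL diffeo_interval(1)[OF g1(1)] diffeo_interval(1)[OF p(1) xI]])
      then show ?thesis using p(2) xI gL[OF xI] diffeo_interval(1)[OF g1(1) xI] True by simp
    next
      case False
      then have xI: "x \<in> {v..w}" using x by simp
      have "(g ^^ k) (q x) = (g2 ^^ k) (q x)"
        by (rule funpow_cong_on[OF gR diffeo_interval(1)[OF g2(1)] diffeo_interval(1)[OF q(1) xI]])
      then show ?thesis
        unfolding gR[OF xI] hR[OF xI] hR[OF diffeo_interval(1)[OF g2(1) xI]] using q(2) xI by simp
    qed
    moreover have "diffeo u w (?j p q) (?j p' q') (?j p'' q'')"
      by (rule diffeo_glue[OF p(1) q(1)]) (use uvw p(4) q(3,5) in auto)
    ultimately show ?thesis
      using p(3,5) q(4,6) uvw by (intro exI[of _ "?j p q"] exI[of _ "?j p' q'"] exI[of _ "?j p'' q''"]) auto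
  qed
  have "diffeo u w g (?j g1' g2') (?j g1'' g2'')"
    unfolding g_def by (rule diffeo_glue[OF g1(1) g2(1)]) (use uvw g1(3,5) g2(2,4) in auto)
  moreover have "\<forall>x\<in>{u..w}. \<bar>?j g1'' g2'' x - f'' x\<bar> \<le> 33 * \<delta>" using g1(6) g2(6) by auto
  ultimately show ?thesis
    unfolding approximable_def using conj g1(2,4) g2(3,5) uvw
    by (intro exI[of _ g] exI[of _ "?j g1' g2'"] exI[of _ "?j g1'' g2''"]) auto
qed

text \<open>Where \<open>f''\<close> is small the approximation is the identity, and any diffeomorphism with the
  prescribed germs at the end points is a conjugacy.\<close>

lemma approximable_flat:
  assumes uv: "u < v" and small: "\<And>x. x \<in> {u..v} \<Longrightarrow> \<bar>f'' x\<bar> < \<delta>"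
  shows "approximable f'' \<delta> u v"
proof -
  have T: "end_curvature f'' \<delta> u = 0" "end_curvature f'' \<delta> v = 0" "end_order f'' \<delta> u = 2" "end_order f'' \<delta> v = 2"
    using small[of u] small[of v] uv by (simp_all add: end_curvature_def end_order_def)
  have conj: "\<exists>h h' h''. diffeo u v h h' h'' \<and> h' u = real k powr (- 1 / 2) \<and> h' v = real k powr (- 1 / 2)
      \<and> h'' u = 0 \<and> h'' v = 0" if k: "k \<ge> 2" for k :: nat
  proof -
    define l where "l = real k powr (- 1 / 2)"
    have l: "0 < l" "l \<le> 1"
      using k powr_mono[of "- 1 / 2" 0 "real k"] by (auto simp: l_def)
    define w where "w = v - u"
    have w: "0 < w" using uv by (simp add: w_def)
    \<comment> \<open>The derivative of \<open>h\<close> is \<open>l\<close> plus \<open>c\<close>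
      times the square of \<open>X * (w - X)\<close>, with \<open>X = x - u\<close>. That square has
      integral \<open>w^5 / 30\<close>, so this \<open>c\<close> makes \<open>h v = v\<close>, and
      \<open>l \<le> 1\<close> makes it nonnegative.\<close>
    define c where "c = 30 * (1 - l) / w ^ 4"
    have c: "0 \<le> c" using l w by (simp add: c_def)
    define h where "h x = u + l * (x - u) + c * (w\<^sup>2 * (x - u) ^ 3 / 3 - w * (x - u) ^ 4 / 2 + (x - u) ^ 5 / 5)" for x
    define h' where "h' x = l + c * (w\<^sup>2 * (x - u) ^ 2 - 2 * w * (x - u) ^ 3 + (x - u) ^ 4)" for x
    define h'' where "h'' x = c * (2 * w\<^sup>2 * (x - u) - 6 * w * (x - u) ^ 2 + 4 * (x - u) ^ 3)" for x
    have "(h has_real_derivative h' x) (at x within {u..v})" for x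
      unfolding h_def[abs_def] h'_def by (auto intro!: derivative_eq_intros simp: algebra_simps)
    moreover have "(h' has_real_derivative h'' x) (at x within {u..v})" for x
      unfolding h'_def[abs_def] h''_def by (auto intro!: derivative_eq_intros simp: algebra_simps)
    moreover have "continuous_on {u..v} h''" unfolding h''_def by (intro continuous_intros)
    ultimately have "c2 {u..v} h h' h''" by (simp add: c2_def)
    moreover have "h u = u" by (simp add: h_def)
    moreover have "h v = v"
    proof -
      have "h v = u + l * w + c * (w ^ 5 / 30)"
        by (simp add: h_def w_def[symmetric] power2_eq_square power3_eq_cube power4_eq_xxxx algebra_simps eval_nat_numeral)
      also have "c * (w ^ 5 / 30) = (1 - l) * w" using w by (simp add: c_def field_simps eval_nat_numeral)
      finally show ?thesis by (simp add: w_def algebra_simps)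
    qed
    moreover have "0 < h' x" for x
    proof -
      have "w\<^sup>2 * (x - u) ^ 2 - 2 * w * (x - u) ^ 3 + (x - u) ^ 4 = ((x - u) * (w - (x - u)))\<^sup>2"
        by (simp add: power2_eq_square algebra_simps eval_nat_numeral)
      then show ?thesis using l c by (simp add: h'_def add_pos_nonneg)
    qed
    moreover have "h' u = l" "h' v = l" "h'' u = 0" "h'' v = 0"
      by (simp_all add: h'_def h''_def w_def[symmetric] power2_eq_square power3_eq_cube power4_eq_xxxx)
    ultimately show ?thesis unfolding l_def[symmetric] diffeo_def by blast
  qed
  have id: "((\<lambda>x. x) ^^ k) y = y" for k and y :: real by (induction k) auto
  show ?thesis
    unfolding approximable_def T
  proof (rule exI[of _ "\<lambda>x. x"], rule exI[of _ "\<lambda>x. 1"], rule exI[of _ "\<lambda>x. 0"], intro conjI allI impI ballI)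
    show "\<bar>0 - f'' x\<bar> \<le> 33 * \<delta>" if "x \<in> {u..v}" for x using small[OF that] by simp
    fix k :: nat and \<beta> :: real assume "k \<ge> 2" "0 = (0::real) \<longrightarrow> \<beta> = 0"
    with conj[of k] show "\<exists>h h' h''. diffeo u v h h' h'' \<and> (\<forall>x\<in>{u..v}. h x = ((\<lambda>x. x) ^^ k) (h x))
            \<and> h' u = real k powr (- 1 / real 2) \<and> h' v = real k powr (- 1 / real 2)
            \<and> h'' u = \<beta> \<and> (0 = (0::real) \<longrightarrow> h'' v = 0)"
      by (auto simp: id)
  qed (auto simp: diffeo_id)
qed

text \<open>At an end \<open>f x - x\<close> vanishes together with its derivative, so two uses of
  the mean value theorem give points arbitrarily near at which \<open>\<sigma> * f''\<close> is
  positive; continuity does the rest. The sign is what makes the parameter of a quadratic model germ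
  positive.\<close>

lemma curvature_sign:
  assumes f: "diffeo a b f f' f''" and ab: "a < b" and par: "f' a = 1" "f' b = 1"
    and sgn: "\<And>x. x \<in> {a<..<b} \<Longrightarrow> 0 < \<sigma> * (f x - x)"
  shows "0 \<le> \<sigma> * f'' a" "0 \<le> \<sigma> * f'' b"
proof -
  note c = diffeo_c2[OF f]
  have d: "((\<lambda>x. f x - x) has_real_derivative f' x - 1) (at x within {a..b})" if "x \<in> {a..b}" for x
    using c2D(1)[OF c that] by (auto intro!: derivative_eq_intros)
  have fab: "f a = a" "f b = b" using f by (auto simp: diffeo_def)
  have 1: "\<exists>y\<in>{a<..<x}. 0 < \<sigma> * f'' y" if x: "x \<in> {a<..<b}" for x
  proof -
    obtain z where z: "a < z" "z < x" "f x - x - (f a - a) = (f' z - 1) * (x - a)"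
      using mvt_within[OF d, of a x] x by auto
    obtain y where y: "a < y" "y < z" "f' z - f' a = f'' y * (z - a)"
      using mvt_within[OF c2D(2)[OF c], of a z] z x by auto
    have E: "\<sigma> * (f x - x) = (\<sigma> * f'' y) * ((z - a) * (x - a))" using z(3) y(3) par fab by simp
    have "0 < (\<sigma> * f'' y) * ((z - a) * (x - a))" using sgn[OF x] unfolding E .
    moreover have "0 < (z - a) * (x - a)" using z x by simp
    ultimately have "0 < \<sigma> * f'' y" by (metis zero_less_mult_pos2)
    then show ?thesis using y z by auto
  qed
  have 2: "\<exists>y\<in>{x<..<b}. 0 < \<sigma> * f'' y" if x: "x \<in> {a<..<b}" for x
  proof -
    obtain z where z: "x < z" "z < b" "f b - b - (f x - x) = (f' z - 1) * (b - x)"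
      using mvt_within[OF d, of x b] x by auto
    obtain y where y: "z < y" "y < b" "f' b - f' z = f'' y * (b - z)"
      using mvt_within[OF c2D(2)[OF c], of z b] z x by auto
    have "f' z - 1 = - (f'' y * (b - z))" using y(3) par by simp
    then have "f x - x = f'' y * (b - z) * (b - x)" using z(3) fab by simp
    then have E: "\<sigma> * (f x - x) = (\<sigma> * f'' y) * ((b - z) * (b - x))" by simp
    have "0 < (\<sigma> * f'' y) * ((b - z) * (b - x))" using sgn[OF x] unfolding E .
    moreover have "0 < (b - z) * (b - x)" using z x by simp
    ultimately have "0 < \<sigma> * f'' y" by (metis zero_less_mult_pos2)
    then show ?thesis using y z by auto
  qed
  have cont: "continuous_on {a..b} (\<lambda>x. \<sigma> * f'' x)" by (intro continuous_intros c2D(3)[OF c])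
  show "0 \<le> \<sigma> * f'' a"
  proof (rule ccontr)
    assume neg: "\<not> 0 \<le> \<sigma> * f'' a"
    obtain d where d: "d > 0" "\<And>x. x \<in> {a..b} \<Longrightarrow> dist x a < d \<Longrightarrow> dist (\<sigma> * f'' x) (\<sigma> * f'' a) < - (\<sigma> * f'' a)"
      using cont ab neg unfolding continuous_on_iff
      by (metis atLeastAtMost_iff less_imp_le neg_0_less_iff_less not_le order_refl)
    have "min (a + d) ((a + b) / 2) \<in> {a<..<b}"
      using d(1) ab by (auto simp: min_less_iff_disj less_max_iff_disj)
    then obtain y where y: "y \<in> {a<..<min (a + d) ((a + b) / 2)}" "0 < \<sigma> * f'' y"
      using 1 by blast
    then have "dist (\<sigma> * f'' y) (\<sigma> * f'' a) < - (\<sigma> * f'' a)"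
      using ab by (intro d(2)) (auto simp: dist_real_def)
    with y(2) show False by (simp add: dist_real_def)
  qed
  show "0 \<le> \<sigma> * f'' b"
  proof (rule ccontr)
    assume neg: "\<not> 0 \<le> \<sigma> * f'' b"
    obtain d where d: "d > 0" "\<And>x. x \<in> {a..b} \<Longrightarrow> dist x b < d \<Longrightarrow> dist (\<sigma> * f'' x) (\<sigma> * f'' b) < - (\<sigma> * f'' b)"
      using cont ab neg unfolding continuous_on_iff
      by (metis atLeastAtMost_iff less_imp_le neg_0_less_iff_less not_le order_refl)
    have "max (b - d) ((a + b) / 2) \<in> {a<..<b}"
      using d(1) ab by (auto simp: min_less_iff_disj less_max_iff_disj)
    then obtain y where y: "y \<in> {max (b - d) ((a + b) / 2)<..<b}" "0 < \<sigma> * f'' y"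
      using 2 by blast
    then have "dist (\<sigma> * f'' y) (\<sigma> * f'' b) < - (\<sigma> * f'' b)"
      using ab by (intro d(2)) (auto simp: dist_real_def)
    with y(2) show False by (simp add: dist_real_def)
  qed
qed

lemma germ''_1_0: "0 < q \<Longrightarrow> germ'' 1 q e 0 = - 2 * e / q\<^sup>2"
  by (simp add: germ''_def powr_minus powr_numeral field_simps eval_nat_numeral)

lemma germ''_2_0: "germ'' 2 q e 0 = 0"
  by (simp add: germ''_def)

lemma approximable_component:
  assumes V: "f \<in> Diff2_V" and I: "0 \<le> a" "b \<le> 1" and ab: "a < b" and fab: "f a = a" "f b = b"
    and \<sigma>: "\<sigma> = 1 \<or> \<sigma> = -1" and sgn: "\<And>x. x \<in> {a<..<b} \<Longrightarrow> 0 < \<sigma> * (f x - x)" and \<delta>: "0 < \<delta>"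
  shows "approximable (D2 f) \<delta> a b"
proof -
  let ?f'' = "D2 f" and ?T = "end_curvature (D2 f) \<delta>" and ?o = "end_order (D2 f) \<delta>"
  have f: "diffeo a b f (D1 f) ?f''" by (rule ends_agree(1)[OF V I ab fab \<sigma> sgn])
  have par: "D1 f a = 1" "D1 f b = 1"
    by (rule ends_agree(2)[OF V I ab fab \<sigma> sgn], assumption)
      (rule ends_agree(3)[OF V I ab fab \<sigma> sgn])
  have cs: "0 \<le> \<sigma> * ?f'' a" "0 \<le> \<sigma> * ?f'' b"
    by (rule curvature_sign(1)[OF f ab par sgn], assumption)
      (rule curvature_sign(2)[OF f ab par sgn])
  \<comment> \<open>For order 1 the model has second derivative
    \<open>2 * \<sigma> / \<alpha>\<close> at either end, and \<open>al\<close> solves for the value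
    \<open>f''\<close>. For order 2 it is 0 with every positive parameter, and 1 is taken.\<close>
  define al where "al x = (if \<bar>?f'' x\<bar> < \<delta> then 1 else 2 * \<sigma> / ?f'' x)" for x
  have al: "0 < al x" "germ'' (?o x) 1 (- \<sigma> / al x) 0 = ?T x" "germ'' (?o x) 1 (\<sigma> / al x) 0 = - ?T x"
    if "0 \<le> \<sigma> * ?f'' x" for x
  proof (atomize(full), cases "\<bar>?f'' x\<bar> < \<delta>")
    case True
    then show "0 < al x \<and> germ'' (?o x) 1 (- \<sigma> / al x) 0 = ?T x \<and> germ'' (?o x) 1 (\<sigma> / al x) 0 = - ?T x"
      by (simp add: al_def end_order_def end_curvature_def germ''_2_0)
  next
    case False
    then have nz: "?f'' x \<noteq> 0" using \<delta> by auto
    have "0 < 2 * \<sigma> / ?f'' x"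
      using \<sigma> nz that by (auto simp: zero_less_divide_iff)
    with False nz \<sigma> show "0 < al x \<and> germ'' (?o x) 1 (- \<sigma> / al x) 0 = ?T x \<and> germ'' (?o x) 1 (\<sigma> / al x) 0 = - ?T x"
      by (auto simp: al_def end_order_def end_curvature_def germ''_1_0[unfolded One_nat_def] field_simps)
  qed
  have T: "\<bar>?T x - ?f'' x\<bar> < \<delta>" for x using \<delta> by (simp add: end_curvature_def)
  have o: "1 \<le> ?o x" for x by (simp add: end_order_def)
  have \<delta>a: "\<bar>germ'' (?o a) 1 (- \<sigma> / al a) 0 - ?f'' a\<bar> < \<delta>" using al(2)[OF cs(1)] T by simp
  have \<delta>b: "\<bar>germ'' (?o b) 1 (\<sigma> / al b) 0 + ?f'' b\<bar> < \<delta>"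
    using al(3)[OF cs(2)] T[of b] by (simp add: abs_minus_commute)
  obtain K K' K'' \<epsilon> d d' g g' g'' where tc: "time_coordinate a b K K' K'' \<epsilon> (al a) (al b) d d' (?o a) (?o b)"
    and g: "diffeo a b g g' g''" "\<And>x. x \<in> {a<..<b} \<Longrightarrow> K (g x) = K x + \<sigma>" "g' a = 1" "g' b = 1"
    "g'' a = germ'' (?o a) 1 (- \<sigma> / al a) 0" "g'' b = - germ'' (?o b) 1 (\<sigma> / al b) 0"
    "\<And>x. x \<in> {a..b} \<Longrightarrow> \<bar>g'' x - ?f'' x\<bar> \<le> 33 * \<delta>"
    by (rule component_perturbation[OF V I ab fab \<sigma> sgn o o al(1)[OF cs(1)] al(1)[OF cs(2)] \<delta>a \<delta>b], assumption) (rule that)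
  interpret T: time_coordinate a b K K' K'' \<epsilon> "al a" "al b" d d' "?o a" "?o b" by (rule tc)
  have gI: "(g ^^ j) x \<in> {a<..<b} \<and> K ((g ^^ j) x) = K x + real j * \<sigma>" if "x \<in> {a<..<b}" for j x
    by (induction j) (use that g(2) diffeo_interval(2)[OF g(1)] in \<open>auto simp: algebra_simps\<close>)
  have gab: "g a = a" "g b = b" using g(1) by (auto simp: diffeo_def)
  have gab': "(g ^^ j) a = a" "(g ^^ j) b = b" for j by (induction j) (use gab in auto)
  have conj: "\<exists>h h' h''. diffeo a b h h' h'' \<and> (\<forall>x\<in>{a..b}. h (g x) = (g ^^ k) (h x))
      \<and> h' a = real k powr (- 1 / real (?o a)) \<and> h' b = real k powr (- 1 / real (?o b))
      \<and> h'' a = \<beta> \<and> (?T b = 0 \<longrightarrow> h'' b = 0)" if k: "k \<ge> 2" and \<beta>: "?T a = 0 \<longrightarrow> \<beta> = 0" for k :: nat and \<beta>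
  proof -
    \<comment> \<open>Solves \<open>- 2 * e / k^2 = \<beta>\<close>, the second derivative of an
      order 1 germ with slope \<open>k\<close>, for the \<open>s\<close> contained in
      \<open>e = - ((k - 1) * d + s) / al a\<close>.\<close>
    define s where "s = al a * \<beta> * (real k)\<^sup>2 / 2 - (real k - 1) * d"
    have k0: "0 < real k" using k by simp
    obtain h h' h'' where h: "diffeo a b h h' h''"
      "\<And>x. x \<in> {a<..<b} \<Longrightarrow> h x \<in> {a<..<b} \<and> K (h x) = real k * K x + s"
      "h' a = real k powr (- 1 / real (?o a))" "h' b = real k powr (- 1 / real (?o b))"
      "h'' a = germ'' (?o a) (real k) (- ((real k - 1) * d + s) / al a) 0"
      "h'' b = - germ'' (?o b) (real k) (((real k - 1) * d' + s) / al b) 0"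
      using T.affine_map[OF k0, of s] by metis
    have "h'' a = \<beta>"
    proof (cases "\<bar>?f'' a\<bar> < \<delta>")
      case True
      then show ?thesis using h(5) \<beta> by (simp add: end_order_def end_curvature_def germ''_2_0)
    next
      case False
      have "- ((real k - 1) * d + s) / al a = - (\<beta> * (real k)\<^sup>2 / 2)"
        using al(1)[OF cs(1)] by (simp add: s_def field_simps)
      then show ?thesis using h(5) False k0 by (simp add: end_order_def end_curvature_def germ''_1_0[unfolded One_nat_def])
    qed
    moreover have "h'' b = 0" if "?T b = 0"
    proof -
      have "\<bar>?f'' b\<bar> < \<delta>" using that \<delta> by (auto simp: end_curvature_def split: if_splits)
      then show ?thesis using h(6) by (simp add: end_order_def germ''_2_0)
    qed
    moreover have "h (g x) = (g ^^ k) (h x)" if x: "x \<in> {a..b}" for x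
    proof -
      consider "x = a" | "x = b" | "x \<in> {a<..<b}" using x by force
      then show ?thesis
      proof cases
        case 3
        have gx: "g x \<in> {a<..<b}" using diffeo_interval(2)[OF g(1) 3] .
        have hx: "h x \<in> {a<..<b}" using h(2)[OF 3] by blast
        \<comment> \<open>In the coordinate, translation by \<sigma> followed by
          \<open>k * t + s\<close> equals \<open>k * t + s\<close> followed by translation by
          \<open>k * \<sigma>\<close>.\<close>
        have "K (h (g x)) = K ((g ^^ k) (h x))"
          using h(2)[OF gx] g(2)[OF 3] gI[OF hx, of k] h(2)[OF 3] by (simp add: algebra_simps)
        then show ?thesis using T.K_inj[of "h (g x)" "(g ^^ k) (h x)"] h(2)[OF gx] gI[OF hx, of k] by blast
      qed (use h(1) gab gab' in \<open>auto simp: diffeo_def\<close>)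
    qed
    ultimately show ?thesis using h(1,3,4) by blast
  qed
  show ?thesis
    unfolding approximable_def
  proof (rule exI[of _ g], rule exI[of _ g'], rule exI[of _ g''], intro conjI allI impI ballI)
    show "g'' a = ?T a" "g'' b = ?T b" using g(5,6) al(2)[OF cs(1)] al(3)[OF cs(2)] by simp_all
  qed (use g conj in auto)
qed

text \<open>A supremum argument: the supremum of the fixed points reachable from 0 is reachable by a
  flat piece, and below 1 it could be passed by a whole component.\<close>

lemma approximable_unit:
  assumes V: "f \<in> Diff2_V" and \<delta>: "0 < \<delta>"
  shows "approximable (D2 f) \<delta> 0 1"
proof -
  let ?A = "approximable (D2 f) \<delta>"
  have fD: "f \<in> Diff2" using V by (simp add: Diff2_V_def)
  note f = Diff2_dif[OF fD]
  note c = diffeo_c2[OF f]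
  have "uniformly_continuous_on {0..1} (D2 f)"
    using c2D(3)[OF c] by (simp add: compact_uniformly_continuous)
  then obtain \<epsilon> where \<epsilon>: "0 < \<epsilon>" "\<And>x y. x \<in> {0..1} \<Longrightarrow> y \<in> {0..1} \<Longrightarrow> \<bar>x - y\<bar> < \<epsilon> \<Longrightarrow> \<bar>D2 f x - D2 f y\<bar> < \<delta>"
    using \<delta> unfolding uniformly_continuous_on_def dist_real_def by metis
  \<comment> \<open>Both fixed points are parabolic, so \<open>D2 f\<close> vanishes between them
    and is small on the whole short interval. Accumulating fixed points are thereby
    harmless.\<close>
  have near: "?A u v" if u: "u \<in> {0..1}" "f u = u" and v: "v \<in> {0..1}" "f v = v" and uv: "u < v" "v - u < \<epsilon>" for u v
  proof (rule approximable_flat[OF uv(1)])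
    obtain z where z: "u < z" "z < v" "D1 f v - D1 f u = D2 f z * (v - u)"
      using mvt_within[OF c2D(2)[OF c], of u v] u v uv by auto
    then have "D2 f z = 0" using Diff2_V_parabolic[OF V u] Diff2_V_parabolic[OF V v] uv by simp
    then show "\<bar>D2 f x\<bar> < \<delta>" if "x \<in> {u..v}" for x
      using \<epsilon>(2)[of x z] that z u v uv by (simp add: abs_less_iff)
  qed
  have comp: "?A u v" if u: "u \<in> {0..1}" "f u = u" and v: "v \<in> {0..1}" "f v = v" and uv: "u < v"
    and no: "\<And>x. x \<in> {u<..<v} \<Longrightarrow> f x \<noteq> x" for u v
  proof -
    let ?p = "(u + v) / 2"
    have pI: "?p \<in> {u<..<v}" using uv by auto
    have cont: "continuous_on {u<..<v} (\<lambda>x. f x - x)"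
      by (intro continuous_intros continuous_on_subset[OF c2D(5)[OF c]]) (use u v in auto)
    have conn: "connected ((\<lambda>x. f x - x) ` {u<..<v})"
      by (rule connected_continuous_image[OF cont]) simp
    have z: "0 \<notin> (\<lambda>x. f x - x) ` {u<..<v}" using no by auto
    have same: "(0 < f x - x) = (0 < f ?p - ?p)" if x: "x \<in> {u<..<v}" for x
    proof (rule ccontr)
      assume ne: "(0 < f x - x) \<noteq> (0 < f ?p - ?p)"
      have "0 \<in> closed_segment A B" if "(0 < A) \<noteq> (0 < B)" for A B :: real
        using that by (auto simp: closed_segment_eq_real_ivl)
      from this[OF ne] have "0 \<in> closed_segment (f x - x) (f ?p - ?p)" .
      moreover have "closed_segment (f x - x) (f ?p - ?p) \<subseteq> (\<lambda>x. f x - x) ` {u<..<v}"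
        using conn x pI unfolding is_interval_connected_1[symmetric] is_interval_convex_1 convex_contains_segment
        by blast
      ultimately show False using z by blast
    qed
    show ?thesis
    proof (rule approximable_component[OF V, of u v "if 0 < f ?p - ?p then 1 else -1"])
      fix x assume x: "x \<in> {u<..<v}"
      show "0 < (if 0 < f ?p - ?p then 1 else - 1) * (f x - x)"
        using same[OF x] no[OF x] by auto
    qed (use u v uv \<delta> in auto)
  qed
  define Fix where "Fix = {x \<in> {0..1}. f x = x}"
  have closed_Fix: "closed Fix"
  proof -
    have "closed {x \<in> {0..1}. f x - x \<in> {0}}"
      using continuous_closed_preimage[OF continuous_on_diff[OF c2D(5)[OF c] continuous_on_id], of "{0}"]
      by (simp add: vimage_def Int_def)
    then show ?thesis by (simp add: Fix_def)
  qed
  have f01: "f 0 = 0" "f 1 = 1" using Diff2_endpoints[OF fD] by auto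
  \<comment> \<open>0 is included by hand, since the pieces to be glued have positive
    length.\<close>
  define S where "S = {v \<in> Fix. v = 0 \<or> ?A 0 v}"
  define s where "s = Sup S"
  have S: "0 \<in> S" "bdd_above S" using f01 by (auto simp: S_def Fix_def intro!: bdd_aboveI[of _ 1])
  have extend: "v \<in> S" if "u \<in> S" "v \<in> Fix" "u < v" "?A u v" for u v
    using that approximable_glue[of "D2 f" \<delta> 0 u v] by (cases "u = 0") (auto simp: S_def Fix_def)
  have "s \<in> closure S" unfolding s_def using S by (intro closure_contains_Sup) auto
  moreover have "closure S \<subseteq> Fix" using closed_Fix by (intro closure_minimal) (auto simp: S_def)
  ultimately have sF: "s \<in> Fix" by blast
  have sS: "s \<in> S"
  proof -
    obtain v where v: "v \<in> S" "s - \<epsilon> < v" using less_cSup_iff[OF _ S(2), of "s - \<epsilon>"] S(1) \<epsilon>(1) by (auto simp: s_def)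
    have "v \<le> s" unfolding s_def using v(1) S(2) by (rule cSup_upper)
    show ?thesis
    proof (cases "v = s")
      case False
      then show ?thesis using v sF \<open>v \<le> s\<close> near[of v s] extend[of v s] by (auto simp: S_def Fix_def)
    qed (use v in simp)
  qed
  have no_ext: False if "v \<in> Fix" "s < v" "?A s v" for v
  proof -
    have "v \<in> S" using extend[OF sS] that by blast
    then have "v \<le> s" unfolding s_def using S(2) by (rule cSup_upper)
    with that show False by simp
  qed
  have "s = 1"
  proof (rule ccontr)
    assume "s \<noteq> 1"
    then have s1: "s < 1" using sF by (auto simp: Fix_def)
    \<comment> \<open>A fixed point closer to \<open>s\<close> would allow a flat extension. So
      there is a next fixed point, and the interval up to it is a component.\<close>
    have gap: "s + \<epsilon> \<le> v" if "v \<in> Fix" "s < v" for v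
      using no_ext[OF that] near[of s v] that sF by (force simp: Fix_def)
    define F where "F = Fix \<inter> {s + \<epsilon>..}"
    define b where "b = Inf F"
    have F: "1 \<in> F" "bdd_below F" "closed F"
      using gap[of 1] s1 f01 closed_Fix by (auto simp: F_def Fix_def intro!: bdd_belowI[of _ 0])
    have bF: "b \<in> F" unfolding b_def using F by (intro closed_contains_Inf) auto
    have "?A s b"
    proof (rule comp)
      show "s < b" using bF \<epsilon>(1) by (simp add: F_def)
      fix x assume x: "x \<in> {s<..<b}"
      show "f x \<noteq> x"
      proof
        assume "f x = x"
        moreover have "x \<in> {0..1}" using x sF bF by (auto simp: Fix_def F_def)
        ultimately have "x \<in> F" using gap[of x] x by (auto simp: F_def Fix_def)
        then have "b \<le> x" unfolding b_def using F(2) by (rule cInf_lower)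
        with x show False by simp
      qed
    qed (use sF bF in \<open>auto simp: Fix_def F_def\<close>)
    then show False using no_ext[of b] bF \<epsilon>(1) by (auto simp: F_def)
  qed
  with sS show ?thesis by (auto simp: S_def)
qed

lemma conj_to_powers_dense:
  assumes V: "f \<in> Diff2_V" and r: "0 < r"
  obtains g where "g \<in> conj_to_powers" "C2_dist f g < r"
proof -
  \<comment> \<open>The closeness obtained is \<open>33 * \<delta>\<close>; 34 makes the final
    inequality strict.\<close>
  define \<delta> where "\<delta> = r / 34"
  have \<delta>: "0 < \<delta>" using r by (simp add: \<delta>_def)
  have fD: "f \<in> Diff2" using V by (simp add: Diff2_V_def)
  obtain g g' g'' where g: "diffeo 0 1 g g' g''" and close: "\<forall>x\<in>{0..1}. \<bar>g'' x - D2 f x\<bar> \<le> 33 * \<delta>"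
    and ex: "\<forall>k::nat. k \<ge> 2 \<longrightarrow> (\<forall>\<beta>. (end_curvature (D2 f) \<delta> 0 = 0 \<longrightarrow> \<beta> = 0) \<longrightarrow>
         (\<exists>h h' h''. diffeo 0 1 h h' h'' \<and> (\<forall>x\<in>{0..1}. h (g x) = (g ^^ k) (h x))
            \<and> h' 0 = real k powr (- 1 / real (end_order (D2 f) \<delta> 0))
            \<and> h' 1 = real k powr (- 1 / real (end_order (D2 f) \<delta> 1))
            \<and> h'' 0 = \<beta> \<and> (end_curvature (D2 f) \<delta> 1 = 0 \<longrightarrow> h'' 1 = 0)))"
    using approximable_unit[OF V \<delta>] unfolding approximable_def by (elim exE conjE) (rule that)
  \<comment> \<open>The parameter \<open>\<beta> = 0\<close> is always admissible.\<close>
  have conj: "\<exists>h h' h''. diffeo 0 1 h h' h'' \<and> (\<forall>x\<in>{0..1}. h (g x) = (g ^^ k) (h x))" if "k \<ge> 2" for k :: nat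
    using ex[rule_format, OF that, of 0] by blast
  define G where "G = restrict g {0..1}"
  have G: "G \<in> Diff2" unfolding G_def by (rule diffeo_Diff2(1)[OF g])
  obtain x where x: "x \<in> {0..1}" "C2_dist f G = \<bar>D2 f x - D2 G x\<bar>" using C2_dist_attained[OF fD G] .
  have "C2_dist f G \<le> 33 * \<delta>"
    using x close diffeo_Diff2(3)[OF g x(1)] by (simp add: G_def abs_minus_commute)
  then have "C2_dist f G < r" using r by (simp add: \<delta>_def)
  moreover have "G \<in> conj_to_powers"
    unfolding conj_to_powers_def
  proof (intro CollectI conjI allI impI G)
    fix k :: nat assume "2 \<le> k"
    then obtain h h' h'' where h: "diffeo 0 1 h h' h''" "\<forall>x\<in>{0..1}. h (g x) = (g ^^ k) (h x)" using conj by blast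
    define H where "H = restrict h {0..1}"
    have H: "H \<in> Diff2" unfolding H_def by (rule diffeo_Diff2(1)[OF h(1)])
    have Gk: "G [^]\<^bsub>BG\<^esub> k \<in> Diff2" using G by simp
    \<comment> \<open>In this form the equation can be checked pointwise without evaluating the
      inverse of \<open>H\<close>; cancellation in the group gives the conjugacy.\<close>
    have "H \<otimes>\<^bsub>BG\<^esub> G = (G [^]\<^bsub>BG\<^esub> k) \<otimes>\<^bsub>BG\<^esub> H"
      unfolding BG_mult[OF H G] BG_mult[OF Gk H]
    proof (rule extensionalityI)
      fix x :: real assume x: "x \<in> {0..1}"
      have gx: "g x \<in> {0..1}" and hx: "h x \<in> {0..1}" using diffeo_interval(1)[OF g x] diffeo_interval(1)[OF h(1) x] .
      have "(G ^^ k) (h x) = (g ^^ k) (h x)"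
        by (rule funpow_cong_on[OF _ diffeo_interval(1)[OF g] hx]) (simp add: G_def)
      then show "compose {0..1} H G x = compose {0..1} (G [^]\<^bsub>BG\<^esub> k) H x"
        using x gx hx h(2) Diff2_pow_apply(1)[OF G hx, of k] by (simp add: compose_def G_def H_def)
    qed (simp_all add: compose_extensional)
    then have "H \<otimes>\<^bsub>BG\<^esub> G \<otimes>\<^bsub>BG\<^esub> inv\<^bsub>BG\<^esub> H = G [^]\<^bsub>BG\<^esub> k"
      using H Gk Diff2_closed(2)[OF H] by (simp add: BG.m_assoc Diff2_Bij)
    with H show "\<exists>h\<in>Diff2. h \<otimes>\<^bsub>BG\<^esub> G \<otimes>\<^bsub>BG\<^esub> inv\<^bsub>BG\<^esub> h = G [^]\<^bsub>BG\<^esub> k" by blast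
  qed
  ultimately show thesis using that by blast
qed

theorem theorem4:
  shows "conj_to_powers \<subseteq> Diff2_V
    \<and> subtopology Diff2_topology Diff2_V closure_of conj_to_powers = Diff2_V"
proof
  show sub: "conj_to_powers \<subseteq> Diff2_V" by (rule conj_to_powers_subset)
  interpret M: Metric_space Diff2 C2_dist by (rule Diff2_Metric_space)
  have D: "Diff2_V \<subseteq> Diff2" by (auto simp: Diff2_V_def)
  have "Diff2_V \<subseteq> Diff2_topology closure_of conj_to_powers"
    unfolding Diff2_topology_def M.metric_closure_of
  proof (intro subsetI CollectI conjI allI impI)
    fix f r assume f: "f \<in> Diff2_V"
    then show "f \<in> Diff2" using D by blast
    assume "0 < (r::real)"
    with f obtain g where "g \<in> conj_to_powers" "C2_dist f g < r" using conj_to_powers_dense by blast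
    with f sub D show "\<exists>y\<in>conj_to_powers. y \<in> M.mball f r" by (intro bexI[of _ g]) auto
  qed
  then show "subtopology Diff2_topology Diff2_V closure_of conj_to_powers = Diff2_V"
    using sub by (auto simp: closure_of_subtopology Int_absorb1)
qed

end
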